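(* Let $\Omega\subset\mathbb{R}^n$ be open and bounded and $\Omega'\Subset\Omega$. Let $s\in(0,1)$, $p\in(1,+\infty)$ and $f\in L^p(\Omega)$. Let $u\in L^p(\mathbb{R}^n)$ be a distributional solution of $(1-\Delta)^su=f$ in $\Omega$. Then (the restriction of) $u$ belongs to $\mathcal{L}^p_{2s}(\Omega')$ and $\|u\|_{\mathcal{L}^p_{2s}(\Omega')}\le C\big(\|f\|_{L^p(\Omega)}+\|u\|_{L^p(\mathbb{R}^n)}\big)$ for a constant $C>0$ depending only on $n$, $s$, $p$, $\Omega$ and $\Omega'$.
   Context: $(1-\Delta)^s\varphi:=\mathcal{F}^{-1}((1+4\pi^2|\xi|^2)^s\widehat\varphi)$, $\widehat\varphi(\xi)=\int\varphi(x)e^{-2\pi ix\cdot\xi}dx$. Distributional solution in $\Omega$: $\int_{\mathbb{R}^n}u\,(1-\Delta)^s\varphi\,dx=\int_\Omega f\varphi\,dx$ for all $\varphi\in C^\infty_c(\Omega)$. Bessel potential space: $\mathcal{L}^p_{2s}(\mathbb{R}^n):=\{v\in L^p(\mathbb{R}^n): v=\mathcal{B}^{(s)}*g,\ g\in L^p\}$ with norm $\|g\|_{L^p}$, where $\mathcal{B}^{(s)}$ is the integrable function with Fourier transform $(1+4\pi^2|\xi|^2)^{-s}$. Local version: $\mathcal{L}^p_{2s}(\Omega')$ is the set of functions on $\Omega'$ that are restrictions of elements of $\mathcal{L}^p_{2s}(\mathbb{R}^n)$, with $\|v\|_{\mathcal{L}^p_{2s}(\Omega')}:=\inf\{\|\tilde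 v\|_{\mathcal{L}^p_{2s}(\mathbb{R}^n)}:\ \tilde v\in\mathcal{L}^p_{2s}(\mathbb{R}^n),\ \tilde v=v \text{ in }\Omega'\}$. *)

theory Defs
  imports "HOL-Analysis.Analysis"
begin

coinductive smooth_fun :: "('a::euclidean_space \<Rightarrow> real) \<Rightarrow> bool" where
  "f differentiable_on UNIV \<Longrightarrow> (\<forall>v. smooth_fun (\<lambda>x. frechet_derivative f (at x) v))
     \<Longrightarrow> smooth_fun f"

definition tsupport :: "('a::euclidean_space \<Rightarrow> real) \<Rightarrow> 'a set" where
  "tsupport \<phi> = closure {x. \<phi> x \<noteq> 0}"

definition test_fun :: "'a::euclidean_space set \<Rightarrow> ('a \<Rightarrow> real) \<Rightarrow> bool" where
  "test_fun \<Omega> \<phi> \<longleftrightarrow> smooth_fun \<phi> \<and> compact (tsupport \<phi>) \<and> tsupport \<phi> \<subseteq> \<Omega>"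

definition fourier :: "('a::euclidean_space \<Rightarrow> complex) \<Rightarrow> 'a \<Rightarrow> complex" where
  "fourier g \<xi> = (LINT x|lborel. g x * cis (- 2 * pi * (x \<bullet> \<xi>)))"

definition ifourier :: "('a::euclidean_space \<Rightarrow> complex) \<Rightarrow> 'a \<Rightarrow> complex" where
  "ifourier h x = (LINT \<xi>|lborel. h \<xi> * cis (2 * pi * (x \<bullet> \<xi>)))"

definition bessel_op :: "real \<Rightarrow> ('a::euclidean_space \<Rightarrow> real) \<Rightarrow> 'a \<Rightarrow> complex" where
  "bessel_op s \<phi> = ifourier (\<lambda>\<xi>. complex_of_real ((1 + 4 * pi\<^sup>2 * (norm \<xi>)\<^sup>2) powr s)
                                    * fourier (\<lambda>x. complex_of_real (\<phi> x)) \<xi>)"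

definition dist_solution :: "real \<Rightarrow> 'a::euclidean_space set \<Rightarrow> ('a \<Rightarrow> real) \<Rightarrow> ('a \<Rightarrow> real) \<Rightarrow> bool" where
  "dist_solution s \<Omega> f u \<longleftrightarrow>
     (\<forall>\<phi>. test_fun \<Omega> \<phi> \<longrightarrow>
        (LINT x|lborel. complex_of_real (u x) * bessel_op s \<phi> x)
          = complex_of_real (LINT x|lborel. indicator \<Omega> x * f x * \<phi> x))"

definition Lp_on :: "'a::euclidean_space set \<Rightarrow> real \<Rightarrow> ('a \<Rightarrow> real) \<Rightarrow> bool" where
  "Lp_on A p v \<longleftrightarrow> (\<lambda>x. indicator A x * v x) \<in> borel_measurable lborel
      \<and> (\<integral>\<^sup>+ x. ennreal (indicator A x * \<bar>v x\<bar> powr p) \<partial>lborel) < \<infinity>"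

definition Lp_norm_on :: "'a::euclidean_space set \<Rightarrow> real \<Rightarrow> ('a \<Rightarrow> real) \<Rightarrow> real" where
  "Lp_norm_on A p v = enn2real (\<integral>\<^sup>+ x. ennreal (indicator A x * \<bar>v x\<bar> powr p) \<partial>lborel) powr (1 / p)"

definition bessel_kernel :: "real \<Rightarrow> 'a::euclidean_space \<Rightarrow> real" where
  "bessel_kernel s = (SOME B. integrable lborel B \<and>
      (\<forall>\<xi>. fourier (\<lambda>x. complex_of_real (B x)) \<xi>
             = complex_of_real ((1 + 4 * pi\<^sup>2 * (norm \<xi>)\<^sup>2) powr (- s))))"

definition conv :: "('a::euclidean_space \<Rightarrow> real) \<Rightarrow> ('a \<Rightarrow> real) \<Rightarrow> 'a \<Rightarrow> real" where
  "conv B g x = (LINT y|lborel. B (x - y) * g y)"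

definition bessel_rep :: "real \<Rightarrow> real \<Rightarrow> ('a::euclidean_space \<Rightarrow> real) \<Rightarrow> ('a \<Rightarrow> real) \<Rightarrow> bool" where
  "bessel_rep s p v g \<longleftrightarrow> Lp_on UNIV p g \<and> (AE x in lborel. v x = conv (bessel_kernel s) g x)"

definition bessel_space :: "real \<Rightarrow> real \<Rightarrow> ('a::euclidean_space \<Rightarrow> real) set" where
  "bessel_space s p = {v. Lp_on UNIV p v \<and> (\<exists>g. bessel_rep s p v g)}"

definition bessel_norm :: "real \<Rightarrow> real \<Rightarrow> ('a::euclidean_space \<Rightarrow> real) \<Rightarrow> real" where
  "bessel_norm s p v = Inf {Lp_norm_on UNIV p g | g. bessel_rep s p v g}"

definition loc_bessel_space :: "real \<Rightarrow> real \<Rightarrow> 'a::euclidean_space set \<Rightarrow> ('a \<Rightarrow> real) set" where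
  "loc_bessel_space s p A = {v. \<exists>w \<in> bessel_space s p. AE x in lborel. x \<in> A \<longrightarrow> w x = v x}"

definition loc_bessel_norm :: "real \<Rightarrow> real \<Rightarrow> 'a::euclidean_space set \<Rightarrow> ('a \<Rightarrow> real) \<Rightarrow> real" where
  "loc_bessel_norm s p A v = Inf {bessel_norm s p w | w. w \<in> bessel_space s p \<and>
                                     (AE x in lborel. x \<in> A \<longrightarrow> w x = v x)}"

end

theory Submission
  imports Defs "HOL-Probability.Probability"
begin

text \<open>
  The proof is a parametrix argument, with no Calderon--Zygmund theory. Let \<open>w = 1 + 4\<pi>\<^sup>2|\<xi>|\<^sup>2\<close> and let \<open>B\<close> be
  the Bessel kernel of order \<open>2s\<close>. Cutting \<open>B\<close> off outside a small ball gives a kernel \<open>B0\<close> of small support,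
  and \<open>B - B0\<close> is smooth with rapidly decreasing derivatives, so \<open>(1 - \<Delta>) (B - B0)\<close> and
  \<open>(1 - \<Delta>)\<^sup>2 (B - B0)\<close> are integrable. Convolving them with the Bessel kernel of order \<open>2 - 2s\<close> once and
  twice gives integrable kernels \<open>R\<close> and \<open>H\<close> with Fourier transforms \<open>w\<^sup>s (B - B0)\<close> and \<open>w\<^bsup>2s\<^esup> (B - B0)\<close>
  (transforms of \<open>B\<close>, \<open>B0\<close> understood), that is, \<open>B - B0 = B * R\<close> and \<open>R = B * H\<close>.

  For a mollifier \<open>\<psi>\<close> near \<open>\<Omega>'\<close>, \<open>B0 * \<psi>\<close> is a test function in \<open>\<Omega>\<close> and
  \<open>(1 - \<Delta>)\<^sup>s (B0 * \<psi>) = \<psi> - R * \<psi>\<close>. Testing the equation with it gives \<open>u = B0 * f + R * u\<close> near \<open>\<Omega>'\<close>,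
  hence \<open>u = B * (f - R * f + H * u)\<close> there, and Young's inequality bounds the function in parentheses.
\<close>

section \<open>Lebesgue measure and Gaussians\<close>

text \<open>The kernel is cut off, not the solution: a cutoff on \<open>u\<close> would leave a
  commutator with a nonlocal operator, whereas \<open>B0 * \<psi>\<close> is an admissible test
  function with an explicit image. The price is that \<open>R * u\<close> sees \<open>u\<close> on
  the whole space, so the global norm of \<open>u\<close> enters the estimate. The identity
  \<open>u = B0 * f + R * u\<close> does not yet show membership in the Bessel space: each term has
  to be \<open>B\<close> convolved with an \<open>L^p\<close> function. The first term needs only
  \<open>B0 = B - B * R\<close>. The second needs \<open>R\<close> itself to be divisible by
  \<open>B\<close>, which costs the second application of \<open>1 - \<Delta>\<close> and produces
  \<open>H\<close>. The symbol \<open>w powr s\<close> grows and is not the transform of an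
  integrable kernel. The splitting \<open>w powr s = w powr (s - 1) * w\<close> separates an
  integrable kernel, which exists because \<open>s < 1\<close>, from a differential operator that
  only ever hits the smooth, rapidly decreasing part of \<open>B\<close>. So only convolutions with
  integrable functions act on \<open>f\<close> and \<open>u\<close>, and the constant is governed by
  \<open>p\<close> and the \<open>L^1\<close> norms of \<open>R\<close> and
  \<open>H\<close>.\<close>

lemma borel_measurable_cis [measurable]: "cis \<in> borel_measurable borel"
  by (intro borel_measurable_continuous_onI continuous_intros)

lemma distr_lborel_translate:
  "distr lborel borel (\<lambda>x. a + x) = (lborel :: 'a::euclidean_space measure)"
  using lborel_affine[of 1 a] by (simp add: density_1)

lemma distr_lborel_reflect:
  "distr lborel borel (\<lambda>x. a - x) = (lborel :: 'a::euclidean_space measure)"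
  using lborel_affine[of "-1" a] by (simp add: density_1)

lemma integral_translate:
  fixes f :: "'a::euclidean_space \<Rightarrow> 'b::{banach,second_countable_topology}"
  assumes "f \<in> borel_measurable borel"
  shows "(LINT x|lborel. f (a + x)) = (LINT x|lborel. f x)"
  using integral_distr[of "\<lambda>x. a + x" lborel borel f] assms by (simp add: distr_lborel_translate)

lemma integral_reflect_at:
  fixes f :: "'a::euclidean_space \<Rightarrow> 'b::{banach,second_countable_topology}"
  assumes "f \<in> borel_measurable borel"
  shows "(LINT x|lborel. f (a - x)) = (LINT x|lborel. f x)"
  using integral_distr[of "\<lambda>x. a - x" lborel borel f] assms by (simp add: distr_lborel_reflect)

lemma integrable_translate:
  fixes f :: "'a::euclidean_space \<Rightarrow> 'b::{banach,second_countable_topology}"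
  assumes "integrable lborel f"
  shows "integrable lborel (\<lambda>x. f (a + x))"
  using integrable_distr[of "\<lambda>x. a + x" lborel borel f] assms by (simp add: distr_lborel_translate)

lemma integrable_reflect_at:
  fixes f :: "'a::euclidean_space \<Rightarrow> 'b::{banach,second_countable_topology}"
  assumes "integrable lborel f"
  shows "integrable lborel (\<lambda>x. f (a - x))"
  using integrable_distr[of "\<lambda>x. a - x" lborel borel f] assms by (simp add: distr_lborel_reflect)

lemma AE_reflect_at:
  assumes "AE x in (lborel :: 'a::euclidean_space measure). P x"
  shows "AE x in lborel. P (a - x)"
proof -
  from assms obtain N where N: "N \<in> null_sets lborel" "{x. \<not> P x} \<subseteq> N"
    by (auto elim!: AE_E simp: null_sets_def)
  have "AE x in distr lborel borel (\<lambda>x. a - x). x \<notin> N"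
    using N by (simp add: distr_lborel_reflect AE_not_in)
  then have "AE x in lborel. a - x \<notin> N"
    using N by (subst (asm) AE_distr_iff) auto
  then show ?thesis using N by (auto elim: eventually_mono)
qed

text \<open>The substitution \<open>sqrt (2 * c) * x\<close> turns the characteristic function of
  the standard normal distribution into this integral.\<close>

lemma gaussian_fourier_real:
  fixes c t :: real
  assumes "0 < c"
  shows "integrable lborel (\<lambda>x. complex_of_real (exp (- c * x\<^sup>2)) * cis (x * t))"
    and "(LINT x|lborel. complex_of_real (exp (- c * x\<^sup>2)) * cis (x * t))
           = complex_of_real (sqrt (pi / c) * exp (- t\<^sup>2 / (4 * c)))"
proof -
  let ?h = "\<lambda>x. complex_of_real (std_normal_density x) * cis (x * (t / sqrt (2 * c)))"
  have i: "integrable lborel ?h"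
    by (rule Bochner_Integration.integrable_bound[of _ std_normal_density])
       (auto simp: norm_mult)
  have v: "(LINT x|lborel. ?h x) = exp (- (t / sqrt (2 * c))\<^sup>2 / 2)"
    using fun_cong[OF char_std_normal_distribution, of "t / sqrt (2 * c)"]
    by (simp add: char_def integral_density cis_conv_exp scaleR_conv_of_real mult_ac exp_of_real[symmetric])
  have *: "(\<lambda>x. ?h (0 + sqrt (2 * c) * x)) = (\<lambda>x. complex_of_real (1 / sqrt (2 * pi)) * (complex_of_real (exp (- c * x\<^sup>2)) * cis (x * t)))"
    using assms by (auto simp: std_normal_density_def fun_eq_iff power_mult_distrib mult_ac)
  have "integrable lborel (\<lambda>x. ?h (0 + sqrt (2 * c) * x))"
    using assms i by (subst lborel_integrable_real_affine_iff) auto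
  then show "integrable lborel (\<lambda>x. complex_of_real (exp (- c * x\<^sup>2)) * cis (x * t))"
    unfolding * using integrable_mult_right[of "complex_of_real (sqrt (2 * pi))" lborel
        "\<lambda>x. complex_of_real (1 / sqrt (2 * pi)) * (complex_of_real (exp (- c * x\<^sup>2)) * cis (x * t))"]
    by (simp add: field_simps)
  have "(LINT x|lborel. ?h x) = sqrt (2 * c) *\<^sub>R (LINT x|lborel. ?h (0 + sqrt (2 * c) * x))"
    using assms lborel_integral_real_affine[of "sqrt (2 * c)" ?h 0] by simp
  also have "\<dots> = complex_of_real (sqrt (2 * c) / sqrt (2 * pi)) * (LINT x|lborel. complex_of_real (exp (- c * x\<^sup>2)) * cis (x * t))"
    unfolding * by (simp add: scaleR_conv_of_real)
  also have "sqrt (2 * c) / sqrt (2 * pi) = sqrt (c / pi)" by (simp add: real_sqrt_mult real_sqrt_divide)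
  finally have "complex_of_real (sqrt (c / pi)) * (LINT x|lborel. complex_of_real (exp (- c * x\<^sup>2)) * cis (x * t))
      = complex_of_real (exp (- t\<^sup>2 / (4 * c)))" 
    unfolding v using assms by (simp add: power_divide)
  then have "complex_of_real (sqrt (pi / c)) * (complex_of_real (sqrt (c / pi)) * (LINT x|lborel. complex_of_real (exp (- c * x\<^sup>2)) * cis (x * t)))
      = complex_of_real (sqrt (pi / c) * exp (- t\<^sup>2 / (4 * c)))" by simp
  moreover have "complex_of_real (sqrt (pi / c)) * complex_of_real (sqrt (c / pi)) = 1"
    using assms by (simp add: of_real_mult[symmetric] real_sqrt_mult[symmetric] del: of_real_mult)
  ultimately show "(LINT x|lborel. complex_of_real (exp (- c * x\<^sup>2)) * cis (x * t))
           = complex_of_real (sqrt (pi / c) * exp (- t\<^sup>2 / (4 * c)))"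
    by (metis (no_types, lifting) mult.assoc mult_1)
qed

lemma cis_sum: "finite A \<Longrightarrow> cis (sum f A) = (\<Prod>b\<in>A. cis (f b))"
  by (induction A rule: finite_induct) (auto simp: cis_mult[symmetric])

text \<open>Both the Gaussian and the character are products over \<open>Basis\<close>, and
  \<open>lborel\<close> is the image of a product of one-dimensional Lebesgue measures, so the
  integral factorizes.\<close>

lemma gaussian_fourier:
  fixes \<xi> :: "'a::euclidean_space"
  assumes "0 < c"
  shows "integrable lborel (\<lambda>x::'a. complex_of_real (exp (- c * (norm x)\<^sup>2)) * cis (x \<bullet> \<xi>))"
    and "(LINT x|lborel. complex_of_real (exp (- c * (norm x)\<^sup>2)) * cis (x \<bullet> \<xi>))
           = complex_of_real ((pi / c) powr (DIM('a) / 2) * exp (- (norm \<xi>)\<^sup>2 / (4 * c)))"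
proof -
  let ?M = "\<Pi>\<^sub>M b\<in>(Basis::'a set). (lborel :: real measure)"
  let ?T = "\<lambda>f. \<Sum>b\<in>(Basis::'a set). f b *\<^sub>R b"
  let ?g = "\<lambda>x::'a. complex_of_real (exp (- c * (norm x)\<^sup>2)) * cis (x \<bullet> \<xi>)"
  let ?u = "\<lambda>b y. complex_of_real (exp (- c * y\<^sup>2)) * cis (y * (\<xi> \<bullet> b))"
  interpret product_sigma_finite "\<lambda>b::'a. lborel :: real measure" ..
  have g_eq: "?g x = (\<Prod>b\<in>Basis. ?u b (x \<bullet> b))" for x
  proof -
    have "exp (- c * (norm x)\<^sup>2) = (\<Prod>b\<in>Basis. exp (- c * (x \<bullet> b)\<^sup>2))"
      by (subst norm_conv_dist, subst euclidean_dist_l2)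
         (simp add: L2_set_def sum_nonneg exp_sum[symmetric] sum_distrib_left sum_negf)
    moreover have "cis (x \<bullet> \<xi>) = (\<Prod>b\<in>Basis. cis ((x \<bullet> b) * (\<xi> \<bullet> b)))"
      by (subst euclidean_inner) (simp add: cis_sum)
    ultimately show ?thesis by (simp add: prod.distrib)
  qed
  have gT: "?g (?T f) = (\<Prod>b\<in>Basis. ?u b (f b))" for f
    unfolding g_eq by (intro prod.cong) auto
  have meas: "?T \<in> measurable ?M borel" by measurable
  have gm: "?g \<in> borel_measurable borel"
    by (intro borel_measurable_continuous_onI continuous_intros)
  have "integrable ?M (\<lambda>f. ?g (?T f))"
    unfolding gT by (rule product_integrable_prod) (use gaussian_fourier_real(1)[OF assms] in auto)
  then have "integrable (distr ?M borel ?T) ?g"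
    using meas gm by (subst integrable_distr_eq) auto
  then show "integrable lborel ?g"
    by (simp add: lborel_eq[where 'a='a])
  have "integral\<^sup>L lborel ?g = (LINT f|?M. ?g (?T f))"
    by (subst lborel_eq) (rule integral_distr[OF meas gm])
  also have "\<dots> = (\<Prod>b\<in>Basis. integral\<^sup>L lborel (?u b))"
    unfolding gT by (rule product_integral_prod) (use gaussian_fourier_real(1)[OF assms] in auto)
  also have "\<dots> = (\<Prod>b\<in>Basis. complex_of_real (sqrt (pi / c) * exp (- (\<xi> \<bullet> b)\<^sup>2 / (4 * c))))"
    using gaussian_fourier_real(2)[OF assms] by simp
  also have "\<dots> = complex_of_real (sqrt (pi / c) ^ DIM('a) * exp (\<Sum>b\<in>Basis. - (\<xi> \<bullet> b)\<^sup>2 / (4 * c)))"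
    by (simp add: prod.distrib exp_sum)
  also have "sqrt (pi / c) ^ DIM('a) = (pi / c) powr (DIM('a) / 2)"
    using assms by (simp add: powr_half_sqrt[symmetric] powr_realpow[symmetric] powr_powr)
  also have "(\<Sum>b\<in>Basis. - (\<xi> \<bullet> b)\<^sup>2 / (4 * c)) = - (norm \<xi>)\<^sup>2 / (4 * c)"
    by (subst norm_conv_dist, subst euclidean_dist_l2)
       (simp add: L2_set_def sum_nonneg sum_divide_distrib sum_negf)
  finally show "integral\<^sup>L lborel ?g = complex_of_real ((pi / c) powr (DIM('a) / 2) * exp (- (norm \<xi>)\<^sup>2 / (4 * c)))" .
qed

section \<open>Fourier transform and Gaussian regularization\<close>

abbreviation rfourier :: "('a::euclidean_space \<Rightarrow> real) \<Rightarrow> 'a \<Rightarrow> complex" where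
  "rfourier f \<equiv> fourier (\<lambda>x. complex_of_real (f x))"

lemma integrable_translate_diff:
  fixes f :: "'a::euclidean_space \<Rightarrow> 'b::{banach,second_countable_topology}"
  shows "integrable lborel f \<Longrightarrow> integrable lborel (\<lambda>x. f (x - a))"
  using integrable_translate[of f "- a"] by simp

lemma integral_translate_diff:
  fixes f :: "'a::euclidean_space \<Rightarrow> 'b::{banach,second_countable_topology}"
  shows "f \<in> borel_measurable borel \<Longrightarrow> (LINT x|lborel. f (x - a)) = (LINT x|lborel. f x)"
  using integral_translate[of f "- a"] by simp

lemma integrable_mult_cis:
  fixes h :: "'a::euclidean_space \<Rightarrow> complex"
  assumes "integrable lborel h" and [measurable]: "\<theta> \<in> borel_measurable borel"
  shows "integrable lborel (\<lambda>x. h x * cis (\<theta> x))"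
  by (rule Bochner_Integration.integrable_bound[OF assms(1)])
     (use borel_measurable_integrable[OF assms(1)] in \<open>auto simp: norm_mult\<close>)

lemma integrable_conv_pair:
  fixes f g :: "'a::euclidean_space \<Rightarrow> real"
  assumes f: "integrable lborel f" and g: "integrable lborel g"
  shows "integrable (lborel \<Otimes>\<^sub>M lborel) (\<lambda>(x,y). f (x - y) * g y)"
proof -
  have [measurable]: "f \<in> borel_measurable borel" "g \<in> borel_measurable borel"
    using f g by auto
  have "(LINT x|lborel. norm (f (x - y) * g y)) = (LINT x|lborel. \<bar>f x\<bar>) * \<bar>g y\<bar>" for y
    by (simp add: abs_mult integral_translate_diff[of "\<lambda>x. \<bar>f x\<bar>" y])
  then have "integrable (lborel \<Otimes>\<^sub>M lborel) (\<lambda>(y,x). f (x - y) * g y)"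
    using f g by (intro lborel_pair.Fubini_integrable) (auto intro: integrable_translate_diff)
  from lborel_pair.integrable_product_swap[OF this] show ?thesis by simp
qed

lemma integrable_conv:
  assumes "integrable lborel f" and "integrable lborel g"
  shows "integrable lborel (conv f g)"
  using lborel_pair.integrable_fst[OF integrable_conv_pair[OF assms]] by (simp add: conv_def[abs_def])

lemma fourier_conv:
  fixes f g :: "'a::euclidean_space \<Rightarrow> real"
  assumes f: "integrable lborel f" and g: "integrable lborel g"
  shows "rfourier (conv f g) \<xi> = rfourier f \<xi> * rfourier g \<xi>"
proof -
  have [measurable]: "f \<in> borel_measurable borel" "g \<in> borel_measurable borel"
    using f g by auto
  let ?H = "\<lambda>x y. complex_of_real (f (x - y) * g y) * cis (- 2 * pi * (x \<bullet> \<xi>))"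
  have i: "integrable (lborel \<Otimes>\<^sub>M lborel) (case_prod ?H)"
    by (rule Bochner_Integration.integrable_bound[OF integrable_conv_pair[OF f g]])
       (auto simp: norm_mult)
  have inner: "(LINT x|lborel. ?H x y) = complex_of_real (g y) * cis (- 2 * pi * (y \<bullet> \<xi>)) * rfourier f \<xi>" for y
  proof -
    have "(LINT x|lborel. ?H x y) = (LINT x|lborel. complex_of_real (f (x - y) * g y) * cis (- 2 * pi * ((x - y + y) \<bullet> \<xi>)))"
      by simp
    also have "\<dots> = (LINT x|lborel. complex_of_real (f x * g y) * cis (- 2 * pi * ((x + y) \<bullet> \<xi>)))"
      by (rule integral_translate_diff[where f = "\<lambda>x. complex_of_real (f x * g y) * cis (- 2 * pi * ((x + y) \<bullet> \<xi>))"]) simp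
    also have "\<dots> = (LINT x|lborel. (complex_of_real (g y) * cis (- 2 * pi * (y \<bullet> \<xi>))) * (complex_of_real (f x) * cis (- 2 * pi * (x \<bullet> \<xi>))))"
      by (simp add: inner_add_left distrib_left cis_mult mult_ac)
    also have "\<dots> = (complex_of_real (g y) * cis (- 2 * pi * (y \<bullet> \<xi>))) * rfourier f \<xi>"
      unfolding fourier_def by (rule integral_mult_right_zero)
    finally show ?thesis .
  qed
  have "rfourier (conv f g) \<xi> = (LINT x|lborel. LINT y|lborel. ?H x y)"
    unfolding fourier_def conv_def integral_mult_left_zero integral_complex_of_real ..
  also have "\<dots> = (LINT y|lborel. LINT x|lborel. ?H x y)"
    by (rule lborel_pair.Fubini_integral[OF i, symmetric])
  also have "\<dots> = rfourier f \<xi> * rfourier g \<xi>"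
    unfolding inner integral_mult_left_zero by (simp add: fourier_def mult_ac)
  finally show ?thesis .
qed

lemma borel_measurable_fourier:
  assumes [measurable]: "h \<in> borel_measurable borel"
  shows "fourier h \<in> borel_measurable borel"
  unfolding fourier_def[abs_def] by measurable

lemma norm_fourier_le: "norm (fourier h \<xi>) \<le> (LINT x|lborel. norm (h x))"
  unfolding fourier_def
  using integral_norm_bound[of lborel "\<lambda>x. h x * cis (- 2 * pi * (x \<bullet> \<xi>))"] by (simp add: norm_mult)

lemma integrable_fourier_mult:
  assumes "integrable lborel h" and "integrable lborel \<Psi>"
  shows "integrable lborel (\<lambda>\<xi>. fourier h \<xi> * \<Psi> \<xi>)"
proof (rule Bochner_Integration.integrable_bound)
  show "integrable lborel (\<lambda>\<xi>. (LINT x|lborel. norm (h x)) *\<^sub>R \<Psi> \<xi>)"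
    using assms by simp
  show "(\<lambda>\<xi>. fourier h \<xi> * \<Psi> \<xi>) \<in> borel_measurable lborel"
    using assms borel_measurable_fourier[of h] by auto
qed (auto simp: norm_mult intro!: mult_right_mono norm_fourier_le order_trans[OF norm_fourier_le])

text \<open>Multiplication formula, by Fubini: \<open>fourier h\<close> need not be integrable, but
  the integrable factor \<open>\<Psi>\<close> carries the inverse transform. With a Gaussian
  \<open>\<Psi>\<close> it regularizes inversion; with the transform of a mollifier it yields
  uniqueness and evaluates \<open>bessel_op\<close>.\<close>

lemma ifourier_fourier_mult:
  fixes h :: "'a::euclidean_space \<Rightarrow> complex"
  assumes h: "integrable lborel h" and \<Psi>: "integrable lborel \<Psi>"
  shows "ifourier (\<lambda>\<xi>. fourier h \<xi> * \<Psi> \<xi>) x = (LINT y|lborel. h y * ifourier \<Psi> (x - y))"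
proof -
  have [measurable]: "h \<in> borel_measurable borel" "\<Psi> \<in> borel_measurable borel"
    using h \<Psi> by auto
  let ?H = "\<lambda>y \<xi>. h y * (\<Psi> \<xi> * cis (2 * pi * ((x - y) \<bullet> \<xi>)))"
  have i: "integrable (lborel \<Otimes>\<^sub>M lborel) (case_prod ?H)"
  proof (rule lborel_pair.Fubini_integrable)
    show "integrable lborel (\<lambda>y. LINT \<xi>|lborel. norm (case_prod ?H (y, \<xi>)))"
      using h by (simp add: norm_mult)
    show "AE y in lborel. integrable lborel (\<lambda>\<xi>. case_prod ?H (y, \<xi>))"
      using \<Psi> by (intro AE_I2) (simp, intro integrable_mult_right integrable_mult_cis, auto)
  qed simp
  have "ifourier (\<lambda>\<xi>. fourier h \<xi> * \<Psi> \<xi>) x = (LINT \<xi>|lborel. LINT y|lborel. ?H y \<xi>)"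
  proof -
    have "fourier h \<xi> * \<Psi> \<xi> * cis (2 * pi * (x \<bullet> \<xi>)) = (LINT y|lborel. ?H y \<xi>)" for \<xi>
      unfolding fourier_def integral_mult_left_zero[symmetric]
      by (intro Bochner_Integration.integral_cong refl)
         (simp add: inner_diff_left right_diff_distrib cis_mult mult.left_commute mult.commute)
    then show ?thesis by (simp add: ifourier_def)
  qed
  also have "\<dots> = (LINT y|lborel. LINT \<xi>|lborel. ?H y \<xi>)"
    by (rule lborel_pair.Fubini_integral[OF i])
  finally show ?thesis
    unfolding integral_mult_right_zero by (simp add: ifourier_def)
qed

section \<open>The heat kernel, and inversion through its Gaussian transform\<close>

definition heat :: "real \<Rightarrow> 'a::euclidean_space \<Rightarrow> real" where
  "heat t x = (1 / (4 * pi * t)) powr (DIM('a) / 2) * exp (- (norm x)\<^sup>2 / (4 * t))"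

lemma borel_measurable_heat [measurable]:
  "case_prod heat \<in> borel_measurable (borel \<Otimes>\<^sub>M borel)"
  unfolding heat_def case_prod_beta by measurable

lemma heat_nonneg: "0 \<le> heat t x"
  by (simp add: heat_def)

lemma heat_fourier:
  fixes \<xi> :: "'a::euclidean_space"
  assumes "0 < t"
  shows "integrable lborel (heat t :: 'a \<Rightarrow> real)"
    and "rfourier (heat t) \<xi> = complex_of_real (exp (- 4 * pi\<^sup>2 * t * (norm \<xi>)\<^sup>2))"
proof -
  let ?C = "(1 / (4 * pi * t)) powr (DIM('a) / 2)"
  have c: "0 < 1 / (4 * t)" using assms by simp
  have "integrable lborel (\<lambda>x::'a. Re (complex_of_real (exp (- (1 / (4 * t)) * (norm x)\<^sup>2)) * cis (x \<bullet> 0)))"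
    by (intro integrable_Re gaussian_fourier(1) c)
  then show "integrable lborel (heat t :: 'a \<Rightarrow> real)"
    by (simp add: heat_def[abs_def])
  have "rfourier (heat t) \<xi> = complex_of_real ?C * (LINT x|lborel. complex_of_real (exp (- (1 / (4 * t)) * (norm x)\<^sup>2)) * cis (x \<bullet> ((- 2 * pi) *\<^sub>R \<xi>)))"
    unfolding fourier_def integral_mult_right_zero[symmetric]
    by (intro Bochner_Integration.integral_cong) (simp_all add: heat_def)
  also have "\<dots> = complex_of_real (?C * ((pi / (1 / (4 * t))) powr (DIM('a) / 2) * exp (- (norm ((- 2 * pi) *\<^sub>R \<xi>))\<^sup>2 / (4 * (1 / (4 * t))))))"
    by (simp only: gaussian_fourier(2)[OF c] of_real_mult)
  also have "?C * ((pi / (1 / (4 * t))) powr (DIM('a) / 2) * exp (- (norm ((- 2 * pi) *\<^sub>R \<xi>))\<^sup>2 / (4 * (1 / (4 * t)))))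
     = exp (- 4 * pi\<^sup>2 * t * (norm \<xi>)\<^sup>2)"
    using assms by (simp add: powr_divide power_mult_distrib) (simp add: mult_ac)
  finally show "rfourier (heat t) \<xi> = complex_of_real (exp (- 4 * pi\<^sup>2 * t * (norm \<xi>)\<^sup>2))" .
qed

lemma heat_ifourier:
  fixes x :: "'a::euclidean_space"
  assumes "0 < t"
  shows "integrable lborel (\<lambda>\<xi>::'a. complex_of_real (exp (- 4 * pi\<^sup>2 * t * (norm \<xi>)\<^sup>2)))"
    and "ifourier (\<lambda>\<xi>. complex_of_real (exp (- 4 * pi\<^sup>2 * t * (norm \<xi>)\<^sup>2))) x = complex_of_real (heat t x)"
proof -
  have c: "0 < 4 * pi\<^sup>2 * t" using assms by simp
  show "integrable lborel (\<lambda>\<xi>::'a. complex_of_real (exp (- 4 * pi\<^sup>2 * t * (norm \<xi>)\<^sup>2)))"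
    using gaussian_fourier(1)[OF c, of "0::'a"] by simp
  have "ifourier (\<lambda>\<xi>. complex_of_real (exp (- 4 * pi\<^sup>2 * t * (norm \<xi>)\<^sup>2))) x
     = (LINT \<xi>|lborel. complex_of_real (exp (- (4 * pi\<^sup>2 * t) * (norm \<xi>)\<^sup>2)) * cis (\<xi> \<bullet> ((2 * pi) *\<^sub>R x)))"
    by (simp add: ifourier_def inner_commute)
  also have "\<dots> = complex_of_real ((pi / (4 * pi\<^sup>2 * t)) powr (DIM('a) / 2) * exp (- (norm ((2 * pi) *\<^sub>R x))\<^sup>2 / (4 * (4 * pi\<^sup>2 * t))))"
    by (rule gaussian_fourier(2)[OF c])
  also have "pi / (4 * pi\<^sup>2 * t) = 1 / (4 * pi * t)"
    using assms by (simp add: power2_eq_square)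
  also have "- (norm ((2 * pi) *\<^sub>R x))\<^sup>2 / (4 * (4 * pi\<^sup>2 * t)) = - (norm x)\<^sup>2 / (4 * t)"
    using assms by (simp add: power_mult_distrib)
  also have "complex_of_real ((1 / (4 * pi * t)) powr (DIM('a) / 2) * exp (- (norm x)\<^sup>2 / (4 * t))) = complex_of_real (heat t x)"
    by (simp only: heat_def)
  finally show "ifourier (\<lambda>\<xi>. complex_of_real (exp (- 4 * pi\<^sup>2 * t * (norm \<xi>)\<^sup>2))) x = complex_of_real (heat t x)" .
qed

lemma heat_integral: "0 < t \<Longrightarrow> (LINT x|lborel. heat t (x::'a::euclidean_space)) = 1"
  using heat_fourier(2)[of t "0::'a"] by (simp add: fourier_def integral_complex_of_real)

lemma integral_scale_reflect:
  fixes f :: "'a::euclidean_space \<Rightarrow> real"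
  assumes [measurable]: "f \<in> borel_measurable borel" and r: "0 < r"
  shows "(LINT y|lborel. f y) = r ^ DIM('a) * (LINT z|lborel. f (x - r *\<^sub>R z))"
proof -
  have "(lborel :: 'a measure) = density (distr lborel borel (\<lambda>z. x + (- r) *\<^sub>R z)) (\<lambda>_. ennreal (r ^ DIM('a)))"
    using lborel_affine[of "- r" x] r by simp
  from arg_cong[OF this, of "\<lambda>M. integral\<^sup>L M f"]
  have "(LINT y|lborel. f y) = (LINT y|density (distr lborel borel (\<lambda>z. x + (- r) *\<^sub>R z)) (\<lambda>_. ennreal (r ^ DIM('a))). f y)" .
  also have "\<dots> = r ^ DIM('a) * (LINT z|lborel. f (x - r *\<^sub>R z))"
    using r by (subst integral_density) (auto simp: integral_distr)
  finally show ?thesis .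
qed

text \<open>Parabolic scaling, time \<open>r\<^sup>2\<close> against length \<open>r\<close>, trades
  the varying kernel for the fixed density \<open>heat 1\<close>, where sup bounds and dominated
  convergence apply at once.\<close>

lemma heat_average:
  fixes k :: "'a::euclidean_space \<Rightarrow> real"
  assumes [measurable]: "k \<in> borel_measurable borel" and r: "0 < r"
  shows "(LINT y|lborel. k y * heat (r\<^sup>2) (x - y)) = (LINT z|lborel. k (x - r *\<^sub>R z) * heat 1 z)"
proof -
  let ?n = "DIM('a)"
  have [measurable]: "heat t \<in> borel_measurable borel" for t :: real by measurable
  have "(LINT y|lborel. k y * heat (r\<^sup>2) (x - y)) = (LINT z|lborel. r ^ ?n * (k (x - r *\<^sub>R z) * heat (r\<^sup>2) (r *\<^sub>R z)))"
    using r by (subst integral_scale_reflect[where r = r and x = x]) auto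
  also have "\<dots> = (LINT z|lborel. k (x - r *\<^sub>R z) * heat 1 z)"
  proof (intro Bochner_Integration.integral_cong refl)
    fix z :: 'a
    have "(1 / (4 * pi * r\<^sup>2)) powr (?n / 2) = (1 / (4 * pi)) powr (?n / 2) * (1 / r\<^sup>2) powr (?n / 2)"
      using r by (subst powr_mult[symmetric]) auto
    also have "(1 / r\<^sup>2) powr (?n / 2) = 1 / (r powr 2) powr (?n / 2)"
      using r by (simp add: powr_divide)
    also have "(r powr 2) powr (?n / 2) = r ^ ?n"
      using r by (simp add: powr_powr powr_realpow[symmetric] del: powr_numeral)
    finally show "r ^ ?n * (k (x - r *\<^sub>R z) * heat (r\<^sup>2) (r *\<^sub>R z)) = k (x - r *\<^sub>R z) * heat 1 z"
      using r by (simp add: heat_def power_mult_distrib)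
  qed
  finally show ?thesis .
qed

lemma heat_average_tendsto:
  fixes k :: "'a::euclidean_space \<Rightarrow> real"
  assumes k: "continuous_on UNIV k" and b: "\<And>x. \<bar>k x\<bar> \<le> M"
  shows "(\<lambda>m. LINT y|lborel. k y * heat ((1 / real (Suc m))\<^sup>2) (x - y)) \<longlonglongrightarrow> k x"
proof -
  have [measurable]: "k \<in> borel_measurable borel"
    using k by (rule borel_measurable_continuous_onI)
  have [measurable]: "heat t \<in> borel_measurable borel" for t :: real by measurable
  have "(\<lambda>m. LINT z|lborel. k (x - (1 / real (Suc m)) *\<^sub>R z) * heat 1 z) \<longlonglongrightarrow> (LINT z|lborel. k x * heat 1 (z::'a))"
  proof (rule integral_dominated_convergence[where w = "\<lambda>z::'a. M * heat 1 z"])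
    show "AE z in lborel. (\<lambda>m. k (x - (1 / real (Suc m)) *\<^sub>R z) * heat 1 z) \<longlonglongrightarrow> k x * heat 1 z"
    proof (intro AE_I2 tendsto_mult_right)
      fix z :: 'a
      have "(\<lambda>m. (1 / real (Suc m)) *\<^sub>R z) \<longlonglongrightarrow> 0 *\<^sub>R z"
        by (intro tendsto_scaleR tendsto_const LIMSEQ_Suc lim_1_over_n)
      then have "(\<lambda>m. x - (1 / real (Suc m)) *\<^sub>R z) \<longlonglongrightarrow> x"
        using tendsto_diff[OF tendsto_const[of x]] by fastforce
      moreover have "isCont k x" using k by (simp add: continuous_on_eq_continuous_at)
      ultimately show "(\<lambda>m. k (x - (1 / real (Suc m)) *\<^sub>R z)) \<longlonglongrightarrow> k x"
        using isCont_tendsto_compose by blast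
    qed
    show "integrable lborel (\<lambda>z::'a. M * heat 1 z)"
      using heat_fourier(1)[of 1, where 'a='a] by simp
    show "AE z in lborel. norm (k (x - (1 / real (Suc m)) *\<^sub>R z) * heat 1 z) \<le> M * heat 1 z" for m
      using b by (auto simp: abs_mult heat_nonneg intro!: mult_right_mono)
  qed measurable
  then show ?thesis
    by (subst heat_average) (auto simp: heat_integral)
qed

lemma fourier_heat_regularization:
  fixes k :: "'a::euclidean_space \<Rightarrow> real"
  assumes k: "integrable lborel k" and t: "0 < t"
  shows "ifourier (\<lambda>\<xi>. rfourier k \<xi> * complex_of_real (exp (- 4 * pi\<^sup>2 * t * (norm \<xi>)\<^sup>2))) x
     = complex_of_real (LINT y|lborel. k y * heat t (x - y))"
proof -
  have "integrable lborel (\<lambda>x. complex_of_real (k x))" using k by simp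
  from ifourier_fourier_mult[OF this heat_ifourier(1)[OF t], of x]
  show ?thesis
    unfolding heat_ifourier(2)[OF t] of_real_mult[symmetric] integral_complex_of_real .
qed

lemma gaussian_factor_tendsto:
  "(\<lambda>m. exp (- 4 * pi\<^sup>2 * (1 / real (Suc m))\<^sup>2 * N)) \<longlonglongrightarrow> 1"
proof -
  have "isCont (\<lambda>r::real. exp (- 4 * pi\<^sup>2 * r\<^sup>2 * N)) 0"
    by simp
  from isCont_tendsto_compose[OF this LIMSEQ_Suc[OF lim_1_over_n]] show ?thesis by simp
qed

text \<open>At \<open>x = 0\<close> the regularized inversion integrals are bounded by \<open>sup |k|\<close>, and for a nonnegative
  transform they control its integral by Fatou's lemma.\<close>

lemma fourier_integrable_if_nonneg:
  fixes k :: "'a::euclidean_space \<Rightarrow> real"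
  assumes int: "integrable lborel k" and k: "continuous_on UNIV k" and b: "\<And>x. \<bar>k x\<bar> \<le> M"
    and \<kappa>: "\<And>\<xi>. rfourier k \<xi> = complex_of_real (\<kappa> \<xi>)" and nonneg: "\<And>\<xi>. 0 \<le> \<kappa> \<xi>"
  shows "integrable lborel (rfourier k)"
proof -
  let ?E = "\<lambda>m \<xi>::'a. exp (- 4 * pi\<^sup>2 * (1 / real (Suc m))\<^sup>2 * (norm \<xi>)\<^sup>2)"
  have "\<kappa> = (\<lambda>\<xi>. Re (rfourier k \<xi>))" using \<kappa> by simp
  then have [measurable]: "\<kappa> \<in> borel_measurable borel"
    using borel_measurable_fourier[of "\<lambda>x. complex_of_real (k x)"] int by auto
  have t: "0 < (1 / real (Suc m))\<^sup>2" for m by simp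
  have i: "integrable lborel (\<lambda>\<xi>. \<kappa> \<xi> * ?E m \<xi>)" for m
  proof -
    have "integrable lborel (\<lambda>\<xi>. Re (rfourier k \<xi> * complex_of_real (?E m \<xi>)))"
      by (intro integrable_Re integrable_fourier_mult heat_ifourier(1) t) (use int in auto)
    then show ?thesis unfolding \<kappa> by simp
  qed
  have bd: "(LINT \<xi>|lborel. \<kappa> \<xi> * ?E m \<xi>) \<le> M" for m
  proof -
    have "complex_of_real (LINT \<xi>|lborel. \<kappa> \<xi> * ?E m \<xi>) = complex_of_real (LINT y|lborel. k y * heat ((1 / real (Suc m))\<^sup>2) (0 - y))"
      using fourier_heat_regularization[OF int t, of m 0]
      unfolding \<kappa> ifourier_def inner_zero_left mult_zero_right cis_zero mult_1_right
        of_real_mult[symmetric] integral_complex_of_real .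
    then have "(LINT \<xi>|lborel. \<kappa> \<xi> * ?E m \<xi>) = (LINT y|lborel. k y * heat ((1 / real (Suc m))\<^sup>2) (0 - y))"
      by (simp only: of_real_eq_iff)
    also have "\<dots> = (LINT z|lborel. k (0 - (1 / real (Suc m)) *\<^sub>R z) * heat 1 z)"
      by (rule heat_average) (use int in auto)
    also have "\<dots> \<le> (LINT z|lborel. M * heat 1 (z::'a))"
    proof (rule integral_mono')
      show "integrable lborel (\<lambda>z::'a. M * heat 1 z)"
        using heat_fourier(1)[of 1, where 'a='a] by simp
      show "k (0 - (1 / real (Suc m)) *\<^sub>R z) * heat 1 z \<le> M * heat 1 z" for z
        using b[of "0 - (1 / real (Suc m)) *\<^sub>R z"] by (intro mult_right_mono heat_nonneg) auto
      show "0 \<le> M * heat 1 z" for z :: 'a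
        using b[of 0] by (intro mult_nonneg_nonneg heat_nonneg) auto
    qed
    finally show ?thesis by (simp add: heat_integral)
  qed
  have lim: "(\<lambda>m. \<kappa> \<xi> * ?E m \<xi>) \<longlonglongrightarrow> \<kappa> \<xi>" for \<xi>
    using tendsto_mult_left[OF gaussian_factor_tendsto, of "\<kappa> \<xi>" "(norm \<xi>)\<^sup>2"] by simp
  have "(\<integral>\<^sup>+\<xi>. ennreal (\<kappa> \<xi>) \<partial>lborel) = (\<integral>\<^sup>+\<xi>. liminf (\<lambda>m. ennreal (\<kappa> \<xi> * ?E m \<xi>)) \<partial>lborel)"
    by (intro nn_integral_cong lim_imp_Liminf[symmetric] tendsto_ennrealI lim) simp
  also have "\<dots> \<le> liminf (\<lambda>m. \<integral>\<^sup>+\<xi>. ennreal (\<kappa> \<xi> * ?E m \<xi>) \<partial>lborel)"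
    by (rule nn_integral_liminf) measurable
  also have "\<dots> \<le> liminf (\<lambda>m::nat. ennreal M)"
    by (intro Liminf_mono always_eventually allI)
       (use i nonneg bd in \<open>auto simp: nn_integral_eq_integral intro!: ennreal_leI\<close>)
  also have "\<dots> < \<infinity>" by (simp add: Liminf_const)
  finally have "integrable lborel \<kappa>"
    using nonneg by (intro integrableI_nonneg) auto
  then show ?thesis unfolding \<kappa> by simp
qed

text \<open>The Gaussian-damped inversion integrals have two limits: \<open>k x\<close>, because
  they are heat averages of \<open>k\<close>, and the undamped integral, by dominated convergence
  with the integrable transform as majorant.\<close>

lemma fourier_inversion:
  fixes k :: "'a::euclidean_space \<Rightarrow> real"
  assumes int: "integrable lborel k" and k: "continuous_on UNIV k" and b: "\<And>x. \<bar>k x\<bar> \<le> M"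
    and intf: "integrable lborel (rfourier k)"
  shows "ifourier (rfourier k) x = complex_of_real (k x)"
proof (rule LIMSEQ_unique)
  let ?E = "\<lambda>m \<xi>::'a. exp (- 4 * pi\<^sup>2 * (1 / real (Suc m))\<^sup>2 * (norm \<xi>)\<^sup>2)"
  have [measurable]: "rfourier k \<in> borel_measurable borel" using intf by simp
  have t: "0 < (1 / real (Suc m))\<^sup>2" for m by simp
  show "(\<lambda>m. ifourier (\<lambda>\<xi>. rfourier k \<xi> * complex_of_real (?E m \<xi>)) x) \<longlonglongrightarrow> complex_of_real (k x)"
    unfolding fourier_heat_regularization[OF int t]
    by (intro tendsto_of_real heat_average_tendsto[OF k b])
  show "(\<lambda>m. ifourier (\<lambda>\<xi>. rfourier k \<xi> * complex_of_real (?E m \<xi>)) x) \<longlonglongrightarrow> ifourier (rfourier k) x"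
    unfolding ifourier_def
  proof (rule integral_dominated_convergence[where w = "\<lambda>\<xi>. norm (rfourier k \<xi>)"])
    show "AE \<xi> in lborel. (\<lambda>m. rfourier k \<xi> * complex_of_real (?E m \<xi>) * cis (2 * pi * (x \<bullet> \<xi>))) \<longlonglongrightarrow> rfourier k \<xi> * cis (2 * pi * (x \<bullet> \<xi>))"
    proof (intro AE_I2 tendsto_mult_right)
      fix \<xi>
      show "(\<lambda>m. rfourier k \<xi> * complex_of_real (?E m \<xi>)) \<longlonglongrightarrow> rfourier k \<xi>"
        using tendsto_mult_left[OF tendsto_of_real[OF gaussian_factor_tendsto[of "(norm \<xi>)\<^sup>2"]], of "rfourier k \<xi>"] by simp
    qed
    show "AE \<xi> in lborel. norm (rfourier k \<xi> * complex_of_real (?E m \<xi>) * cis (2 * pi * (x \<bullet> \<xi>))) \<le> norm (rfourier k \<xi>)" for m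
      by (auto simp: norm_mult intro!: mult_left_le)
  qed (use intf in auto)
qed

section \<open>Mollifiers and uniqueness of the Fourier transform\<close>

text \<open>A pi-lambda argument: open boxes are closed under intersection and generate the Borel
  sets. The vanishing total integral is what the step to complements uses.\<close>

lemma AE_zero_if_box_integrals_zero:
  fixes w :: "'a::euclidean_space \<Rightarrow> real"
  assumes i: "integrable lborel w" and t: "(LINT x|lborel. w x) = 0"
    and z: "\<And>c d. (LINT x:box c d|lborel. w x) = 0"
  shows "AE x in lborel. w x = 0"
proof (rule density_unique_real)
  fix A :: "'a set" assume "A \<in> sets lborel"
  have si: "set_integrable lborel B w" if "B \<in> sets borel" for B
    using integrable_mult_indicator[of B lborel w] that i by (simp add: set_integrable_def)
  from \<open>A \<in> sets lborel\<close> have A: "A \<in> sigma_sets UNIV (range (\<lambda>(a, b). box a b :: 'a set))"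
    by (simp add: borel_eq_box)
  have S: "sigma_sets UNIV (range (\<lambda>(a, b). box a b :: 'a set)) = sets borel"
    by (subst borel_eq_box) simp
  have "Int_stable (range (\<lambda>(a, b). box a b :: 'a set))"
    by (auto simp: Int_stable_def box_Int_box)
  moreover have "range (\<lambda>(a, b). box a b :: 'a set) \<subseteq> Pow UNIV" by simp
  moreover note A
  ultimately have "(LINT x:A|lborel. w x) = 0"
  proof (induction A rule: sigma_sets_induct_disjoint)
    case (basic A) then show ?case using z by auto
  next
    case empty show ?case by (simp add: set_lebesgue_integral_def)
  next
    case (compl A)
    have A: "A \<in> sets borel" using compl(1) S by simp
    have "(LINT x:A \<union> (UNIV - A)|lborel. w x) = (LINT x:A|lborel. w x) + (LINT x:UNIV - A|lborel. w x)"
      using A by (intro set_integral_Un si) auto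
    then show ?case using compl t by (simp add: set_lebesgue_integral_def)
  next
    case (union A)
    have A: "A n \<in> sets borel" for n using union(2) S by auto
    have "(LINT x:(\<Union>n. A n)|lborel. w x) = (\<Sum>n. (LINT x:A n|lborel. w x))"
      using union(1) A by (intro lebesgue_integral_countable_add si) (auto simp: disjoint_family_on_def)
    then show ?case using union by simp
  qed
  then show "(LINT x:A|lborel. w x) = (LINT x:A|lborel. 0)" by simp
qed (use i in auto)

lemma AE_notin_frontier_box:
  fixes c d :: "'a::euclidean_space"
  shows "AE x in lborel. x \<notin> cbox c d - box c d"
proof -
  have "negligible (cbox c d - box c d)" by (rule negligible_frontier_interval)
  then have "cbox c d - box c d \<in> null_sets lborel"
    by (simp add: negligible_iff_null_sets null_sets_completion_iff)
  then show ?thesis by (rule AE_not_in)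
qed

text \<open>Countably many closed boxes exhaust \<open>U\<close>. On each of them, \<open>w\<close>
  cut to the open box has zero integral over every box, and the frontier lost by the cut is a null
  set.\<close>

lemma AE_zero_on_open:
  fixes w :: "'a::euclidean_space \<Rightarrow> real"
  assumes U: "open U" and i: "\<And>r. integrable lborel (\<lambda>x. indicator (cball 0 r) x * w x)"
    and z: "\<And>c d. cbox c d \<subseteq> U \<Longrightarrow> (LINT x:box c d|lborel. w x) = 0"
  shows "AE x in lborel. x \<in> U \<longrightarrow> w x = 0"
proof -
  obtain D where D: "countable D" "D \<subseteq> Pow U" "\<And>X. X \<in> D \<Longrightarrow> \<exists>a b. X = cbox a b" "\<Union>D = U"
    using open_countable_Union_open_cbox[OF U] by metis
  have "AE x in lborel. \<forall>X\<in>D. x \<in> X \<longrightarrow> w x = 0"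
  proof (subst AE_ball_countable[OF D(1)], intro ballI)
    fix X assume "X \<in> D"
    then obtain a b where X: "X = cbox a b" "cbox a b \<subseteq> U" using D by blast
    obtain r where r: "cbox a b \<subseteq> cball 0 r"
      using bounded_subset_ballD[OF bounded_cbox[of a b], of 0] ball_subset_cball by blast
    define v where "v x = indicator (box a b) x * w x" for x
    have v: "indicator (box a b) x *\<^sub>R (indicator (cball 0 r) x * w x) = v x" for x
      using r box_subset_cbox[of a b] by (auto simp: indicator_def v_def)
    have "integrable lborel (\<lambda>x. indicator (box a b) x *\<^sub>R (indicator (cball 0 r) x * w x))"
      by (rule integrable_mult_indicator[OF _ i]) simp
    then have 1: "integrable lborel v" unfolding v .
    have 2: "(LINT x|lborel. v x) = 0"
      using z[OF X(2)] unfolding set_lebesgue_integral_def real_scaleR_def v_def .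
    have 3: "(LINT x:box c d|lborel. v x) = 0" for c d
    proof -
      obtain c' d' where cd: "box c d \<inter> box a b = box c' d'"
        by (rule that[OF box_Int_box])
      have "(LINT x:box c d|lborel. v x) = (LINT x:box c' d'|lborel. w x)"
        unfolding set_lebesgue_integral_def cd[symmetric]
        by (intro Bochner_Integration.integral_cong) (auto simp: indicator_def v_def)
      \<comment> \<open>The hypothesis \<open>z\<close> speaks of the closed box, which is the
        closure of the open one only if the latter is nonempty.\<close>
      also have "\<dots> = 0"
      proof (cases "box c' d' = {}")
        case False
        then have "cbox c' d' = closure (box c' d')" by (simp add: closure_box)
        also have "\<dots> \<subseteq> closure (box a b)" unfolding cd[symmetric] by (intro closure_mono) auto
        also have "\<dots> \<subseteq> cbox a b" by (intro closure_minimal box_subset_cbox closed_cbox)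
        finally show ?thesis using X by (intro z) auto
      qed (simp add: set_lebesgue_integral_def)
      finally show ?thesis .
    qed
    have "AE x in lborel. v x = 0" by (rule AE_zero_if_box_integrals_zero[OF 1 2 3])
    with AE_notin_frontier_box[of a b] show "AE x in lborel. x \<in> X \<longrightarrow> w x = 0"
      unfolding X by eventually_elim (auto simp: indicator_def v_def split: if_splits)
  qed
  then show ?thesis by eventually_elim (use D(4) in blast)
qed

text \<open>Besides an even approximate identity with shrinking supports, the locale demands an
  integrable transform, so that each mollifier is its own Fourier integral and can be used on the
  frequency side.\<close>

locale mollifiers =
  fixes \<kappa> :: "nat \<Rightarrow> 'a::euclidean_space \<Rightarrow> real"
  assumes cont: "continuous_on UNIV (\<kappa> m)"
    and bounded: "\<exists>M. \<forall>x. \<bar>\<kappa> m x\<bar> \<le> M"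
    and nonneg: "0 \<le> \<kappa> m x"
    and even: "\<kappa> m (- x) = \<kappa> m x"
    and supp: "\<kappa> m x \<noteq> 0 \<Longrightarrow> norm x \<le> 1 / real (Suc m)"
    and int: "integrable lborel (\<kappa> m)"
    and integral: "(LINT x|lborel. \<kappa> m x) = 1"
    and fourier_int: "integrable lborel (rfourier (\<kappa> m))"
begin

lemma measurable [measurable]: "\<kappa> m \<in> borel_measurable borel"
  using int by auto

lemma inversion: "ifourier (rfourier (\<kappa> m)) x = complex_of_real (\<kappa> m x)"
proof -
  obtain M where "\<And>x. \<bar>\<kappa> m x\<bar> \<le> M" using bounded by blast
  then show ?thesis by (rule fourier_inversion[OF int cont _ fourier_int])
qed

lemma even': "\<kappa> m (x - y) = \<kappa> m (y - x)"
  using even[of m "x - y"] by simp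

text \<open>Off the frontier, a null set, the shrinking supports eventually lie entirely inside the
  box or entirely outside it, so the sequence becomes constant.\<close>

lemma smoothed_box_tendsto:
  "AE y in lborel. (\<lambda>m. LINT x:box c d|lborel. \<kappa> m (y - x)) \<longlonglongrightarrow> indicator (box c d) y"
  using AE_notin_frontier_box[of c d]
proof eventually_elim
  fix y assume y: "y \<notin> cbox c d - box c d"
  have small: "eventually (\<lambda>m. 1 / real (Suc m) < e) sequentially" if "0 < e" for e
    using order_tendstoD(2)[OF LIMSEQ_Suc[OF lim_1_over_n] that] .
  show "(\<lambda>m. LINT x:box c d|lborel. \<kappa> m (y - x)) \<longlonglongrightarrow> indicator (box c d) y"
  proof (cases "y \<in> box c d")
    case True
    then obtain e where e: "0 < e" "ball y e \<subseteq> box c d"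
      using open_contains_ball[of "box c d"] by auto
    have "eventually (\<lambda>m. (LINT x:box c d|lborel. \<kappa> m (y - x)) = 1) sequentially"
      using small[OF e(1)]
    proof eventually_elim
      fix m assume m: "1 / real (Suc m) < e"
      have "indicator (box c d) x *\<^sub>R \<kappa> m (y - x) = \<kappa> m (y - x)" for x
      proof (cases "\<kappa> m (y - x) = 0")
        case False
        then have "x \<in> ball y e" using supp[OF False] m by (simp add: dist_norm)
        then show ?thesis using e by auto
      qed simp
      then show "(LINT x:box c d|lborel. \<kappa> m (y - x)) = 1"
        unfolding set_lebesgue_integral_def by (simp only:) (simp add: integral_reflect_at integral)
    qed
    then show ?thesis using True by (simp add: tendsto_eventually)
  next
    case False
    then have "open (- cbox c d)" "y \<in> - cbox c d" using y by auto
    then obtain e where e: "0 < e" "ball y e \<subseteq> - cbox c d"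
      using open_contains_ball by blast
    have "eventually (\<lambda>m. (LINT x:box c d|lborel. \<kappa> m (y - x)) = 0) sequentially"
      using small[OF e(1)]
    proof eventually_elim
      fix m assume m: "1 / real (Suc m) < e"
      have "indicator (box c d) x *\<^sub>R \<kappa> m (y - x) = 0" for x
      proof (cases "\<kappa> m (y - x) = 0")
        case False
        then have "x \<in> ball y e" using supp[OF False] m by (simp add: dist_norm)
        then show ?thesis using e box_subset_cbox[of c d] by (auto simp: indicator_def)
      qed simp
      then show "(LINT x:box c d|lborel. \<kappa> m (y - x)) = 0"
        unfolding set_lebesgue_integral_def by (simp only:) simp
    qed
    then show ?thesis using False by (simp add: tendsto_eventually)
  qed
qed

text \<open>Integrating the vanishing averages over a box and exchanging integrals pairs
  \<open>w\<close> with the smoothed indicator of that box; the limit is the integral of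
  \<open>w\<close> over the box.\<close>

lemma AE_zero_if_mollified_zero:
  assumes U: "open U" and i: "\<And>r. integrable lborel (\<lambda>x. indicator (cball 0 r) x * w x)"
    and w [measurable]: "w \<in> borel_measurable borel"
    and z: "\<And>m x. cball x (1 / real (Suc m)) \<subseteq> U \<Longrightarrow> (LINT y|lborel. w y * \<kappa> m (y - x)) = 0"
  shows "AE x in lborel. x \<in> U \<longrightarrow> w x = 0"
proof (rule AE_zero_on_open[OF U i])
  fix c d :: 'a assume sub: "cbox c d \<subseteq> U"
  obtain e where e: "0 < e" "(\<Union>x\<in>cbox c d. ball x e) \<subseteq> U"
    using compact_subset_open_imp_ball_epsilon_subset[OF compact_cbox U sub] by blast
  obtain r where r: "cbox c d \<subseteq> cball 0 r"
    using bounded_subset_ballD[OF bounded_cbox[of c d], of 0] ball_subset_cball by blast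
  \<comment> \<open>Mollifier supports have radius at most 1, so a ball enlarged by 1 contains every
    \<open>y\<close> that interacts with a point of the box. There \<open>v\<close> agrees with
    \<open>w\<close>, and \<open>v\<close> is integrable on the whole space.\<close>
  define v where "v x = indicator (cball 0 (r + 1)) x * w x" for x
  have v: "integrable lborel v" unfolding v_def by (rule i)
  have [measurable]: "v \<in> borel_measurable borel" using v by auto
  define P where "P m y = (LINT x:box c d|lborel. \<kappa> m (y - x))" for m y
  have [measurable]: "P m \<in> borel_measurable borel" for m
    unfolding P_def set_lebesgue_integral_def by measurable
  have sint: "integrable lborel (\<lambda>x. indicator (box c d) x *\<^sub>R \<kappa> m (y - x))" for m y
    by (rule integrable_mult_indicator) (auto intro: integrable_reflect_at int)
  have P0: "0 \<le> P m y" for m y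
    unfolding P_def set_lebesgue_integral_def by (intro integral_nonneg_AE AE_I2) (simp add: nonneg)
  have P1: "P m y \<le> 1" for m y
  proof -
    have "P m y \<le> (LINT x|lborel. \<kappa> m (y - x))"
      unfolding P_def set_lebesgue_integral_def
      by (rule integral_mono[OF sint]) (auto intro: integrable_reflect_at int nonneg simp: indicator_def)
    then show ?thesis by (simp add: integral_reflect_at integral)
  qed
  have eq: "v y * (indicator (box c d) x * \<kappa> m (y - x)) = indicator (box c d) x * (w y * \<kappa> m (y - x))" for x y m
  proof (cases "x \<in> box c d \<and> \<kappa> m (y - x) \<noteq> 0")
    case True
    have "norm y \<le> norm x + norm (y - x)" using norm_triangle_ineq[of x "y - x"] by simp
    also have "norm x \<le> r" using True r box_subset_cbox[of c d] by auto
    also have "norm (y - x) \<le> 1 / real (Suc m)" using True supp by blast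
    also have "\<dots> \<le> 1" by simp
    finally show ?thesis by (simp add: v_def)
  qed auto
  have zero: "(LINT y|lborel. v y * P m y) = 0" if m: "1 / real (Suc m) < e" for m
  proof -
    let ?H = "\<lambda>y x. v y * (indicator (box c d) x * \<kappa> m (y - x))"
    have "integrable (lborel \<Otimes>\<^sub>M lborel) (case_prod ?H)"
    proof (rule lborel_pair.Fubini_integrable)
      have "(LINT x|lborel. norm (case_prod ?H (y, x))) = \<bar>v y\<bar> * P m y" for y
        by (simp add: abs_mult nonneg P_def set_lebesgue_integral_def)
      moreover have "integrable lborel (\<lambda>y. \<bar>v y\<bar> * P m y)"
        by (rule Bochner_Integration.integrable_bound[OF v])
           (use P0 P1 in \<open>auto simp: abs_mult intro!: mult_left_le\<close>)
      ultimately show "integrable lborel (\<lambda>y. LINT x|lborel. norm (case_prod ?H (y, x)))" by simp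
      show "AE y in lborel. integrable lborel (\<lambda>x. case_prod ?H (y, x))"
        using sint by simp
    qed measurable
    then have "(LINT x|lborel. LINT y|lborel. ?H y x) = (LINT y|lborel. LINT x|lborel. ?H y x)"
      by (rule lborel_pair.Fubini_integral)
    also have "\<dots> = (LINT y|lborel. v y * P m y)"
      by (simp add: P_def set_lebesgue_integral_def)
    also have "(LINT x|lborel. LINT y|lborel. ?H y x) = (LINT x|lborel. indicator (box c d) x * (LINT y|lborel. w y * \<kappa> m (y - x)))"
      by (simp add: eq)
    also have "\<dots> = (LINT x|lborel. (\<lambda>x::'a. 0) x)"
    proof (intro Bochner_Integration.integral_cong refl)
      fix x
      have "cball x (1 / real (Suc m)) \<subseteq> U" if "x \<in> box c d"
        using that box_subset_cbox[of c d] e m by (force simp: subset_eq)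
      then show "indicator (box c d) x * (LINT y|lborel. w y * \<kappa> m (y - x)) = 0"
        using z[of x m] by (auto simp: indicator_def)
    qed
    finally show ?thesis by simp
  qed
  have "(\<lambda>m. LINT y|lborel. v y * P m y) \<longlonglongrightarrow> (LINT y|lborel. v y * indicator (box c d) y)"
  proof (rule integral_dominated_convergence[where w = "\<lambda>y. \<bar>v y\<bar>"])
    show "AE y in lborel. (\<lambda>m. v y * P m y) \<longlonglongrightarrow> v y * indicator (box c d) y"
      using smoothed_box_tendsto[of c d] unfolding P_def by eventually_elim (rule tendsto_mult_left)
    show "AE y in lborel. norm (v y * P m y) \<le> \<bar>v y\<bar>" for m
      using P0 P1 by (auto simp: abs_mult intro!: mult_left_le)
  qed (use v in auto)
  moreover have "eventually (\<lambda>m. (LINT y|lborel. v y * P m y) = 0) sequentially"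
    using order_tendstoD(2)[OF LIMSEQ_Suc[OF lim_1_over_n] e(1)] by eventually_elim (rule zero)
  then have "(\<lambda>m. LINT y|lborel. v y * P m y) \<longlonglongrightarrow> 0" by (rule tendsto_eventually)
  ultimately have "(LINT y|lborel. v y * indicator (box c d) y) = 0" by (rule LIMSEQ_unique)
  also have "(\<lambda>y. v y * indicator (box c d) y) = (\<lambda>y. indicator (box c d) y *\<^sub>R w y)"
    using r box_subset_cbox[of c d] by (fastforce simp: v_def indicator_def fun_eq_iff)
  finally show "(LINT x:box c d|lborel. w x) = 0" by (simp add: set_lebesgue_integral_def)
qed

text \<open>By the multiplication formula the average of \<open>h\<close> against a mollifier is an
  inverse transform of a product containing the transform of \<open>h\<close>, hence 0.\<close>

lemma fourier_unique:
  fixes h :: "'a \<Rightarrow> real"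
  assumes h: "integrable lborel h" and 0: "\<And>\<xi>. rfourier h \<xi> = 0"
  shows "AE x in lborel. h x = 0"
proof -
  have "(LINT y|lborel. h y * \<kappa> m (y - x)) = 0" for m and x
  proof -
    have "integrable lborel (\<lambda>x. complex_of_real (h x))" using h by simp
    from ifourier_fourier_mult[OF this fourier_int[of m], of x]
    have "(LINT y|lborel. complex_of_real (h y * \<kappa> m (x - y))) = 0"
      unfolding 0 inversion by (simp add: ifourier_def)
    then show ?thesis unfolding integral_complex_of_real even'[of m x] by simp
  qed
  moreover have "integrable lborel (\<lambda>x. indicator (cball 0 r) x * h x)" for r
    using integrable_mult_indicator[of "cball 0 r" lborel h] h by simp
  ultimately have "AE x in lborel. x \<in> UNIV \<longrightarrow> h x = 0"
    using h by (intro AE_zero_if_mollified_zero) auto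
  then show ?thesis by simp
qed

lemma fourier_eq_imp_AE_eq:
  fixes f g :: "'a \<Rightarrow> real"
  assumes "integrable lborel f" "integrable lborel g" "\<And>\<xi>. rfourier f \<xi> = rfourier g \<xi>"
  shows "AE x in lborel. f x = g x"
proof -
  have "rfourier (\<lambda>x. f x - g x) \<xi> = rfourier f \<xi> - rfourier g \<xi>" for \<xi>
    unfolding fourier_def using assms(1,2)
    by (subst Bochner_Integration.integral_diff[symmetric]) (auto intro!: integrable_mult_cis simp: algebra_simps)
  then have "AE x in lborel. f x - g x = 0"
    using assms by (intro fourier_unique) auto
  then show ?thesis by simp
qed

end

section \<open>Smooth functions\<close>

text \<open>The classical flat function \<open>exp (- 1 / t)\<close> with all its quotients by
  powers of \<open>t\<close>: differentiation raises the power, so only the whole family is closed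
  under it.\<close>

definition flat :: "nat \<Rightarrow> real \<Rightarrow> real" where
  "flat k t = (if 0 < t then exp (- (1 / t)) / t ^ k else 0)"

lemma flat_nonneg: "0 \<le> flat k t"
  by (simp add: flat_def)

text \<open>A single term of the exponential series. It controls the flat functions at 0 and later
  the decay of the Bessel kernel at infinity.\<close>

lemma power_le_fact_exp:
  fixes x :: real
  assumes "0 \<le> x"
  shows "x ^ n \<le> fact n * exp x"
proof -
  have "(\<lambda>n. x ^ n /\<^sub>R fact n) sums exp x" by (rule exp_converges)
  then have "(\<Sum>i\<in>{n}. x ^ i /\<^sub>R fact i) \<le> exp x"
    unfolding sums_iff by (metis (no_types, lifting) assms finite.intros sum_le_suminf scaleR_nonneg_nonneg
      zero_le_power inverse_nonnegative_iff_nonnegative fact_ge_zero)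
  then show ?thesis by (simp add: field_simps)
qed

text \<open>With \<open>x = 1 / t\<close> this is the domination of \<open>x ^ Suc k\<close> by the
  exponential; the extra power leaves the factor \<open>t\<close> that forces the limit 0.\<close>

lemma flat_le: "flat k t \<le> fact (Suc k) * \<bar>t\<bar>"
proof (cases "0 < t")
  case True
  define x where "x = 1 / t"
  have x: "0 < x" using True by (simp add: x_def)
  have "x ^ k * x \<le> fact (Suc k) * exp x"
    using power_le_fact_exp[of x "Suc k"] x by (simp add: mult.commute del: fact_Suc)
  then have "x ^ k * exp (- x) \<le> fact (Suc k) / x"
    using x by (simp add: exp_minus field_simps del: fact_Suc)
  then show ?thesis using True by (simp add: flat_def x_def power_divide field_simps del: fact_Suc)
next
  case False
  have "0 \<le> (fact (Suc k) :: real) * \<bar>t\<bar>" by (intro mult_nonneg_nonneg fact_ge_zero abs_ge_zero)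
  then show ?thesis using False by (simp only: flat_def if_False)
qed

lemma flat_tendsto_0: "(flat k \<longlongrightarrow> 0) (at 0)"
proof (rule tendsto_sandwich[where f = "\<lambda>_. 0" and h = "\<lambda>t. fact (Suc k) * \<bar>t\<bar>"])
  show "((\<lambda>t. fact (Suc k) * \<bar>t\<bar>) \<longlongrightarrow> (0::real)) (at 0)"
    by (auto intro!: tendsto_eq_intros)
qed (auto simp: flat_nonneg flat_le simp del: fact_Suc)

lemma flat_has_derivative:
  "(flat k has_real_derivative flat (k + 2) t - real k * flat (k + 1) t) (at t)"
proof -
  consider "0 < t" | "t < 0" | "t = 0" by linarith
  then show ?thesis
  proof cases
    case 1
    have "((\<lambda>t. exp (- (1 / t)) / t ^ k) has_real_derivative
        (exp (- (1 / t)) * (1 / t\<^sup>2) * t ^ k - exp (- (1 / t)) * (real k * t ^ (k - 1))) / (t ^ k * t ^ k)) (at t)"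
      using 1 by (auto intro!: derivative_eq_intros simp: power2_eq_square)
    also have "(exp (- (1 / t)) * (1 / t\<^sup>2) * t ^ k - exp (- (1 / t)) * (real k * t ^ (k - 1))) / (t ^ k * t ^ k)
        = flat (k + 2) t - real k * flat (k + 1) t"
      using 1 by (cases k) (auto simp: flat_def power2_eq_square field_simps)
    finally show ?thesis
      by (rule has_field_derivative_transform_within[where d = t]) (use 1 in \<open>auto simp: flat_def dist_real_def\<close>)
  next
    case 2
    have "((\<lambda>_. 0::real) has_real_derivative 0) (at t)" by simp
    then have "(flat k has_real_derivative 0) (at t)"
      by (rule has_field_derivative_transform_within[where d = "- t"]) (use 2 in \<open>auto simp: flat_def dist_real_def\<close>)
    then show ?thesis using 2 by (simp add: flat_def)
  next
    case 3
    \<comment> \<open>The difference quotient of \<open>flat k\<close> at 0 is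
      \<open>flat (Suc k)\<close>, whose limit is known.\<close>
    have "((\<lambda>h. (flat k (0 + h) - flat k 0) / h) \<longlongrightarrow> 0) (at 0)"
    proof (rule Lim_transform_eventually[OF flat_tendsto_0[of "Suc k"]])
      show "\<forall>\<^sub>F h in at 0. flat (Suc k) h = (flat k (0 + h) - flat k 0) / h"
        by (auto simp: eventually_at_filter flat_def)
    qed
    then show ?thesis using 3 by (simp add: DERIV_def flat_def)
  qed
qed

text \<open>A class closed under directional derivatives, hence contained in the coinductively defined smooth functions.\<close>

inductive_set smooth_class :: "('a::euclidean_space \<Rightarrow> real) set" where
  const: "(\<lambda>x. c) \<in> smooth_class"
| inner: "(\<lambda>x. x \<bullet> v) \<in> smooth_class"
| add: "f \<in> smooth_class \<Longrightarrow> g \<in> smooth_class \<Longrightarrow> (\<lambda>x. f x + g x) \<in> smooth_class"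
| mult: "f \<in> smooth_class \<Longrightarrow> g \<in> smooth_class \<Longrightarrow> (\<lambda>x. f x * g x) \<in> smooth_class"
| flat: "f \<in> smooth_class \<Longrightarrow> (\<lambda>x. flat k (f x)) \<in> smooth_class"

lemma smooth_class_diff:
  assumes "f \<in> smooth_class" "g \<in> smooth_class"
  shows "(\<lambda>x. f x - g x) \<in> smooth_class"
  using smooth_class.add[OF assms(1) smooth_class.mult[OF smooth_class.const[of "-1"] assms(2)]] by simp

lemma smooth_class_sum:
  "finite A \<Longrightarrow> (\<And>i. i \<in> A \<Longrightarrow> f i \<in> smooth_class) \<Longrightarrow> (\<lambda>x. \<Sum>i\<in>A. f i x) \<in> smooth_class"
  by (induction A rule: finite_induct) (auto intro: smooth_class.intros)

lemma smooth_class_norm_diff: "(\<lambda>x. (norm (x - a))\<^sup>2) \<in> smooth_class"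
proof -
  have "(\<lambda>x. \<Sum>b\<in>Basis. (x \<bullet> b - a \<bullet> b) * (x \<bullet> b - a \<bullet> b)) \<in> smooth_class"
    by (intro smooth_class_sum smooth_class.mult smooth_class_diff smooth_class.inner smooth_class.const) auto
  also have "(\<lambda>x. \<Sum>b\<in>Basis. (x \<bullet> b - a \<bullet> b) * (x \<bullet> b - a \<bullet> b)) = (\<lambda>x. (norm (x - a))\<^sup>2)"
    unfolding power2_norm_eq_inner by (subst (2) euclidean_inner) (simp add: inner_diff_left fun_eq_iff)
  finally show ?thesis .
qed

lemma smooth_class_derivative:
  fixes f :: "'a::euclidean_space \<Rightarrow> real"
  assumes "f \<in> smooth_class"
  shows "\<exists>D. (\<forall>v. (\<lambda>x. D x v) \<in> smooth_class) \<and> (\<forall>x. (f has_derivative D x) (at x))"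
  using assms
proof induction
  case (const c)
  show ?case by (rule exI[of _ "\<lambda>_ _. 0"]) (auto intro: smooth_class.intros)
next
  case (inner v)
  show ?case by (rule exI[of _ "\<lambda>_ w. w \<bullet> v"]) (auto intro: smooth_class.intros intro!: derivative_eq_intros)
next
  case (add f g)
  then obtain D E where
    D: "\<And>v. (\<lambda>x. D x v) \<in> smooth_class" "\<And>x. (f has_derivative D x) (at x)" and
    E: "\<And>v. (\<lambda>x. E x v) \<in> smooth_class" "\<And>x. (g has_derivative E x) (at x)" by blast
  show ?case
    by (rule exI[of _ "\<lambda>x v. D x v + E x v"]) (intro conjI allI smooth_class.add D E has_derivative_add)
next
  case (mult f g)
  then obtain D E where
    D: "\<And>v. (\<lambda>x. D x v) \<in> smooth_class" "\<And>x. (f has_derivative D x) (at x)" and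
    E: "\<And>v. (\<lambda>x. E x v) \<in> smooth_class" "\<And>x. (g has_derivative E x) (at x)" by blast
  show ?case
    by (rule exI[of _ "\<lambda>x v. f x * E x v + D x v * g x"])
       (intro conjI allI smooth_class.add smooth_class.mult D E has_derivative_mult mult.hyps)
next
  case (flat f k)
  then obtain D where
    D: "\<And>v. (\<lambda>x. D x v) \<in> smooth_class" "\<And>x. (f has_derivative D x) (at x)" by blast
  show ?case
  proof (rule exI[of _ "\<lambda>x v. (flat (k + 2) (f x) - real k * flat (k + 1) (f x)) * D x v"], intro conjI allI)
    show "(\<lambda>x. (flat (k + 2) (f x) - real k * flat (k + 1) (f x)) * D x v) \<in> smooth_class" for v
      by (intro smooth_class.mult smooth_class_diff smooth_class.flat smooth_class.const flat.hyps D)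
    show "((\<lambda>x. flat k (f x)) has_derivative (\<lambda>v. (flat (k + 2) (f x) - real k * flat (k + 1) (f x)) * D x v)) (at x)" for x
      using has_derivative_compose[OF D(2) flat_has_derivative[unfolded has_field_derivative_def, of k "f x"]] .
  qed
qed

lemma smooth_class_continuous:
  assumes "f \<in> smooth_class"
  shows "continuous_on A f"
proof -
  obtain D where "\<And>x. (f has_derivative D x) (at x)" using smooth_class_derivative[OF assms] by blast
  then show ?thesis
    by (intro continuous_at_imp_continuous_on ballI) (rule has_derivative_continuous)
qed

section \<open>Compactly supported functions, bumps and concrete mollifiers\<close>

lemma integrable_compact_support:
  fixes f :: "'a::euclidean_space \<Rightarrow> real"
  assumes "continuous_on UNIV f" and "\<And>x. r < norm x \<Longrightarrow> f x = 0"
  shows "integrable lborel f"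
proof -
  have "integrable lborel (\<lambda>x. indicator (cball 0 r) x *\<^sub>R f x)"
    using assms(1) by (intro borel_integrable_compact) (auto intro: continuous_on_subset)
  also have "(\<lambda>x. indicator (cball 0 r) x *\<^sub>R f x) = f"
    using assms(2) by (auto simp: indicator_def fun_eq_iff not_le)
  finally show ?thesis .
qed

lemma bounded_compact_support:
  fixes f :: "'a::euclidean_space \<Rightarrow> real"
  assumes "continuous_on UNIV f" and "\<And>x. r < norm x \<Longrightarrow> f x = 0"
  obtains M where "0 \<le> M" "\<And>x. \<bar>f x\<bar> \<le> M"
proof -
  have "compact (f ` cball 0 r)"
    using assms(1) by (intro compact_continuous_image) (auto intro: continuous_on_subset)
  then obtain M where M: "\<And>x. x \<in> cball 0 r \<Longrightarrow> \<bar>f x\<bar> \<le> M"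
    by (force dest!: compact_imp_bounded simp: bounded_iff)
  have "\<bar>f x\<bar> \<le> max 0 M" for x
    using M[of x] assms(2)[of x] by (cases "norm x \<le> r") (auto simp: not_le)
  then show ?thesis by (intro that[of "max 0 M"]) auto
qed

text \<open>The squared norm is used because it is a polynomial in the coordinates; the norm itself
  is not smooth at the centre.\<close>

definition bump :: "real \<Rightarrow> 'a::euclidean_space \<Rightarrow> 'a \<Rightarrow> real" where
  "bump e a x = flat 0 (e\<^sup>2 - (norm (x - a))\<^sup>2)"

lemma bump_smooth: "bump e a \<in> smooth_class"
  unfolding bump_def[abs_def]
  by (intro smooth_class.flat smooth_class_diff smooth_class.const smooth_class_norm_diff)

lemma bump_nonneg: "0 \<le> bump e a x"
  by (simp add: bump_def flat_nonneg)

lemma bump_supp: "0 < e \<Longrightarrow> bump e a x \<noteq> 0 \<longleftrightarrow> norm (x - a) < e"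
  using power2_less_imp_less[of "norm (x - a)" e] power_strict_mono[of "norm (x - a)" e 2] by (auto simp: bump_def flat_def)

lemma bump_translate: "bump e a x = bump e 0 (x - a)"
  by (simp add: bump_def)

lemma bump_even: "bump e 0 (- x) = bump e 0 x"
  by (simp add: bump_def)

text \<open>Reflecting the variable conjugates the integrand. A real transform has a nonnegative
  square, which is what the self-convolution of a bump exploits.\<close>

lemma fourier_even_real:
  fixes f :: "'a::euclidean_space \<Rightarrow> real"
  assumes f: "integrable lborel f" and e: "\<And>x. f (- x) = f x"
  shows "rfourier f \<xi> = complex_of_real (Re (rfourier f \<xi>))"
proof -
  let ?h = "\<lambda>x. complex_of_real (f x) * cis (- 2 * pi * (x \<bullet> \<xi>))"
  have [measurable]: "f \<in> borel_measurable borel" using f by auto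
  have "rfourier f \<xi> = (LINT x|lborel. ?h (0 - x))"
    unfolding fourier_def by (rule integral_reflect_at[symmetric]) simp
  also have "\<dots> = (LINT x|lborel. cnj (?h x))"
    by (simp add: e cis_cnj)
  also have "\<dots> = cnj (rfourier f \<xi>)"
    unfolding fourier_def by (rule Bochner_Integration.integral_cnj)
  finally show ?thesis by (simp add: complex_eq_iff)
qed

lemma conv_even:
  fixes f g :: "'a::euclidean_space \<Rightarrow> real"
  assumes [measurable]: "f \<in> borel_measurable borel" "g \<in> borel_measurable borel"
    and f: "\<And>x. f (- x) = f x" and g: "\<And>x. g (- x) = g x"
  shows "conv f g (- x) = conv f g x"
proof -
  have "conv f g (- x) = (LINT y|lborel. f (- x - (0 - y)) * g (0 - y))"
    unfolding conv_def by (rule integral_reflect_at[symmetric]) simp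
  also have "\<dots> = conv f g x"
    unfolding conv_def by (intro Bochner_Integration.integral_cong refl) (use f[of "x - y" for y] g in simp)
  finally show ?thesis .
qed

lemma continuous_conv:
  fixes f g :: "'a::euclidean_space \<Rightarrow> real"
  assumes f: "continuous_on UNIV f" "\<And>x. \<bar>f x\<bar> \<le> M" and g: "integrable lborel g"
  shows "continuous_on UNIV (conv f g)"
proof (rule continuous_at_imp_continuous_on, rule ballI, rule continuous_at_sequentiallyI)
  fix x and u :: "nat \<Rightarrow> 'a" assume u: "u \<longlonglongrightarrow> x"
  have [measurable]: "f \<in> borel_measurable borel" "g \<in> borel_measurable borel"
    using f g by (auto intro: borel_measurable_continuous_onI)
  show "(\<lambda>n. conv f g (u n)) \<longlonglongrightarrow> conv f g x"
    unfolding conv_def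
  proof (rule integral_dominated_convergence[where w = "\<lambda>y. M * \<bar>g y\<bar>"])
    show "AE y in lborel. (\<lambda>n. f (u n - y) * g y) \<longlonglongrightarrow> f (x - y) * g y"
    proof (intro AE_I2 tendsto_mult_right)
      fix y
      have "isCont f (x - y)" using f(1) by (simp add: continuous_on_eq_continuous_at)
      then show "(\<lambda>n. f (u n - y)) \<longlonglongrightarrow> f (x - y)"
        by (rule isCont_tendsto_compose) (intro tendsto_intros u)
    qed
    show "AE y in lborel. norm (f (u n - y) * g y) \<le> M * \<bar>g y\<bar>" for n
      using f(2) by (auto simp: abs_mult intro!: mult_right_mono)
  qed (use g in auto)
qed

lemma conv_bound:
  fixes f g :: "'a::euclidean_space \<Rightarrow> real"
  assumes [measurable]: "f \<in> borel_measurable borel" and f: "\<And>x. \<bar>f x\<bar> \<le> M" and g: "integrable lborel g"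
  shows "\<bar>conv f g x\<bar> \<le> M * (LINT y|lborel. \<bar>g y\<bar>)"
proof -
  have "\<bar>conv f g x\<bar> \<le> (LINT y|lborel. \<bar>f (x - y) * g y\<bar>)"
    unfolding conv_def using integral_norm_bound[of lborel "\<lambda>y. f (x - y) * g y"] by simp
  also have "\<dots> \<le> (LINT y|lborel. M * \<bar>g y\<bar>)"
    by (rule integral_mono') (use f g order_trans[OF abs_ge_zero f] in \<open>auto simp: abs_mult intro!: mult_right_mono mult_nonneg_nonneg\<close>)
  finally show ?thesis by simp
qed

lemma conv_supp:
  assumes f: "\<And>x. r < norm x \<Longrightarrow> f x = 0" and g: "\<And>x. r' < norm x \<Longrightarrow> g x = 0"
    and x: "r + r' < norm x"
  shows "conv f g x = 0"
proof -
  have "f (x - y) * g y = 0" for y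
    using f[of "x - y"] g[of y] x norm_triangle_ineq[of "x - y" y] by force
  then show ?thesis unfolding conv_def by (simp only:) simp
qed

lemma bump_integrable: "0 < e \<Longrightarrow> integrable lborel (bump e (a::'a::euclidean_space))"
proof (rule integrable_compact_support[OF smooth_class_continuous[OF bump_smooth], where r = "norm a + e"])
  fix x :: 'a assume "0 < e" "norm a + e < norm x"
  then show "bump e a x = 0"
    using bump_supp[of e a x] norm_triangle_ineq[of a "x - a"] by fastforce
qed

lemma bump_integral_pos:
  assumes e: "0 < e"
  shows "0 < (LINT x|lborel. bump e (0::'a::euclidean_space) x)"
proof (rule ccontr)
  assume "\<not> ?thesis"
  then have "(LINT x|lborel. bump e (0::'a) x) = 0"
    using Bochner_Integration.integral_nonneg[of lborel "bump e (0::'a)"] bump_nonneg[of e "0::'a"]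
    by (metis order_le_less)
  then have "AE x in lborel. bump e (0::'a) x = 0"
    by (subst (asm) integral_nonneg_eq_0_iff_AE[OF bump_integrable[OF e]]) (auto simp: bump_nonneg)
  then have "AE x in lborel. x \<notin> ball (0::'a) e"
    by eventually_elim (use bump_supp[OF e, of 0] in auto)
  then have "ball (0::'a) e \<in> null_sets lborel"
    by (subst (asm) AE_iff_null_sets[symmetric]) auto
  then have "negligible (ball (0::'a) e)"
    by (simp add: negligible_iff_null_sets null_sets_completionI)
  then show False using open_not_negligible[of "ball (0::'a) e"] e by auto
qed

text \<open>The transform of the self-convolution of an even function is a square, hence nonnegative and integrable.\<close>

lemma mollifiers_exist:
  obtains \<kappa> :: "nat \<Rightarrow> 'a::euclidean_space \<Rightarrow> real" and c e
  where "mollifiers \<kappa>" "\<And>m. 0 < e m" "\<And>m x. \<kappa> m x = c m * conv (bump (e m) 0) (bump (e m) 0) x"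
proof -
  \<comment> \<open>Self-convolution doubles the radius of the support, so each bump gets half of
    the allowed radius.\<close>
  define e where "e m = 1 / (2 * real (Suc m))" for m
  have e: "0 < e m" for m by (simp add: e_def)
  define \<rho> :: "nat \<Rightarrow> 'a \<Rightarrow> real" where "\<rho> m = bump (e m) 0" for m
  have i: "integrable lborel (\<rho> m)" for m unfolding \<rho>_def by (intro bump_integrable e)
  then have [measurable]: "\<rho> m \<in> borel_measurable borel" for m by auto
  have s: "\<rho> m x = 0" if "e m < norm x" for m x
    using bump_supp[OF e, of m 0 x] that by (auto simp: \<rho>_def)
  have re: "\<rho> m (- x) = \<rho> m x" for m x by (simp add: \<rho>_def bump_even)
  have c: "continuous_on UNIV (\<rho> m)" for m
    unfolding \<rho>_def by (rule smooth_class_continuous[OF bump_smooth])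
  define I where "I m = (LINT x|lborel. \<rho> m x)" for m
  have I: "0 < I m" for m unfolding I_def \<rho>_def by (intro bump_integral_pos e)
  define k where "k m = conv (\<rho> m) (\<rho> m)" for m
  have ki: "integrable lborel (k m)" for m
    unfolding k_def by (intro integrable_conv i)
  have kc: "continuous_on UNIV (k m)" and kb: "\<exists>M. \<forall>x. \<bar>k m x\<bar> \<le> M" for m
  proof -
    obtain M where "\<And>x. \<bar>\<rho> m x\<bar> \<le> M" using bounded_compact_support[OF c s] by blast
    then show "continuous_on UNIV (k m)" "\<exists>M. \<forall>x. \<bar>k m x\<bar> \<le> M"
      unfolding k_def using continuous_conv[OF c _ i] conv_bound[of "\<rho> m", OF _ _ i[of m]] by auto blast
  qed
  have kf: "rfourier (k m) \<xi> = complex_of_real ((Re (rfourier (\<rho> m) \<xi>))\<^sup>2)" for m \<xi>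
  proof -
    have "rfourier (\<rho> m) \<xi> = complex_of_real (Re (rfourier (\<rho> m) \<xi>))"
      by (rule fourier_even_real[OF i]) (simp add: \<rho>_def bump_even)
    then show ?thesis
      unfolding k_def fourier_conv[OF i i] by (metis of_real_mult power2_eq_square)
  qed
  have kfi: "integrable lborel (rfourier (k m))" for m
  proof -
    obtain M where "\<And>x. \<bar>k m x\<bar> \<le> M" using kb by blast
    then show ?thesis by (rule fourier_integrable_if_nonneg[OF ki kc _ kf]) simp
  qed
  have kint: "(LINT x|lborel. k m x) = (I m)\<^sup>2" for m
  proof -
    have "rfourier (k m) 0 = complex_of_real (LINT x|lborel. k m x)"
         "rfourier (\<rho> m) 0 = complex_of_real (I m)"
      by (simp_all add: fourier_def I_def integral_complex_of_real)
    then show ?thesis using kf[of m 0] by (simp only: Re_complex_of_real of_real_eq_iff)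
  qed
  \<comment> \<open>The transform at frequency 0 shows that the self-convolution has mass
    \<open>(I m)\<^sup>2\<close>.\<close>
  define \<kappa> where "\<kappa> m x = 1 / (I m)\<^sup>2 * k m x" for m x
  have "mollifiers \<kappa>"
  proof
    fix m x
    show "continuous_on UNIV (\<kappa> m)" unfolding \<kappa>_def[abs_def] by (intro continuous_intros kc)
    show "\<exists>M. \<forall>x. \<bar>\<kappa> m x\<bar> \<le> M"
    proof -
      obtain M where "\<And>x. \<bar>k m x\<bar> \<le> M" using kb by blast
      then have "\<bar>\<kappa> m x\<bar> \<le> 1 / (I m)\<^sup>2 * M" for x
        unfolding \<kappa>_def abs_mult by (intro mult_mono) auto
      then show ?thesis by blast
    qed
    show "0 \<le> \<kappa> m x"
      unfolding \<kappa>_def k_def conv_def \<rho>_def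
      by (intro mult_nonneg_nonneg integral_nonneg_AE AE_I2 bump_nonneg) auto
    show "\<kappa> m (- x) = \<kappa> m x"
      unfolding \<kappa>_def k_def using conv_even[of "\<rho> m" "\<rho> m" x] by (simp add: re)
    show "integrable lborel (\<kappa> m)" unfolding \<kappa>_def[abs_def] by (intro integrable_mult_right ki)
    show "(LINT x|lborel. \<kappa> m x) = 1"
      unfolding \<kappa>_def using I[of m] by (simp add: kint)
    have "rfourier (\<kappa> m) = (\<lambda>\<xi>. complex_of_real (1 / (I m)\<^sup>2) * rfourier (k m) \<xi>)"
      unfolding fourier_def \<kappa>_def of_real_mult mult.assoc integral_mult_right_zero ..
    then show "integrable lborel (rfourier (\<kappa> m))"
      using kfi[of m] by (simp only: integrable_mult_right)
    show "norm x \<le> 1 / real (Suc m)" if "\<kappa> m x \<noteq> 0"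
    proof (rule ccontr)
      assume "\<not> ?thesis"
      moreover have "e m + e m = 1 / real (Suc m)" unfolding e_def by (simp only: mult_2 add_divide_distrib) (simp add: field_simps)
      ultimately have "e m + e m < norm x" by linarith
      then have "k m x = 0" unfolding k_def by (intro conv_supp[OF s s])
      then show False using that by (simp add: \<kappa>_def)
    qed
  qed
  \<comment> \<open>The concrete form is exported along with the locale because the smoothness
    argument later splits off one of the two bumps.\<close>
  then show ?thesis
    by (rule that[where e = e and c = "\<lambda>m. 1 / (I m)\<^sup>2"]) (simp_all add: \<kappa>_def k_def \<rho>_def e)
qed

section \<open>Differentiating a convolution with an integrable kernel\<close>

definition smooth_compact :: "('a::euclidean_space \<Rightarrow> real) \<Rightarrow> bool" where
  "smooth_compact \<psi> \<longleftrightarrow> \<psi> \<in> smooth_class \<and> (\<exists>r. \<forall>x. r < norm x \<longrightarrow> \<psi> x = 0)"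

lemma smooth_compact_derivative:
  fixes \<psi> :: "'a::euclidean_space \<Rightarrow> real"
  assumes "smooth_compact \<psi>"
  obtains D where "\<And>v. smooth_compact (\<lambda>x. D x v)" "\<And>x. (\<psi> has_derivative D x) (at x)"
proof -
  obtain r where r: "\<And>x. r < norm x \<Longrightarrow> \<psi> x = 0" using assms by (auto simp: smooth_compact_def)
  obtain D where D: "\<And>v. (\<lambda>x. D x v) \<in> smooth_class" "\<And>x. (\<psi> has_derivative D x) (at x)"
    using smooth_class_derivative[of \<psi>] assms by (auto simp: smooth_compact_def)
  have "D x v = 0" if x: "r < norm x" for x v
  proof -
    have "open {x::'a. r < norm x}" by (intro open_Collect_less continuous_intros)
    then have "(\<psi> has_derivative (\<lambda>_. 0)) (at x)"
      by (rule has_derivative_transform_within_open[OF has_derivative_const[of 0]]) (use x r in auto)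
    then have "D x = (\<lambda>_. 0)" by (rule has_derivative_unique[OF D(2)])
    then show ?thesis by simp
  qed
  then show ?thesis using D by (intro that[of D]) (auto simp: smooth_compact_def)
qed

lemma smooth_compact_integrable: "smooth_compact \<psi> \<Longrightarrow> integrable lborel \<psi>"
  using integrable_compact_support smooth_class_continuous unfolding smooth_compact_def by blast

lemma smooth_compact_continuous: "smooth_compact \<psi> \<Longrightarrow> continuous_on UNIV \<psi>"
  using smooth_class_continuous unfolding smooth_compact_def by blast

lemma smooth_compact_bounded:
  assumes "smooth_compact \<psi>"
  obtains M where "0 \<le> M" "\<And>x. \<bar>\<psi> x\<bar> \<le> M"
proof -
  obtain r where "\<And>x. r < norm x \<Longrightarrow> \<psi> x = 0" using assms by (auto simp: smooth_compact_def)
  then show ?thesis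
    by (rule bounded_compact_support[OF smooth_compact_continuous[OF assms]]) (use that in auto)
qed

text \<open>The sequential form of differentiability is the one to which dominated convergence
  applies.\<close>

lemma has_derivative_sequentiallyI:
  fixes f :: "'a::real_normed_vector \<Rightarrow> real"
  assumes "bounded_linear F"
    and "\<And>u. (\<And>n. u n \<noteq> 0) \<Longrightarrow> u \<longlonglongrightarrow> 0 \<Longrightarrow> (\<lambda>n. (f (x + u n) - f x - F (u n)) / norm (u n)) \<longlonglongrightarrow> 0"
  shows "(f has_derivative F) (at x)"
proof -
  have "((\<lambda>h. (f (x + h) - f x - F h) / norm h) \<longlongrightarrow> 0) (at 0)"
    unfolding tendsto_at_iff_sequentially using assms(2) by (auto simp: comp_def)
  then have "((\<lambda>h. norm (f (x + h) - f x - F h) / norm h) \<longlongrightarrow> 0) (at 0)"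
    by (subst (asm) tendsto_rabs_zero_iff[symmetric]) (simp add: abs_divide)
  then show ?thesis using assms(1) by (simp add: has_derivative_at)
qed

text \<open>All derivatives fall on \<open>\<psi>\<close>, so \<open>K\<close> may be merely
  integrable. The difference quotients minus the linear part are dominated by \<open>2 * L\<close>,
  one \<open>L\<close> from the Lipschitz bound for \<open>\<psi>\<close> and one from the
  derivative itself.\<close>

lemma conv_has_derivative:
  fixes K \<psi> :: "'a::euclidean_space \<Rightarrow> real"
  assumes K: "integrable lborel K"
    and D: "\<And>v. smooth_compact (\<lambda>x. D x v)" and d: "\<And>x. (\<psi> has_derivative D x) (at x)"
    and \<psi>: "smooth_compact \<psi>"
  shows "(conv K \<psi> has_derivative (\<lambda>v. conv K (\<lambda>x. D x v) x)) (at x)"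
proof -
  have [measurable]: "K \<in> borel_measurable borel" using K by auto
  have [measurable]: "\<psi> \<in> borel_measurable borel" using smooth_compact_integrable[OF \<psi>] by auto
  have Dm [measurable]: "(\<lambda>x. D x v) \<in> borel_measurable borel" for v using smooth_compact_integrable[OF D] by auto
  have lin: "bounded_linear (D x)" for x using d by (rule has_derivative_bounded_linear)
  have "linear (D x)" for x using lin by (rule bounded_linear.linear)
  note D_add = linear_add[OF this] and D_scaleR = linear_scale[OF this] and D_sum = linear_sum[OF this]
  have flip: "conv K g x = (LINT y|lborel. K y * g (x - y))" if "g \<in> borel_measurable borel" for g x
    using integral_reflect_at[of "\<lambda>y. K (x - y) * g y" x] that by (simp add: conv_def)
  have int: "integrable lborel (\<lambda>y. K y * g (x - y))" if g: "smooth_compact g" for g x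
  proof -
    obtain M where M: "\<And>x. \<bar>g x\<bar> \<le> M" using smooth_compact_bounded[OF g] by blast
    have [measurable]: "g \<in> borel_measurable borel" using smooth_compact_integrable[OF g] by auto
    show ?thesis
      by (rule Bochner_Integration.integrable_bound[of _ "\<lambda>y. K y * M"])
         (use K M in \<open>auto simp: abs_mult intro!: mult_left_mono order_trans[OF M abs_ge_self]\<close>)
  qed
  have "\<exists>M. \<forall>b\<in>(Basis::'a set). \<forall>x. \<bar>D x b\<bar> \<le> M"
  proof -
    have "\<forall>b. \<exists>M. \<forall>x. \<bar>D x b\<bar> \<le> M" using smooth_compact_bounded[OF D] by metis
    then obtain M where M: "\<And>b x. \<bar>D x b\<bar> \<le> M b" by metis
    have "\<bar>D x b\<bar> \<le> (\<Sum>b\<in>Basis. \<bar>M b\<bar>)" if "b \<in> (Basis::'a set)" for x b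
      using M[of x b] member_le_sum[of b Basis "\<lambda>b. \<bar>M b\<bar>"] that by fastforce
    then show ?thesis by blast
  qed
  then obtain M where M: "\<And>b x. b \<in> (Basis::'a set) \<Longrightarrow> \<bar>D x b\<bar> \<le> M" by blast
  \<comment> \<open>Expanding a direction in coordinates adds up \<open>DIM('a)\<close> partial
    derivatives, each bounded by \<open>M\<close>; by the mean value inequality \<open>L\<close> is
    also a Lipschitz constant of \<open>\<psi>\<close>.\<close>
  define L where "L = real DIM('a) * M"
  have DL: "\<bar>D x v\<bar> \<le> L * norm v" for x v
  proof -
    have "D x v = D x (\<Sum>b\<in>Basis. (v \<bullet> b) *\<^sub>R b)" by (simp add: euclidean_representation)
    also have "\<dots> = (\<Sum>b\<in>Basis. (v \<bullet> b) * D x b)" by (simp add: D_sum D_scaleR)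
    finally have "\<bar>D x v\<bar> \<le> (\<Sum>b\<in>Basis. \<bar>(v \<bullet> b) * D x b\<bar>)" by simp
    also have "\<dots> \<le> (\<Sum>b\<in>(Basis::'a set). norm v * M)"
      by (intro sum_mono) (use M Basis_le_norm in \<open>auto simp: abs_mult intro!: mult_mono\<close>)
    finally show ?thesis by (simp add: L_def mult_ac)
  qed
  have lip: "\<bar>\<psi> (z + h) - \<psi> z\<bar> \<le> L * norm h" for z h
  proof -
    have "norm (\<psi> (z + h) - \<psi> z) \<le> L * norm (z + h - z)"
    proof (rule differentiable_bound[OF convex_UNIV])
      show "(\<psi> has_derivative D x) (at x within UNIV)" for x using d by simp
      show "onorm (D x) \<le> L" for x
        using DL by (intro onorm_le) auto
    qed auto
    then show ?thesis by simp
  qed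
  define F where "F v = conv K (\<lambda>x. D x v) x" for v
  have F: "(LINT y|lborel. K y * D (x - y) v) = F v" for v
    by (simp add: F_def flip)
  have bl: "bounded_linear F"
    proof (rule bounded_linear_intro[where K = "(LINT y|lborel. \<bar>K y\<bar>) * L"])
      show "F (v + w) = F v + F w" for v w
        by (simp add: F_def flip D_add distrib_left Bochner_Integration.integral_add[OF int[OF D] int[OF D]])
      show "F (c *\<^sub>R v) = c *\<^sub>R F v" for c v
        by (simp add: F_def flip D_scaleR mult.left_commute[of _ c])
      show "norm (F v) \<le> norm v * ((LINT y|lborel. \<bar>K y\<bar>) * L)" for v
      proof -
        have "norm (F v) \<le> (LINT y|lborel. norm (K y * D (x - y) v))"
          unfolding F[symmetric]
          by (rule integral_norm_bound)
        also have "\<dots> \<le> (LINT y|lborel. \<bar>K y\<bar> * (L * norm v))"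
          by (rule integral_mono') (use K DL in \<open>auto simp: abs_mult intro!: mult_left_mono mult_nonneg_nonneg order_trans[OF abs_ge_zero DL]\<close>)
        finally show ?thesis by (simp add: mult_ac)
      qed
    qed
  have "(conv K \<psi> has_derivative F) (at x)"
  proof (rule has_derivative_sequentiallyI[OF bl])
    fix u :: "nat \<Rightarrow> 'a" assume u0: "\<And>n. u n \<noteq> 0" and u: "u \<longlonglongrightarrow> 0"
    let ?q = "\<lambda>n y. K y * ((\<psi> (x - y + u n) - \<psi> (x - y) - D (x - y) (u n)) / norm (u n))"
    have "(\<lambda>n. LINT y|lborel. ?q n y) \<longlonglongrightarrow> (LINT y|lborel. K y * 0)"
    proof (rule integral_dominated_convergence[where w = "\<lambda>y. \<bar>K y\<bar> * (2 * L)"])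
      show "AE y in lborel. (\<lambda>n. ?q n y) \<longlonglongrightarrow> K y * 0"
      proof (intro AE_I2 tendsto_mult_left)
        fix y
        have "((\<lambda>h. norm (\<psi> (x - y + h) - \<psi> (x - y) - D (x - y) h) / norm h) \<longlongrightarrow> 0) (at 0)"
          using d[of "x - y"] by (simp add: has_derivative_at)
        then have "(\<lambda>n. norm (\<psi> (x - y + u n) - \<psi> (x - y) - D (x - y) (u n)) / norm (u n)) \<longlonglongrightarrow> 0"
          unfolding tendsto_at_iff_sequentially using u0 u by (auto simp: comp_def)
        then have "(\<lambda>n. \<bar>(\<psi> (x - y + u n) - \<psi> (x - y) - D (x - y) (u n)) / norm (u n)\<bar>) \<longlonglongrightarrow> 0"
          by (simp add: abs_divide)
        then show "(\<lambda>n. (\<psi> (x - y + u n) - \<psi> (x - y) - D (x - y) (u n)) / norm (u n)) \<longlonglongrightarrow> 0"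
          by (rule tendsto_rabs_zero_cancel)
      qed
      show "AE y in lborel. norm (?q n y) \<le> \<bar>K y\<bar> * (2 * L)" for n
      proof (intro AE_I2)
        fix y
        have "\<bar>\<psi> (x - y + u n) - \<psi> (x - y) - D (x - y) (u n)\<bar> \<le> 2 * L * norm (u n)"
          using lip[of "x - y" "u n"] DL[of "x - y" "u n"] by linarith
        then have "\<bar>(\<psi> (x - y + u n) - \<psi> (x - y) - D (x - y) (u n)) / norm (u n)\<bar> \<le> 2 * L"
          using u0[of n] by (simp add: abs_divide pos_divide_le_eq)
        then show "norm (?q n y) \<le> \<bar>K y\<bar> * (2 * L)"
          unfolding real_norm_def abs_mult[of "K y"] by (intro mult_left_mono) auto
      qed
    qed (use K in auto)
    moreover have "(LINT y|lborel. ?q n y) = (conv K \<psi> (x + u n) - conv K \<psi> x - F (u n)) / norm (u n)" for n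
    proof -
      have i1: "integrable lborel (\<lambda>y. K y * \<psi> (x - y + u n))"
        using int[OF \<psi>, of "x + u n"] by (simp add: algebra_simps)
      have "(LINT y|lborel. ?q n y) = (LINT y|lborel. (K y * \<psi> (x - y + u n) - K y * \<psi> (x - y) - K y * D (x - y) (u n)) / norm (u n))"
        by (intro Bochner_Integration.integral_cong refl) (simp add: algebra_simps diff_divide_distrib)
      also have "\<dots> = ((LINT y|lborel. K y * \<psi> (x - y + u n)) - (LINT y|lborel. K y * \<psi> (x - y)) - (LINT y|lborel. K y * D (x - y) (u n))) / norm (u n)"
        using i1 int[OF \<psi>, of x] int[OF D[of "u n"], of x] by simp
      finally show ?thesis by (simp only: F) (simp add: flip algebra_simps)
    qed
    ultimately show "(\<lambda>n. (conv K \<psi> (x + u n) - conv K \<psi> x - F (u n)) / norm (u n)) \<longlonglongrightarrow> 0"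
      by (simp only: mult_zero_right Bochner_Integration.integral_zero)
  qed
  then show ?thesis unfolding F_def[abs_def] .
qed

text \<open>Coinduction on the shape \<open>conv K \<psi>\<close>: a directional derivative has the
  same shape, with \<open>\<psi>\<close> replaced by a derivative that is again
  \<open>smooth_compact\<close>.\<close>

lemma conv_smooth_fun:
  fixes K \<psi> :: "'a::euclidean_space \<Rightarrow> real"
  assumes "integrable lborel K" and "smooth_compact \<psi>"
  shows "smooth_fun (conv K \<psi>)"
  using assms(2)
proof (coinduction arbitrary: \<psi> rule: smooth_fun.coinduct)
  case smooth_fun
  obtain D where D: "\<And>v. smooth_compact (\<lambda>x. D x v)" "\<And>x. (\<psi> has_derivative D x) (at x)"
    using smooth_compact_derivative[OF smooth_fun] by blast
  have d: "(conv K \<psi> has_derivative (\<lambda>v. conv K (\<lambda>x. D x v) x)) (at x)" for x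
    by (rule conv_has_derivative[OF assms(1) D smooth_fun])
  have "frechet_derivative (conv K \<psi>) (at x) v = conv K (\<lambda>x. D x v) x" for x v
    using frechet_derivative_at[OF d[of x]] by (simp add: fun_eq_iff)
  moreover have "conv K \<psi> differentiable_on UNIV"
    using d unfolding differentiable_on_def differentiable_def by blast
  ultimately show ?case using D by auto
qed

section \<open>The Bessel kernel\<close>

text \<open>Euler's Gamma integrand, extended by 0 so that all integrals over \<open>t\<close> run
  over the whole line. Orders \<open>s \<le> 0\<close> occur too, but only together with a factor
  that decays fast as \<open>t\<close> approaches 0.\<close>

definition gamma_weight :: "real \<Rightarrow> real \<Rightarrow> real" where
  "gamma_weight s t = indicator {0<..} t * (t powr (s - 1) * exp (- t))"

lemma borel_measurable_gamma_weight [measurable]: "gamma_weight s \<in> borel_measurable borel"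
  unfolding gamma_weight_def[abs_def] by measurable

lemma gamma_weight_nonneg: "0 \<le> gamma_weight s t"
  by (simp add: gamma_weight_def)

lemma gamma_weight_nonpos: "t \<le> 0 \<Longrightarrow> gamma_weight s t = 0"
  by (simp add: gamma_weight_def)

lemma gamma_weight_integral:
  assumes "0 < s"
  shows "integrable lborel (gamma_weight s)" and "(LINT t|lborel. gamma_weight s t) = Gamma s"
proof -
  let ?f = "\<lambda>t. t powr (s - 1) / exp t"
  have h: "(?f has_integral Gamma s) {0<..}"
    using Gamma_integral_real[OF assms] has_integral_spike_set_eq[of "{0::real..}" "{0<..}" ?f]
    by (subst has_integral_spike_set_eq[of _ "{0..}"]) (auto intro: negligible_subset[of "{0}"])
  then have "?f absolutely_integrable_on {0<..}"
    by (intro nonnegative_absolutely_integrable_1) (auto simp: integrable_on_def)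
  then have i: "integrable lebesgue (\<lambda>t. indicator {0<..} t *\<^sub>R ?f t)" and "(LINT t:{0<..}|lebesgue. ?f t) = Gamma s"
    using h by (auto simp: set_integrable_def set_lebesgue_integral_eq_integral integral_unique)
  moreover have eq: "(\<lambda>t. indicator {0<..} t *\<^sub>R ?f t) = gamma_weight s"
    by (auto simp: gamma_weight_def exp_minus divide_inverse)
  ultimately have "integrable lebesgue (gamma_weight s)" "(LINT t|lebesgue. gamma_weight s t) = Gamma s"
    unfolding set_lebesgue_integral_def by simp_all
  then show "integrable lborel (gamma_weight s)" "(LINT t|lborel. gamma_weight s t) = Gamma s"
    by (simp_all add: integrable_completion integral_completion)
qed

text \<open>Substitution of \<open>l * t\<close> in the Gamma integral. The exponent contains
  \<open>l - 1\<close> because the weight already carries \<open>exp (- t)\<close>.\<close>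

lemma gamma_weight_scaled:
  assumes "0 < s" "0 < l"
  shows "integrable lborel (\<lambda>t. gamma_weight s t * exp (- (l - 1) * t))"
    and "(LINT t|lborel. gamma_weight s t * exp (- (l - 1) * t)) = Gamma s * l powr (- s)"
proof -
  have eq: "gamma_weight s (0 + l * t) = l powr (s - 1) * (gamma_weight s t * exp (- (l - 1) * t))" for t
    using assms by (auto simp: gamma_weight_def powr_mult exp_add[symmetric] zero_less_mult_iff indicator_def algebra_simps)
  have "integrable lborel (\<lambda>t. gamma_weight s (0 + l * t))"
    using assms gamma_weight_integral(1) by (subst lborel_integrable_real_affine_iff) auto
  then have "integrable lborel (\<lambda>t. l powr (1 - s) * (l powr (s - 1) * (gamma_weight s t * exp (- (l - 1) * t))))"
    unfolding eq by (rule integrable_mult_right)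
  moreover have 1: "l powr (1 - s) * (l powr (s - 1) * y) = y" for y
    using assms by (simp add: mult.assoc[symmetric] powr_add[symmetric])
  ultimately show "integrable lborel (\<lambda>t. gamma_weight s t * exp (- (l - 1) * t))" by (simp only:)
  have "Gamma s = l * (LINT t|lborel. gamma_weight s (0 + l * t))"
    using assms lborel_integral_real_affine[of l "gamma_weight s" 0] gamma_weight_integral(2)[of s] by simp
  also have "\<dots> = l * l powr (s - 1) * (LINT t|lborel. gamma_weight s t * exp (- (l - 1) * t))"
    unfolding eq by simp
  also have "l * l powr (s - 1) = l powr s" using assms by (simp add: powr_diff)
  finally show "(LINT t|lborel. gamma_weight s t * exp (- (l - 1) * t)) = Gamma s * l powr (- s)"
    using assms by (simp add: powr_minus field_simps)
qed

text \<open>The formula comes from \<open>\<Gamma>(s) l\<^bsup>-s\<^esup> = \<integral> t\<^bsup>s-1\<^esup> exp (-l t) dt\<close> with \<open>l = 1 + 4\<pi>\<^sup>2|\<xi>|\<^sup>2\<close>. Its value at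
  \<open>x = 0\<close> is junk when the integral diverges.\<close>

definition bessel_heat :: "real \<Rightarrow> 'a::euclidean_space \<Rightarrow> real" where
  "bessel_heat s x = (LINT t|lborel. gamma_weight s t * heat t x) / Gamma s"

lemma bessel_heat_pair_integrable:
  assumes "0 < s"
  shows "integrable (lborel \<Otimes>\<^sub>M lborel) (\<lambda>(t, x::'a::euclidean_space). gamma_weight s t * heat t x)"
proof (rule lborel_pair.Fubini_integrable)
  have "(LINT x|lborel. norm (gamma_weight s t * heat t (x::'a))) = gamma_weight s t" for t
    by (cases "0 < t") (simp_all add: abs_mult gamma_weight_nonneg heat_nonneg heat_integral gamma_weight_nonpos)
  then show "integrable lborel (\<lambda>t. LINT x|lborel. norm (case (t, x::'a) of (t, x) \<Rightarrow> gamma_weight s t * heat t x))"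
    using gamma_weight_integral(1)[OF assms] by simp
  have "integrable lborel (\<lambda>x::'a. gamma_weight s t * heat t x)" for t
    by (cases "0 < t") (simp_all add: heat_fourier(1) gamma_weight_nonpos)
  then show "AE t in lborel. integrable lborel (\<lambda>x::'a. case (t, x) of (t, x) \<Rightarrow> gamma_weight s t * heat t x)"
    by simp
qed measurable

lemma bessel_heat_integrable:
  assumes "0 < s"
  shows "integrable lborel (bessel_heat s :: 'a::euclidean_space \<Rightarrow> real)"
  unfolding bessel_heat_def[abs_def]
  by (intro integrable_divide lborel_pair.integrable_snd bessel_heat_pair_integrable assms)

lemma bessel_heat_even: "bessel_heat s (- x) = bessel_heat s x"
  by (simp add: bessel_heat_def heat_def)

lemma bessel_heat_fourier:
  assumes s: "0 < s"
  shows "rfourier (bessel_heat s) \<xi> = complex_of_real ((1 + 4 * pi\<^sup>2 * (norm \<xi>)\<^sup>2) powr (- s))"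
proof -
  let ?H = "\<lambda>t x. complex_of_real (gamma_weight s t * heat t x) * cis (- 2 * pi * (x \<bullet> \<xi>))"
  have i: "integrable (lborel \<Otimes>\<^sub>M lborel) (case_prod ?H)"
    by (rule Bochner_Integration.integrable_bound[OF bessel_heat_pair_integrable[OF s]]) (auto simp: norm_mult)
  have "complex_of_real (Gamma s) * rfourier (bessel_heat s) \<xi>
      = (LINT x|lborel. complex_of_real (Gamma s * bessel_heat s x) * cis (- 2 * pi * (x \<bullet> \<xi>)))"
    unfolding fourier_def by (simp add: mult.assoc)
  also have "\<dots> = (LINT x|lborel. LINT t|lborel. ?H t x)"
    using Gamma_real_pos[OF s] unfolding integral_mult_left_zero integral_complex_of_real by (simp add: bessel_heat_def)
  also have "\<dots> = (LINT t|lborel. LINT x|lborel. ?H t x)"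
    by (rule lborel_pair.Fubini_integral[OF i])
  also have "\<dots> = (LINT t|lborel. complex_of_real (gamma_weight s t * exp (- ((1 + 4 * pi\<^sup>2 * (norm \<xi>)\<^sup>2) - 1) * t)))"
  proof (intro Bochner_Integration.integral_cong refl)
    fix t
    have "(LINT x|lborel. ?H t x) = complex_of_real (gamma_weight s t) * rfourier (heat t) \<xi>"
      unfolding fourier_def integral_mult_right_zero[symmetric] by (simp add: mult.assoc)
    also have "\<dots> = complex_of_real (gamma_weight s t * exp (- ((1 + 4 * pi\<^sup>2 * (norm \<xi>)\<^sup>2) - 1) * t))"
      by (cases "0 < t") (simp_all add: heat_fourier gamma_weight_nonpos mult_ac)
    finally show "(LINT x|lborel. ?H t x) = complex_of_real (gamma_weight s t * exp (- ((1 + 4 * pi\<^sup>2 * (norm \<xi>)\<^sup>2) - 1) * t))" .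
  qed
  also have "\<dots> = complex_of_real (Gamma s) * complex_of_real ((1 + 4 * pi\<^sup>2 * (norm \<xi>)\<^sup>2) powr (- s))"
    unfolding integral_complex_of_real by (subst gamma_weight_scaled[OF s]) (auto intro!: add_pos_nonneg)
  finally show ?thesis using Gamma_real_pos[OF s] by simp
qed

text \<open>The Gamma formula writes the power as a superposition of Gaussians. Integrating each
  Gaussian in space gives a multiple of \<open>t powr (- n / 2)\<close> for dimension
  \<open>n\<close>, so what remains is a Gamma integral of order \<open>N - n / 2\<close>, positive
  by assumption.\<close>

lemma integrable_inverse_power:
  assumes N: "DIM('a) / 2 < real N"
  shows "integrable lborel (\<lambda>x::'a::euclidean_space. 1 / (1 + (norm x)\<^sup>2) ^ N)"
proof -
  let ?n = "DIM('a)"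
  have N0: "0 < real N" using N by (meson divide_nonneg_pos less_le_trans not_less of_nat_0_le_iff order_less_le_trans zero_less_numeral le_less_trans)
  have a: "0 < real N - ?n / 2" using N by simp
  let ?H = "\<lambda>t \<xi>::'a. gamma_weight N t * exp (- 4 * pi\<^sup>2 * t * (norm \<xi>)\<^sup>2)"
  have heat0: "(LINT \<xi>|lborel. exp (- 4 * pi\<^sup>2 * t * (norm (\<xi>::'a))\<^sup>2)) = (1 / (4 * pi * t)) powr (?n / 2)"
     and heat0i: "integrable lborel (\<lambda>\<xi>::'a. exp (- 4 * pi\<^sup>2 * t * (norm \<xi>)\<^sup>2))" if "0 < t" for t
  proof -
    have "complex_of_real (LINT \<xi>|lborel. exp (- 4 * pi\<^sup>2 * t * (norm (\<xi>::'a))\<^sup>2)) = complex_of_real (heat t (0::'a))"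
      using heat_ifourier(2)[OF that, of "0::'a"]
      unfolding ifourier_def inner_zero_left mult_zero_right cis_zero mult_1_right integral_complex_of_real .
    then show "(LINT \<xi>|lborel. exp (- 4 * pi\<^sup>2 * t * (norm (\<xi>::'a))\<^sup>2)) = (1 / (4 * pi * t)) powr (?n / 2)"
      by (simp only: of_real_eq_iff) (simp add: heat_def)
    show "integrable lborel (\<lambda>\<xi>::'a. exp (- 4 * pi\<^sup>2 * t * (norm \<xi>)\<^sup>2))"
      using integrable_Re[OF heat_ifourier(1)[OF that]] by simp
  qed
  have i: "integrable (lborel \<Otimes>\<^sub>M lborel) (case_prod ?H)"
  proof (rule lborel_pair.Fubini_integrable)
    have "(LINT x|lborel. norm (?H t x)) = (1 / (4 * pi)) powr (?n / 2) * gamma_weight (real N - ?n / 2) t" for t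
    proof (cases "0 < t")
      case True
      then have "(LINT x|lborel. norm (?H t x)) = gamma_weight N t * (1 / (4 * pi * t)) powr (?n / 2)"
        by (simp only: real_norm_def abs_mult abs_exp_cancel heat0 integral_mult_right_zero abs_of_nonneg[OF gamma_weight_nonneg])
      also have "\<dots> = (1 / (4 * pi)) powr (?n / 2) * gamma_weight (real N - ?n / 2) t"
      proof -
        have "t powr (real N - 1) = t powr (real N - ?n / 2 - 1) * t powr (?n / 2)"
          using True by (simp add: powr_add[symmetric])
        moreover have "(1 / (4 * pi * t)) powr (?n / 2) * t powr (?n / 2) = (1 / (4 * pi)) powr (?n / 2)"
          using True by (subst powr_mult[symmetric]) auto
        ultimately show ?thesis
          using True by (simp add: gamma_weight_def mult.commute)
      qed
      finally show ?thesis .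
    qed (simp add: gamma_weight_nonpos)
    then show "integrable lborel (\<lambda>t. LINT x|lborel. norm (case_prod ?H (t, x)))"
      using gamma_weight_integral(1)[OF a] by simp
    show "AE t in lborel. integrable lborel (\<lambda>x. case_prod ?H (t, x))"
    proof (intro AE_I2)
      fix t show "integrable lborel (\<lambda>x. case_prod ?H (t, x))"
        using heat0i[of t] by (cases "0 < t") (simp_all add: gamma_weight_nonpos)
    qed
  qed measurable
  have "integrable lborel (\<lambda>\<xi>. LINT t|lborel. ?H t \<xi>)"
    by (rule lborel_pair.integrable_snd[OF i])
  moreover have "(LINT t|lborel. ?H t \<xi>) = Gamma N / (1 + 4 * pi\<^sup>2 * (norm \<xi>)\<^sup>2) ^ N" for \<xi>
  proof -
    have p: "0 < 1 + 4 * pi\<^sup>2 * (norm \<xi>)\<^sup>2" by (intro add_pos_nonneg) auto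
    have "(LINT t|lborel. ?H t \<xi>) = (LINT t|lborel. gamma_weight N t * exp (- ((1 + 4 * pi\<^sup>2 * (norm \<xi>)\<^sup>2) - 1) * t))"
      by (simp add: mult_ac)
    also have "\<dots> = Gamma N * (1 + 4 * pi\<^sup>2 * (norm \<xi>)\<^sup>2) powr (- real N)"
      by (rule gamma_weight_scaled(2)[OF N0 p])
    finally show ?thesis using p by (simp add: powr_minus powr_realpow divide_inverse)
  qed
  ultimately have *: "integrable lborel (\<lambda>\<xi>::'a. Gamma N / (1 + 4 * pi\<^sup>2 * (norm \<xi>)\<^sup>2) ^ N)" by simp
  \<comment> \<open>Removing the constant \<open>4 * pi\<^sup>2\<close>, which is at least 1, from
    the denominator costs at most the factor \<open>(4 * pi\<^sup>2) ^ N\<close>.\<close>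
  show ?thesis
  proof (rule Bochner_Integration.integrable_bound[OF integrable_mult_right[OF *, of "(4 * pi\<^sup>2) ^ N / Gamma N"]])
    show "AE x::'a in lborel. norm (1 / (1 + (norm x)\<^sup>2) ^ N) \<le> norm ((4 * pi\<^sup>2) ^ N / Gamma N * (Gamma N / (1 + 4 * pi\<^sup>2 * (norm x)\<^sup>2) ^ N))"
    proof (intro AE_I2)
      fix x :: 'a
      have pi: "1 \<le> 4 * pi\<^sup>2" using pi_ge_two power_mono[of 2 pi 2] by simp
      have le: "(1 + 4 * pi\<^sup>2 * (norm x)\<^sup>2) ^ N \<le> (4 * pi\<^sup>2 * (1 + (norm x)\<^sup>2)) ^ N"
        using pi by (intro power_mono) (auto simp: distrib_left intro!: add_nonneg_nonneg)
      have key: "1 / A ^ N \<le> K ^ N / B ^ N" if "B ^ N \<le> (K * A) ^ N" "0 < A" "0 < B" for A B K :: real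
        using that by (simp add: field_simps)
      have "1 / (1 + (norm x)\<^sup>2) ^ N \<le> (4 * pi\<^sup>2) ^ N / (1 + 4 * pi\<^sup>2 * (norm x)\<^sup>2) ^ N"
        by (rule key[OF le]) (auto intro!: add_pos_nonneg)
      then show "norm (1 / (1 + (norm x)\<^sup>2) ^ N) \<le> norm ((4 * pi\<^sup>2) ^ N / Gamma N * (Gamma N / (1 + 4 * pi\<^sup>2 * (norm x)\<^sup>2) ^ N))"
        using Gamma_real_pos[OF N0] by (simp add: abs_mult power_abs add_nonneg_nonneg)
    qed
  qed simp
qed

text \<open>The kernel as a function of \<open>r = |x|\<^sup>2\<close>; here \<open>a\<close> may be negative, and the values for \<open>r \<le> 0\<close> are not used.\<close>

definition bessel_radial :: "real \<Rightarrow> real \<Rightarrow> real" where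
  "bessel_radial a r = (LINT t|lborel. gamma_weight a t * exp (- (r / (4 * t))))"

text \<open>The prefactor of the heat kernel contributes \<open>t powr (- n / 2)\<close> in
  dimension \<open>n\<close>; absorbing it lowers the order of the weight from \<open>s\<close> to
  \<open>s - n / 2\<close>.\<close>

lemma bessel_heat_radial:
  fixes x :: "'a::euclidean_space"
  shows "bessel_heat s x = (1 / (4 * pi)) powr (DIM('a) / 2) / Gamma s * bessel_radial (s - DIM('a) / 2) ((norm x)\<^sup>2)"
proof -
  have "gamma_weight s t * heat t x = (1 / (4 * pi)) powr (DIM('a) / 2) * (gamma_weight (s - DIM('a) / 2) t * exp (- ((norm x)\<^sup>2 / (4 * t))))" for t
  proof (cases "0 < t")
    case True
    have "t powr (s - 1) = t powr (s - DIM('a) / 2 - 1) * t powr (DIM('a) / 2)"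
      using True by (simp add: powr_add[symmetric])
    moreover have "(1 / (4 * pi * t)) powr (DIM('a) / 2) * t powr (DIM('a) / 2) = (1 / (4 * pi)) powr (DIM('a) / 2)"
      using True by (subst powr_mult[symmetric]) auto
    ultimately show ?thesis
      using True by (simp add: gamma_weight_def heat_def mult.commute mult.left_commute)
  qed (simp add: gamma_weight_nonpos)
  then show ?thesis by (simp add: bessel_heat_def bessel_radial_def)
qed

text \<open>The bound \<open>exp (- y) \<le> fact N / y ^ N\<close> at
  \<open>y = r / (4 * t)\<close> trades the Gaussian factor for decay \<open>1 / r ^ N\<close> and a
  gain \<open>t ^ N\<close>, which raises the order of the weight. Large \<open>N\<close> thus makes
  any order integrable and yields any polynomial decay.\<close>

lemma gamma_weight_exp_le:
  assumes "0 < r"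
  shows "gamma_weight a t * exp (- (r / (4 * t))) \<le> fact N * 4 ^ N / r ^ N * gamma_weight (a + real N) t"
proof (cases "0 < t")
  case True
  let ?y = "r / (4 * t)"
  have y: "0 < ?y" using True assms by simp
  have "exp (- y) \<le> fact N / y ^ N" if "0 < y" for y :: real
    using power_le_fact_exp[of y N] that by (simp add: exp_minus field_simps)
  from this[OF y] have "exp (- ?y) \<le> fact N / ?y ^ N" .
  also have "\<dots> = fact N * 4 ^ N / r ^ N * t ^ N"
    using True by (simp add: power_divide power_mult_distrib)
  finally have "gamma_weight a t * exp (- ?y) \<le> gamma_weight a t * (fact N * 4 ^ N / r ^ N * t ^ N)"
    by (intro mult_left_mono gamma_weight_nonneg)
  also have "\<dots> = fact N * 4 ^ N / r ^ N * (gamma_weight a t * t ^ N)"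
    by (rule mult.left_commute)
  also have "gamma_weight a t * t ^ N = gamma_weight (a + real N) t"
    using True by (simp add: gamma_weight_def powr_realpow[symmetric] powr_add[symmetric] algebra_simps)
  finally show ?thesis .
qed (simp add: gamma_weight_nonpos)

lemma bessel_radial_integrable:
  assumes r: "0 < r"
  shows "integrable lborel (\<lambda>t. gamma_weight a t * exp (- (r / (4 * t))))"
proof -
  obtain N :: nat where N: "- a < real N" using reals_Archimedean2 by blast
  have i: "integrable lborel (\<lambda>t. fact N * 4 ^ N / r ^ N * gamma_weight (a + real N) t)"
    by (intro integrable_mult_right gamma_weight_integral(1)) (use N in simp)
  show ?thesis
  proof (rule Bochner_Integration.integrable_bound[OF i], simp, intro AE_I2)
    fix t
    have "norm (gamma_weight a t * exp (- (r / (4 * t)))) = gamma_weight a t * exp (- (r / (4 * t)))"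
      by (simp add: abs_mult gamma_weight_nonneg)
    also have "\<dots> \<le> fact N * 4 ^ N / r ^ N * gamma_weight (a + real N) t"
      by (rule gamma_weight_exp_le[OF r])
    also have "\<dots> \<le> norm (fact N * 4 ^ N / r ^ N * gamma_weight (a + real N) t)"
      unfolding real_norm_def by (rule abs_ge_self)
    finally show "norm (gamma_weight a t * exp (- (r / (4 * t)))) \<le> norm (fact N * 4 ^ N / r ^ N * gamma_weight (a + real N) t)" .
  qed
qed

lemma bessel_radial_nonneg: "0 \<le> bessel_radial a r"
  unfolding bessel_radial_def by (intro Bochner_Integration.integral_nonneg) (simp add: gamma_weight_nonneg)

lemma bessel_radial_le:
  assumes r: "0 < r" and N: "0 < a + real N"
  shows "bessel_radial a r \<le> fact N * 4 ^ N * Gamma (a + real N) / r ^ N"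
proof -
  have "bessel_radial a r \<le> (LINT t|lborel. fact N * 4 ^ N / r ^ N * gamma_weight (a + real N) t)"
    unfolding bessel_radial_def
    by (intro integral_mono bessel_radial_integrable[OF r] integrable_mult_right gamma_weight_integral(1)[OF N] gamma_weight_exp_le[OF r])
  then show ?thesis using gamma_weight_integral(2)[OF N] by simp
qed

lemma exp_quadratic_error: "\<bar>exp x - 1 - x\<bar> \<le> exp \<bar>x\<bar> * (x::real)\<^sup>2"
proof -
  have "(\<Sum>i\<le>1. x ^ i / fact i) = 1 + x" by (simp add: atMost_Suc)
  then show ?thesis using Taylor_exp_field[of x 1] by (simp add: power2_eq_square algebra_simps)
qed

text \<open>A quadratic remainder survives integration over a parameter, so this criterion permits
  differentiation under the integral without a limit theorem.\<close>

lemma has_real_derivative_quadraticI: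
  fixes f :: "real \<Rightarrow> real"
  assumes d: "0 < d" and b: "\<And>h. \<bar>h\<bar> \<le> d \<Longrightarrow> \<bar>f (x + h) - f x - h * D\<bar> \<le> C * h\<^sup>2"
  shows "(f has_real_derivative D) (at x)"
proof -
  have "((\<lambda>h. (f (x + h) - f x) / h - D) \<longlongrightarrow> 0) (at 0)"
  proof (rule tendsto_rabs_zero_cancel, rule tendsto_sandwich[where f = "\<lambda>_. 0" and h = "\<lambda>h. C * \<bar>h\<bar>"])
    have "\<forall>\<^sub>F h in at (0::real). \<bar>h\<bar> < d \<and> h \<noteq> 0"
      using d by (auto simp: eventually_at dist_real_def intro!: exI[of _ d])
    then show "\<forall>\<^sub>F h in at 0. \<bar>(f (x + h) - f x) / h - D\<bar> \<le> C * \<bar>h\<bar>"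
    proof eventually_elim
      fix h assume h: "\<bar>h\<bar> < d \<and> h \<noteq> 0"
      have "\<bar>(f (x + h) - f x) / h - D\<bar> = \<bar>f (x + h) - f x - h * D\<bar> / \<bar>h\<bar>"
        using h by (simp add: field_simps flip: abs_divide)
      also have "\<dots> \<le> C * h\<^sup>2 / \<bar>h\<bar>" using b[of h] h by (intro divide_right_mono) auto
      also have "\<dots> = C * \<bar>h\<bar>" using h by (simp add: power2_eq_square abs_if)
      finally show "\<bar>(f (x + h) - f x) / h - D\<bar> \<le> C * \<bar>h\<bar>" .
    qed
    show "((\<lambda>h. C * \<bar>h\<bar>) \<longlongrightarrow> 0) (at 0)" by (auto intro!: tendsto_eq_intros)
  qed auto
  then show ?thesis unfolding DERIV_def by (simp add: LIM_zero_iff)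
qed

text \<open>Differentiating \<open>exp (- (r / (4 * t)))\<close> brings down
  \<open>- 1 / (4 * t)\<close>, which lowers the order by one. The second-order Taylor remainder
  lowers it by two.\<close>

lemma bessel_radial_derivative:
  assumes r: "0 < r"
  shows "(bessel_radial a has_real_derivative - bessel_radial (a - 1) r / 4) (at r)"
proof (rule has_real_derivative_quadraticI)
  \<comment> \<open>For \<open>\<bar>h\<bar> \<le> r / 2\<close>, half of the exponent
    \<open>r / (4 * t)\<close> absorbs the growth \<open>exp \<bar>h / (4 * t)\<bar>\<close> of the
    Taylor remainder; the other half keeps the majorant integrable.\<close>
  show "0 < r / 2" using r by simp
  fix h :: real assume h: "\<bar>h\<bar> \<le> r / 2"
  have rh: "0 < r + h" "0 < r / 2" using h r by auto
  let ?g = "\<lambda>a r t. gamma_weight a t * exp (- (r / (4 * t)))"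
  let ?e = "\<lambda>t. ?g a (r + h) t - ?g a r t + h / 4 * ?g (a - 1) r t"
  have bd: "\<bar>?e t\<bar> \<le> h\<^sup>2 / 16 * ?g (a - 2) (r / 2) t" for t
  proof (cases "0 < t")
    case True
    let ?x = "- (h / (4 * t))"
    have g1: "gamma_weight (a - 1) t = gamma_weight a t / t" and g2: "gamma_weight (a - 2) t = gamma_weight a t / t\<^sup>2"
      using True by (simp_all add: gamma_weight_def powr_diff power2_eq_square power3_eq_cube powr_numeral field_simps)
    have "?e t = gamma_weight a t * exp (- (r / (4 * t))) * (exp ?x - 1 - ?x)"
      using True unfolding g1 by (simp add: field_simps flip: exp_add)
    also have "\<bar>\<dots>\<bar> \<le> gamma_weight a t * exp (- (r / (4 * t))) * (exp \<bar>?x\<bar> * ?x\<^sup>2)"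
      unfolding abs_mult using exp_quadratic_error[of ?x]
      by (intro mult_mono) (auto simp: gamma_weight_nonneg)
    also have "\<dots> = gamma_weight a t * (exp (- (r / (4 * t)) + \<bar>?x\<bar>) * ?x\<^sup>2)"
      unfolding exp_add by simp
    also have "\<dots> \<le> gamma_weight a t * (exp (- ((r / 2) / (4 * t))) * ?x\<^sup>2)"
      using True h by (intro mult_left_mono mult_right_mono gamma_weight_nonneg) (auto simp: field_simps abs_divide)
    also have "\<dots> = h\<^sup>2 / 16 * ?g (a - 2) (r / 2) t"
      using True unfolding g2 by (simp add: power_divide power_mult_distrib)
    finally show ?thesis .
  qed (simp add: gamma_weight_nonpos)
  have e: "(LINT t|lborel. ?e t) = bessel_radial a (r + h) - bessel_radial a r - h * (- bessel_radial (a - 1) r / 4)"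
    unfolding bessel_radial_def using bessel_radial_integrable[OF rh(1), of a] bessel_radial_integrable[OF r, of a]
      bessel_radial_integrable[OF r, of "a - 1"] by simp
  have "\<bar>LINT t|lborel. ?e t\<bar> \<le> (LINT t|lborel. \<bar>?e t\<bar>)"
    using integral_norm_bound[of lborel ?e] by simp
  also have "\<dots> \<le> (LINT t|lborel. h\<^sup>2 / 16 * ?g (a - 2) (r / 2) t)"
    by (rule integral_mono') (use bd bessel_radial_integrable[OF rh(2), of "a - 2"] in \<open>auto simp: gamma_weight_nonneg\<close>)
  also have "\<dots> = bessel_radial (a - 2) (r / 2) / 16 * h\<^sup>2"
    by (simp add: bessel_radial_def)
  finally show "\<bar>bessel_radial a (r + h) - bessel_radial a r - h * (- bessel_radial (a - 1) r / 4)\<bar> \<le> bessel_radial (a - 2) (r / 2) / 16 * h\<^sup>2"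
    unfolding e .
qed

text \<open>Smooth profiles that vanish near \<open>0\<close> and are monomials far out; the class is closed under
  differentiation and under multiplication by the variable.\<close>

definition cut_profile :: "(real \<Rightarrow> real) \<Rightarrow> bool" where
  "cut_profile f \<longleftrightarrow> f \<in> smooth_class \<and> (\<exists>d>0. \<forall>r<d. f r = 0) \<and> (\<exists>c m R. \<forall>r>R. f r = c * r ^ m)"

lemma cut_profile_times: "cut_profile f \<Longrightarrow> cut_profile (\<lambda>r. c * (r * f r))"
proof -
  assume f: "cut_profile f"
  have id: "(\<lambda>r::real. r) \<in> smooth_class" using smooth_class.inner[of "1::real"] by simp
  obtain c' m R where R: "\<And>r. R < r \<Longrightarrow> f r = c' * r ^ m" using f by (auto simp: cut_profile_def)
  have "c * (r * f r) = c * c' * r ^ Suc m" if "R < r" for r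
    using R[OF that] by simp
  then have "\<exists>c' m R. \<forall>r>R. c * (r * f r) = c' * r ^ m" by blast
  then show ?thesis
    using f unfolding cut_profile_def by (auto intro!: smooth_class.mult smooth_class.const id)
qed

lemma cut_profile_scale: "cut_profile f \<Longrightarrow> cut_profile (\<lambda>r. c * f r)"
proof -
  assume f: "cut_profile f"
  obtain c' m R where R: "\<And>r. R < r \<Longrightarrow> f r = c' * r ^ m" using f by (auto simp: cut_profile_def)
  have "c * f r = c * c' * r ^ m" if "R < r" for r
    using R[OF that] by simp
  then have "\<exists>c' m R. \<forall>r>R. c * f r = c' * r ^ m" by blast
  then show ?thesis
    using f unfolding cut_profile_def by (auto intro!: smooth_class.mult smooth_class.const)
qed

lemma cut_profile_derivative:
  assumes f: "cut_profile f"
  obtains f' where "cut_profile f'" "\<And>r. (f has_real_derivative f' r) (at r)"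
proof -
  obtain d where d: "0 < d" "\<And>r. r < d \<Longrightarrow> f r = 0" using f by (auto simp: cut_profile_def)
  obtain c m R where R: "\<And>r. R < r \<Longrightarrow> f r = c * r ^ m" using f by (auto simp: cut_profile_def)
  obtain D where D: "\<And>v. (\<lambda>x. D x v) \<in> smooth_class" "\<And>x. (f has_derivative D x) (at x)"
    using smooth_class_derivative[of f] f unfolding cut_profile_def by blast
  define f' where "f' r = D r 1" for r
  have f': "(f has_real_derivative f' r) (at r)" for r
  proof -
    have eq: "(*) (D r 1) = D r"
    proof
      fix h show "D r 1 * h = D r h"
        using linear_scale[OF has_derivative_linear[OF D(2)], of r h 1]
        unfolding real_scaleR_def mult_1_right by (simp only: mult.commute)
    qed
    show ?thesis unfolding has_field_derivative_def f'_def eq by (rule D(2))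
  qed
  have 1: "f' r = 0" if "r < d" for r
  proof (rule DERIV_unique[OF f'])
    show "(f has_real_derivative 0) (at r)"
      by (rule has_field_derivative_transform_within_open[OF DERIV_const[of 0], of "{..<d}"]) (use that d in auto)
  qed
  have 2: "f' r = c * real m * r ^ (m - 1)" if "R < r" for r
  proof (rule DERIV_unique[OF f'])
    have "((\<lambda>r. c * r ^ m) has_real_derivative c * real m * r ^ (m - 1)) (at r)"
      by (auto intro!: derivative_eq_intros)
    then show "(f has_real_derivative c * real m * r ^ (m - 1)) (at r)"
      by (rule has_field_derivative_transform_within_open[of _ _ _ "{R<..}"]) (use that R in auto)
  qed
  have "f' \<in> smooth_class" unfolding f'_def[abs_def] by (rule D(1))
  then have "cut_profile f'" unfolding cut_profile_def using d(1) 1 2 by blast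
  then show ?thesis using f' by (rule that)
qed

lemma cut_profile_bound:
  assumes f: "cut_profile f"
  obtains C m where "0 \<le> C" "\<And>r. 0 \<le> r \<Longrightarrow> \<bar>f r\<bar> \<le> C * (1 + r) ^ m"
proof -
  obtain c m R where R: "\<And>r. R < r \<Longrightarrow> f r = c * r ^ m" using f by (auto simp: cut_profile_def)
  have "continuous_on {0..R} f" using f by (auto simp: cut_profile_def intro: smooth_class_continuous)
  then have "bounded (f ` {0..R})" by (intro compact_imp_bounded compact_continuous_image) auto
  then obtain M where "\<forall>y\<in>f ` {0..R}. norm y \<le> M" unfolding bounded_iff by blast
  then have M: "\<And>r. r \<in> {0..R} \<Longrightarrow> \<bar>f r\<bar> \<le> M" by simp
  have "\<bar>f r\<bar> \<le> (\<bar>c\<bar> + \<bar>M\<bar>) * (1 + r) ^ m" if r: "0 \<le> r" for r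
  proof (cases "R < r")
    case True
    have "\<bar>f r\<bar> = \<bar>c\<bar> * r ^ m" using R[OF True] r by (simp add: abs_mult)
    also have "\<dots> \<le> (\<bar>c\<bar> + \<bar>M\<bar>) * (1 + r) ^ m" using r by (intro mult_mono power_mono) auto
    finally show ?thesis .
  next
    case False
    then have "\<bar>f r\<bar> \<le> \<bar>M\<bar>" using M[of r] r by auto
    also have "\<dots> \<le> (\<bar>c\<bar> + \<bar>M\<bar>) * 1" by simp
    also have "\<dots> \<le> (\<bar>c\<bar> + \<bar>M\<bar>) * (1 + r) ^ m" using r by (intro mult_left_mono one_le_power) auto
    finally show ?thesis .
  qed
  then show ?thesis by (intro that[of "\<bar>c\<bar> + \<bar>M\<bar>" m]) auto
qed

text \<open>The profile removes the singularity of the Bessel integral at 0, and the order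
  \<open>a\<close> varies because differentiation lowers it. Closure under derivatives and
  multiplication by \<open>r\<close> is what applying \<open>1 - \<Delta>\<close> repeatedly to a
  radial function requires.\<close>

inductive_set radial_class :: "(real \<Rightarrow> real) set" where
  base: "cut_profile f \<Longrightarrow> (\<lambda>r. f r * bessel_radial a r) \<in> radial_class"
| add: "F \<in> radial_class \<Longrightarrow> G \<in> radial_class \<Longrightarrow> (\<lambda>r. F r + G r) \<in> radial_class"

lemma radial_class_times: "F \<in> radial_class \<Longrightarrow> (\<lambda>r. c * (r * F r)) \<in> radial_class"
proof (induction rule: radial_class.induct)
  case (base f a)
  show ?case using radial_class.base[OF cut_profile_times[OF base, of c], of a] by (simp add: mult_ac)
next
  case (add F G)
  show ?case using radial_class.add[OF add.IH] by (simp add: algebra_simps)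
qed

lemma radial_class_scale: "F \<in> radial_class \<Longrightarrow> (\<lambda>r. c * F r) \<in> radial_class"
proof (induction rule: radial_class.induct)
  case (base f a)
  show ?case using radial_class.base[OF cut_profile_scale[OF base, of c], of a] by (simp add: mult_ac)
next
  case (add F G)
  show ?case using radial_class.add[OF add.IH] by (simp add: algebra_simps)
qed

lemma radial_class_derivative:
  assumes "F \<in> radial_class"
  shows "\<exists>F'\<in>radial_class. \<forall>r. (F has_real_derivative F' r) (at r)"
  using assms
proof (induction rule: radial_class.induct)
  case (base f a)
  obtain f' where f': "cut_profile f'" "\<And>r. (f has_real_derivative f' r) (at r)"
    using cut_profile_derivative[OF base] by blast
  obtain d where d: "0 < d" "\<And>r. r < d \<Longrightarrow> f r = 0" using base by (auto simp: cut_profile_def)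
  obtain d' where d': "0 < d'" "\<And>r. r < d' \<Longrightarrow> f' r = 0" using f'(1) by (auto simp: cut_profile_def)
  let ?F = "\<lambda>r. f' r * bessel_radial a r + (- (1 / 4)) * f r * bessel_radial (a - 1) r"
  have "?F \<in> radial_class"
    by (intro radial_class.add radial_class.base f' cut_profile_scale base)
  moreover have "((\<lambda>r. f r * bessel_radial a r) has_real_derivative ?F r) (at r)" for r
  proof (cases "0 < r")
    case True
    show ?thesis
      using DERIV_mult[OF f'(2) bessel_radial_derivative[OF True, of a]] by (simp add: mult_ac add.commute)
  next
    \<comment> \<open>The derivative formula for the Bessel integral covers only positive
      \<open>r\<close>; here the product vanishes on the neighbourhood \<open>{..<d}\<close>
      instead.\<close>
    case False
    have "((\<lambda>r. f r * bessel_radial a r) has_real_derivative 0) (at r)"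
      by (rule has_field_derivative_transform_within_open[OF DERIV_const[of 0], of "{..<d}"]) (use False d in auto)
    then show ?thesis using False d d' by simp
  qed
  ultimately show ?case by (intro bexI[of _ ?F]) auto
next
  case (add F G)
  then obtain F' G' where "F' \<in> radial_class" "\<And>r. (F has_real_derivative F' r) (at r)"
    "G' \<in> radial_class" "\<And>r. (G has_real_derivative G' r) (at r)" by blast
  then show ?case
    by (intro bexI[of _ "\<lambda>r. F' r + G' r"]) (auto intro: radial_class.add DERIV_add)
qed

lemma radial_class_continuous: "F \<in> radial_class \<Longrightarrow> continuous_on A F"
  using radial_class_derivative by (meson DERIV_isCont continuous_at_imp_continuous_on)

text \<open>The profile grows at most polynomially while the Bessel integral decays at any chosen
  polynomial rate. Near 0 the profile vanishes, and beyond \<open>d\<close> the ratio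
  \<open>(1 + r) / r\<close> is bounded.\<close>

lemma radial_class_decay:
  assumes "F \<in> radial_class"
  shows "\<exists>C\<ge>0. \<forall>r\<ge>0. \<bar>F r\<bar> \<le> C / (1 + r) ^ N"
  using assms
proof (induction rule: radial_class.induct)
  case (base f a)
  obtain d where d: "0 < d" "\<And>r. r < d \<Longrightarrow> f r = 0" using base by (auto simp: cut_profile_def)
  obtain C m where C: "0 \<le> C" "\<And>r. 0 \<le> r \<Longrightarrow> \<bar>f r\<bar> \<le> C * (1 + r) ^ m"
    using cut_profile_bound[OF base] by blast
  obtain K :: nat where K: "- a < real K" using reals_Archimedean2 by blast
  \<comment> \<open>Here \<open>m\<close> pays for the growth of the profile, \<open>N\<close> is
    the requested decay, and \<open>K\<close> makes the order \<open>a + M\<close> positive.\<close>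
  define M where "M = m + N + K"
  have aM: "0 < a + real M" using K by (simp add: M_def)
  define B where "B = fact M * 4 ^ M * Gamma (a + real M)"
  have B: "0 \<le> B" using Gamma_real_pos[OF aM] by (simp add: B_def)
  have "\<bar>f r * bessel_radial a r\<bar> \<le> C * B * (1 + 1 / d) ^ M / (1 + r) ^ N" if r: "0 \<le> r" for r
  proof (cases "r < d")
    case True
    then show ?thesis using d C B r by (auto intro!: divide_nonneg_nonneg mult_nonneg_nonneg)
  next
    case False
    then have r0: "0 < r" using d by simp
    have "(1 + r) / r \<le> 1 + 1 / d" using False d r0 by (simp add: field_simps)
    then have p: "((1 + r) / r) ^ M \<le> (1 + 1 / d) ^ M" using r0 by (intro power_mono) auto
    have "\<bar>f r * bessel_radial a r\<bar> \<le> (C * (1 + r) ^ m) * (B / r ^ M)"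
      unfolding abs_mult using C(2)[OF r] bessel_radial_le[OF r0 aM] bessel_radial_nonneg[of a r] C(1) r
      by (intro mult_mono) (auto simp: B_def)
    also have "\<dots> = C * B * (((1 + r) / r) ^ M * ((1 + r) ^ m / (1 + r) ^ M))"
      using r0 by (simp add: power_divide)
    also have "\<dots> \<le> C * B * ((1 + 1 / d) ^ M * (1 / (1 + r) ^ N))"
    proof (intro mult_left_mono mult_mono p)
      have "(1 + r) ^ m * (1 + r) ^ N \<le> (1 + r) ^ M"
        unfolding power_add[symmetric] M_def using r by (intro power_increasing) auto
      then show "(1 + r) ^ m / (1 + r) ^ M \<le> 1 / (1 + r) ^ N" using r0 by (simp add: field_simps)
    qed (use C B d r0 in auto)
    finally show ?thesis by (simp add: mult_ac)
  qed
  moreover have "0 \<le> C * B * (1 + 1 / d) ^ M" using C B d by (intro mult_nonneg_nonneg) auto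
  ultimately show ?case by blast
next
  case (add F G)
  then obtain C C' where C: "0 \<le> C" "\<And>r. 0 \<le> r \<Longrightarrow> \<bar>F r\<bar> \<le> C / (1 + r) ^ N"
    "0 \<le> C'" "\<And>r. 0 \<le> r \<Longrightarrow> \<bar>G r\<bar> \<le> C' / (1 + r) ^ N" by blast
  have "\<bar>F r + G r\<bar> \<le> (C + C') / (1 + r) ^ N" if "0 \<le> r" for r
    using C(2)[OF that] C(4)[OF that] by (simp add: add_divide_distrib)
  then show ?case using C by (intro exI[of _ "C + C'"]) auto
qed

text \<open>The weight \<open>h\<close> will be 1, a coordinate or its square: the factors that up
  to two differentiations of \<open>F ((norm x)\<^sup>2)\<close> produce.\<close>

lemma radial_integrable_power:
  fixes h :: "'a::euclidean_space \<Rightarrow> real"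
  assumes F: "F \<in> radial_class" and h: "continuous_on UNIV h" and b: "\<And>x. \<bar>h x\<bar> \<le> 1 + (norm x)\<^sup>2"
  shows "integrable lborel (\<lambda>x. h x * F ((norm x)\<^sup>2))"
proof -
  obtain N :: nat where N: "DIM('a) / 2 < real N" using reals_Archimedean2 by blast
  \<comment> \<open>The additional power of \<open>1 + r\<close> absorbs the bound on
    \<open>h\<close>.\<close>
  obtain C where C: "0 \<le> C" "\<And>r. 0 \<le> r \<Longrightarrow> \<bar>F r\<bar> \<le> C / (1 + r) ^ Suc N"
    using radial_class_decay[OF F, of "Suc N"] by blast
  have "continuous_on UNIV (\<lambda>x::'a. F ((norm x)\<^sup>2))"
    by (rule continuous_on_compose2[OF radial_class_continuous[OF F, of UNIV]]) (auto intro!: continuous_intros)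
  then have m: "(\<lambda>x. h x * F ((norm x)\<^sup>2)) \<in> borel_measurable borel"
    by (intro borel_measurable_continuous_onI continuous_on_mult h)
  show ?thesis
  proof (rule Bochner_Integration.integrable_bound[OF integrable_mult_right[OF integrable_inverse_power[OF N], of C]])
    show "AE x in lborel. norm (h x * F ((norm x)\<^sup>2)) \<le> norm (C * (1 / (1 + (norm x)\<^sup>2) ^ N))"
    proof (intro AE_I2)
      fix x :: 'a
      have p: "0 < 1 + (norm x)\<^sup>2" by (intro add_pos_nonneg) auto
      have "\<bar>h x * F ((norm x)\<^sup>2)\<bar> \<le> (1 + (norm x)\<^sup>2) * (C / (1 + (norm x)\<^sup>2) ^ Suc N)"
        unfolding abs_mult using C(2)[of "(norm x)\<^sup>2"] b[of x] p by (intro mult_mono) auto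
      also have "\<dots> = C * (1 / (1 + (norm x)\<^sup>2) ^ N)" using p by simp
      finally show "norm (h x * F ((norm x)\<^sup>2)) \<le> norm (C * (1 / (1 + (norm x)\<^sup>2) ^ N))"
        using C(1) by simp
    qed
  qed (use m in simp)
qed

section \<open>Parametrix\<close>

text \<open>Integrate \<open>G (x + b) - G x\<close>, the integral of
  \<open>G' (x + t *\<^sub>R b)\<close> over \<open>t\<close> in \<open>{0..1}\<close>, with respect
  to \<open>x\<close>. Translation invariance makes one side 0 and, after Fubini, the other side the
  integral of \<open>G'\<close>. Integrability thus replaces boundary terms.\<close>

lemma integral_directional_derivative:
  fixes G G' :: "'a::euclidean_space \<Rightarrow> complex"
  assumes G: "integrable lborel G" and G': "integrable lborel G'" "continuous_on UNIV G'"
    and d: "\<And>x t. ((\<lambda>t. G (x + t *\<^sub>R b)) has_vector_derivative G' (x + t *\<^sub>R b)) (at t)"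
  shows "(LINT x|lborel. G' x) = 0"
proof -
  have [measurable]: "G \<in> borel_measurable borel" "G' \<in> borel_measurable borel" using G G' by auto
  let ?H = "\<lambda>t x. indicator {0..1::real} t *\<^sub>R G' (x + t *\<^sub>R b)"
  have shift: "(LINT x|lborel. h (x + a)) = (LINT x|lborel. h x)" if "h \<in> borel_measurable borel"
    for h :: "'a \<Rightarrow> 'b::{banach,second_countable_topology}" and a
    using integral_translate[OF that, of a] by (simp add: add.commute)
  have shifti: "integrable lborel (\<lambda>x. h (x + a))" if "integrable lborel h"
    for h :: "'a \<Rightarrow> complex" and a
    using integrable_translate[OF that, of a] by (simp add: add.commute)
  have i: "integrable (lborel \<Otimes>\<^sub>M lborel) (case_prod ?H)"
  proof (rule lborel_pair.Fubini_integrable)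
    have n: "(LINT x|lborel. norm (?H t x)) = indicator {0..1} t *\<^sub>R (LINT x|lborel. norm (G' x))" for t
      by (simp add: shift[of "\<lambda>x. norm (G' x)"])
    show "integrable lborel (\<lambda>t. LINT x|lborel. norm (case_prod ?H (t, x)))"
      unfolding split_conv n by simp
    show "AE t in lborel. integrable lborel (\<lambda>x. case_prod ?H (t, x))"
      using shifti[OF G'(1)] by simp
  qed measurable
  have "(LINT t|lborel. ?H t x) = G (x + b) - G x" for x
  proof -
    have "has_bochner_integral lborel (\<lambda>t. indicator {0..1} t *\<^sub>R G' (x + t *\<^sub>R b)) (G (x + 1 *\<^sub>R b) - G (x + 0 *\<^sub>R b))"
    proof (rule has_bochner_integral_FTC_Icc)
      show "continuous_on {0..1} (\<lambda>t. G' (x + t *\<^sub>R b))"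
        by (rule continuous_on_compose2[OF G'(2)]) (auto intro!: continuous_intros)
      show "((\<lambda>t. G (x + t *\<^sub>R b)) has_vector_derivative G' (x + t *\<^sub>R b)) (at t within {0..1})" for t
        using d[of x t] by (rule has_vector_derivative_at_within)
    qed simp
    then show ?thesis by (simp add: has_bochner_integral_iff)
  qed
  then have "(LINT x|lborel. LINT t|lborel. ?H t x) = (LINT x|lborel. G (x + b)) - (LINT x|lborel. G x)"
    using shifti[OF G] G by simp
  also have "\<dots> = 0" by (simp add: shift)
  finally have "(LINT t|lborel. LINT x|lborel. ?H t x) = 0"
    using lborel_pair.Fubini_integral[OF i] by simp
  then show ?thesis by (simp add: shift)
qed

text \<open>Integration by parts: the directional derivative of \<open>f\<close> times the character
  has integral zero, and the product rule splits it into the two transforms.\<close>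

lemma fourier_directional_derivative:
  fixes f g :: "'a::euclidean_space \<Rightarrow> real"
  assumes f: "integrable lborel f" "continuous_on UNIV f" and g: "integrable lborel g" "continuous_on UNIV g"
    and d: "\<And>x t. ((\<lambda>t. f (x + t *\<^sub>R b)) has_real_derivative g (x + t *\<^sub>R b)) (at t)"
  shows "rfourier g \<xi> = 2 * pi * \<i> * complex_of_real (b \<bullet> \<xi>) * rfourier f \<xi>"
proof -
  let ?e = "\<lambda>x. cis (- 2 * pi * (x \<bullet> \<xi>))"
  let ?c = "- 2 * pi * \<i> * complex_of_real (b \<bullet> \<xi>)"
  have fi: "integrable lborel (\<lambda>x. complex_of_real (f x) * ?e x)" and gi: "integrable lborel (\<lambda>x. complex_of_real (g x) * ?e x)"
    using f g by (auto intro!: integrable_mult_cis)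
  have "(LINT x|lborel. complex_of_real (g x) * ?e x + ?c * (complex_of_real (f x) * ?e x)) = 0"
  proof (rule integral_directional_derivative[OF fi])
    show "integrable lborel (\<lambda>x. complex_of_real (g x) * ?e x + ?c * (complex_of_real (f x) * ?e x))"
      by (intro Bochner_Integration.integrable_add gi integrable_mult_right fi)
    show "continuous_on UNIV (\<lambda>x. complex_of_real (g x) * ?e x + ?c * (complex_of_real (f x) * ?e x))"
      by (intro continuous_intros f g)
    fix x t
    let ?\<alpha> = "- 2 * pi * (x \<bullet> \<xi>)" and ?\<beta> = "- 2 * pi * (b \<bullet> \<xi>)"
    have e: "?e (x + t *\<^sub>R b) = exp (\<i> * (complex_of_real ?\<alpha> + complex_of_real ?\<beta> * complex_of_real t))" for t
      by (simp add: cis_conv_exp inner_add_left algebra_simps)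
    have "((\<lambda>t. exp (\<i> * (complex_of_real ?\<alpha> + complex_of_real ?\<beta> * complex_of_real t))) has_vector_derivative
       ?c * exp (\<i> * (complex_of_real ?\<alpha> + complex_of_real ?\<beta> * complex_of_real t))) (at t)"
      by (rule has_vector_derivative_real_field) (auto intro!: derivative_eq_intros)
    then have e': "((\<lambda>t. ?e (x + t *\<^sub>R b)) has_vector_derivative ?c * ?e (x + t *\<^sub>R b)) (at t)"
      unfolding e .
    have "((\<lambda>t. complex_of_real (f (x + t *\<^sub>R b))) has_vector_derivative complex_of_real (g (x + t *\<^sub>R b))) (at t)"
      using d by (rule has_vector_derivative_of_real)
    from has_vector_derivative_mult[OF this e']
    show "((\<lambda>t. complex_of_real (f (x + t *\<^sub>R b)) * ?e (x + t *\<^sub>R b)) has_vector_derivative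
       complex_of_real (g (x + t *\<^sub>R b)) * ?e (x + t *\<^sub>R b) + ?c * (complex_of_real (f (x + t *\<^sub>R b)) * ?e (x + t *\<^sub>R b))) (at t)"
      by (simp only: mult.left_commute add.commute)
  qed
  then have "rfourier g \<xi> + ?c * rfourier f \<xi> = 0"
    unfolding fourier_def
    by (subst (asm) Bochner_Integration.integral_add[OF gi integrable_mult_right[OF fi]], subst (asm) integral_mult_right_zero)
  then show ?thesis by (simp add: add_eq_0_iff)
qed

lemma radial_directional_derivative:
  fixes x b :: "'a::euclidean_space"
  assumes "\<And>r. (F has_real_derivative F' r) (at r)"
  shows "((\<lambda>t. F ((norm (x + t *\<^sub>R b))\<^sup>2)) has_real_derivative 2 * ((x + t *\<^sub>R b) \<bullet> b) * F' ((norm (x + t *\<^sub>R b))\<^sup>2)) (at t)"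
proof -
  have e: "(norm (x + t *\<^sub>R b))\<^sup>2 = x \<bullet> x + 2 * t * (x \<bullet> b) + t * t * (b \<bullet> b)" for t
    unfolding power2_norm_eq_inner by (simp add: inner_add_left inner_add_right inner_commute algebra_simps)
  have "((\<lambda>t. (norm (x + t *\<^sub>R b))\<^sup>2) has_real_derivative 2 * ((x + t *\<^sub>R b) \<bullet> b)) (at t)"
    unfolding e by (auto intro!: derivative_eq_intros simp: inner_add_left algebra_simps)
  from DERIV_chain2[OF assms this] show ?thesis by (simp add: mult.commute)
qed

text \<open>In dimension \<open>n\<close>, the Laplacian of \<open>F ((norm x)\<^sup>2)\<close> is
  \<open>4 * r * F'' r + 2 * n * F' r\<close> at \<open>r = (norm x)\<^sup>2\<close>. Hence
  \<open>1 - \<Delta>\<close> acts on profiles and stays in the class, so it can be applied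
  again.\<close>

lemma radial_class_bessel:
  assumes F: "F \<in> radial_class"
  shows "\<exists>G\<in>radial_class. \<forall>\<xi>::'a::euclidean_space.
    rfourier (\<lambda>x. G ((norm x)\<^sup>2)) \<xi> = complex_of_real (1 + 4 * pi\<^sup>2 * (norm \<xi>)\<^sup>2) * rfourier (\<lambda>x. F ((norm x)\<^sup>2)) \<xi>"
proof -
  obtain F' where F': "F' \<in> radial_class" "\<And>r. (F has_real_derivative F' r) (at r)"
    using radial_class_derivative[OF F] by blast
  obtain F'' where F'': "F'' \<in> radial_class" "\<And>r. (F' has_real_derivative F'' r) (at r)"
    using radial_class_derivative[OF F'(1)] by blast
  have cont: "continuous_on UNIV (\<lambda>x::'a. H ((norm x)\<^sup>2))" if "H \<in> radial_class" for H
    by (rule continuous_on_compose2[OF radial_class_continuous[OF that, of UNIV]]) (auto intro!: continuous_intros)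
  let ?f = "\<lambda>x::'a. F ((norm x)\<^sup>2)"
  let ?g = "\<lambda>b x::'a. 2 * (x \<bullet> b) * F' ((norm x)\<^sup>2)"
  let ?h = "\<lambda>b x::'a. 2 * F' ((norm x)\<^sup>2) + 4 * (x \<bullet> b)\<^sup>2 * F'' ((norm x)\<^sup>2)"
  have b1: "\<bar>x \<bullet> b\<bar> \<le> norm x" if "b \<in> Basis" for x b :: 'a
    using Basis_le_norm[OF that] by simp
  have b2: "norm x \<le> 1 + (norm x)\<^sup>2" for x :: 'a
    using sum_squares_ge_zero[of "norm x - 1/2" 0] by (simp add: power2_eq_square algebra_simps)
  have fi: "integrable lborel ?f"
    using radial_integrable_power[OF F, of "\<lambda>_::'a. 1"] by simp
  have fi': "integrable lborel (\<lambda>x::'a. F' ((norm x)\<^sup>2))"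
    using radial_integrable_power[OF F'(1), of "\<lambda>_::'a. 1"] by simp
  have gi: "integrable lborel (?g b)" if b: "b \<in> Basis" for b
  proof -
    have "integrable lborel (\<lambda>x. (x \<bullet> b) * F' ((norm x)\<^sup>2))"
      by (rule radial_integrable_power[OF F'(1)]) (auto intro!: continuous_intros order_trans[OF b1[OF b] b2])
    from integrable_mult_right[OF this, of 2] show ?thesis by (simp add: mult.assoc)
  qed
  have hi: "integrable lborel (?h b)" if b: "b \<in> Basis" for b
  proof -
    have "\<bar>(x \<bullet> b)\<^sup>2\<bar> \<le> 1 + (norm x)\<^sup>2" for x
      using power_mono[OF b1[OF b, of x], of 2] by simp
    then have "integrable lborel (\<lambda>x. (x \<bullet> b)\<^sup>2 * F'' ((norm x)\<^sup>2))"
      by (intro radial_integrable_power[OF F''(1)]) (auto intro!: continuous_intros)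
    then have "integrable lborel (\<lambda>x. 4 * ((x \<bullet> b)\<^sup>2 * F'' ((norm x)\<^sup>2)))" by (rule integrable_mult_right)
    from Bochner_Integration.integrable_add[OF integrable_mult_right[OF fi', of 2] this]
    show ?thesis by (simp only: mult.assoc)
  qed
  have h: "rfourier (?h b) \<xi> = complex_of_real (- (4 * pi\<^sup>2 * (b \<bullet> \<xi>)\<^sup>2)) * rfourier ?f \<xi>" if b: "b \<in> Basis" for b \<xi>
  proof -
    have "rfourier (?g b) \<xi> = 2 * pi * \<i> * complex_of_real (b \<bullet> \<xi>) * rfourier ?f \<xi>"
      by (rule fourier_directional_derivative[OF fi cont[OF F] gi[OF b]])
         (intro continuous_intros cont F', rule radial_directional_derivative[OF F'(2)])
    moreover have "rfourier (?h b) \<xi> = 2 * pi * \<i> * complex_of_real (b \<bullet> \<xi>) * rfourier (?g b) \<xi>"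
    proof (rule fourier_directional_derivative[OF gi[OF b] _ hi[OF b]])
      show "continuous_on UNIV (?g b)" "continuous_on UNIV (?h b)"
        by (intro continuous_intros cont F' F'')+
      fix x :: 'a and t
      have "((\<lambda>t. 2 * ((x + t *\<^sub>R b) \<bullet> b)) has_real_derivative 2) (at t)"
        using b by (auto intro!: derivative_eq_intros simp: inner_add_left)
      from DERIV_mult[OF this radial_directional_derivative[OF F''(2), of x b t]]
      show "((\<lambda>t. ?g b (x + t *\<^sub>R b)) has_real_derivative ?h b (x + t *\<^sub>R b)) (at t)"
        by (simp add: power2_eq_square mult_ac add.commute)
    qed
    ultimately show ?thesis by (simp add: power2_eq_square algebra_simps)
  qed
  let ?G = "\<lambda>r. F r + ((- 4) * (r * F'' r) + (- 2 * real DIM('a)) * F' r)"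
  have G: "?G \<in> radial_class"
    by (intro radial_class.add F radial_class_times F'' radial_class_scale F')
  have norm2: "(\<Sum>b\<in>Basis. (x \<bullet> b)\<^sup>2) = (norm x)\<^sup>2" for x :: 'a
    unfolding power2_norm_eq_inner by (subst (2) euclidean_inner) (simp add: power2_eq_square)
  have Geq: "?G ((norm x)\<^sup>2) = ?f x - (\<Sum>b\<in>Basis. ?h b x)" for x :: 'a
    by (simp add: sum.distrib norm2[symmetric] sum_distrib_left sum_distrib_right sum_negf mult_ac)
  have "rfourier (\<lambda>x. ?G ((norm x)\<^sup>2)) \<xi> = complex_of_real (1 + 4 * pi\<^sup>2 * (norm \<xi>)\<^sup>2) * rfourier ?f \<xi>" for \<xi> :: 'a
  proof -
    let ?e = "\<lambda>x. cis (- 2 * pi * (x \<bullet> \<xi>))"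
    have int: "integrable lborel (\<lambda>x. complex_of_real (k x) * ?e x)" if "integrable lborel k" for k :: "'a \<Rightarrow> real"
      using that by (auto intro!: integrable_mult_cis)
    have "rfourier (\<lambda>x. ?G ((norm x)\<^sup>2)) \<xi> = (LINT x|lborel. complex_of_real (?f x) * ?e x - (\<Sum>b\<in>Basis. complex_of_real (?h b x) * ?e x))"
      unfolding fourier_def Geq of_real_diff of_real_sum left_diff_distrib sum_distrib_right ..
    also have "\<dots> = rfourier ?f \<xi> - (\<Sum>b\<in>Basis. rfourier (?h b) \<xi>)"
      unfolding fourier_def using int[OF fi] int[OF hi]
      by (subst Bochner_Integration.integral_diff) (auto intro!: Bochner_Integration.integral_sum Bochner_Integration.integrable_sum)
    also have "(\<Sum>b\<in>Basis. rfourier (?h b) \<xi>) = (\<Sum>b\<in>Basis. complex_of_real (- (4 * pi\<^sup>2 * (b \<bullet> \<xi>)\<^sup>2)) * rfourier ?f \<xi>)"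
      by (intro sum.cong refl h)
    also have "\<dots> = complex_of_real (- (4 * pi\<^sup>2 * (norm \<xi>)\<^sup>2)) * rfourier ?f \<xi>"
      unfolding norm2[of \<xi>, symmetric] by (simp add: sum_distrib_left sum_distrib_right sum_negf inner_commute)
    finally show ?thesis by (simp add: algebra_simps)
  qed
  with G show ?thesis by (intro bexI[of _ ?G]) auto
qed

section \<open>Cutting the Bessel kernel near the origin\<close>

lemma cutoff_exists:
  assumes d: "0 < d"
  obtains q where "cut_profile q" "\<And>r. d \<le> r \<Longrightarrow> q r = 1"
proof -
  \<comment> \<open>Since \<open>smooth_class\<close> has no quotients, the step is a composition of
    flat functions. Below \<open>d / 2\<close> the inner one is 0 and
    \<open>exp 1 * flat 0 1 = 1\<close>, so \<open>q\<close> vanishes; \<open>K\<close> makes the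
    outer argument nonpositive from \<open>d\<close> on, so \<open>q\<close> is 1 there.\<close>
  define K where "K = 1 / flat 0 (d / 2)"
  have fd: "0 < flat 0 (d / 2)" using d by (simp add: flat_def)
  define q where "q r = 1 - exp 1 * flat 0 (1 - K * flat 0 (r - d / 2))" for r
  have id: "(\<lambda>r::real. r) \<in> smooth_class" using smooth_class.inner[of "1::real"] by simp
  have "q \<in> smooth_class"
    unfolding q_def[abs_def]
    by (intro smooth_class_diff smooth_class.mult smooth_class.flat smooth_class.const id)
  moreover have "q r = 0" if "r < d / 2" for r
    using that by (simp add: q_def flat_def flip: exp_add)
  moreover have one: "q r = 1" if "d \<le> r" for r
  proof -
    have "1 / (r - d / 2) \<le> 1 / (d / 2)" using that d by (intro divide_left_mono) auto
    then have "flat 0 (d / 2) \<le> flat 0 (r - d / 2)" using that d by (simp add: flat_def)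
    then have "1 \<le> K * flat 0 (r - d / 2)" using fd by (simp add: K_def)
    then show ?thesis by (simp add: q_def flat_def)
  qed
  have "\<forall>r>d. q r = 1 * r ^ 0" using one by simp
  ultimately have "cut_profile q" unfolding cut_profile_def using d by (meson half_gt_zero)
  then show ?thesis using one by (rule that)
qed

text \<open>The far part is a radial profile, to which \<open>1 - \<Delta>\<close> applies twice,
  giving \<open>G1\<close> and \<open>G2\<close>. The explicit \<open>bessel_heat\<close> is cut
  rather than \<open>bessel_kernel\<close>: the choice operator fixes the latter only up to null
  sets, while evenness and support are wanted at every point.\<close>

lemma bessel_parametrix:
  assumes s: "0 < s" and \<rho>: "0 < \<rho>"
  obtains B0 G1 G2 :: "'a::euclidean_space \<Rightarrow> real" where
    "integrable lborel B0" "integrable lborel G1" "integrable lborel G2"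
    "\<And>x. B0 (- x) = B0 x" "\<And>x. \<rho> \<le> norm x \<Longrightarrow> B0 x = 0" "\<And>x. G1 (- x) = G1 x"
    "\<And>\<xi>. rfourier G1 \<xi> = complex_of_real (1 + 4 * pi\<^sup>2 * (norm \<xi>)\<^sup>2) * (complex_of_real ((1 + 4 * pi\<^sup>2 * (norm \<xi>)\<^sup>2) powr (- s)) - rfourier B0 \<xi>)"
    "\<And>\<xi>. rfourier G2 \<xi> = complex_of_real (1 + 4 * pi\<^sup>2 * (norm \<xi>)\<^sup>2) * rfourier G1 \<xi>"
proof -
  \<comment> \<open>Profiles are functions of the squared norm, hence the threshold
    \<open>\<rho>\<^sup>2\<close>.\<close>
  obtain q where q: "cut_profile q" "\<And>r. \<rho>\<^sup>2 \<le> r \<Longrightarrow> q r = 1"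
    using cutoff_exists[of "\<rho>\<^sup>2"] \<rho> by auto
  define F where "F r = (1 / (4 * pi)) powr (DIM('a) / 2) / Gamma s * (q r * bessel_radial (s - DIM('a) / 2) r)" for r
  have F: "F \<in> radial_class"
    unfolding F_def[abs_def] by (intro radial_class_scale radial_class.base q)
  have Feq: "F ((norm x)\<^sup>2) = q ((norm x)\<^sup>2) * bessel_heat s x" for x :: 'a
    by (simp add: F_def bessel_heat_radial)
  obtain F1 where F1: "F1 \<in> radial_class" "\<And>\<xi>::'a. rfourier (\<lambda>x. F1 ((norm x)\<^sup>2)) \<xi> = complex_of_real (1 + 4 * pi\<^sup>2 * (norm \<xi>)\<^sup>2) * rfourier (\<lambda>x. F ((norm x)\<^sup>2)) \<xi>"
    using radial_class_bessel[OF F] by blast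
  obtain F2 where F2: "F2 \<in> radial_class" "\<And>\<xi>::'a. rfourier (\<lambda>x. F2 ((norm x)\<^sup>2)) \<xi> = complex_of_real (1 + 4 * pi\<^sup>2 * (norm \<xi>)\<^sup>2) * rfourier (\<lambda>x. F1 ((norm x)\<^sup>2)) \<xi>"
    using radial_class_bessel[OF F1(1)] by blast
  have int: "integrable lborel (\<lambda>x::'a. H ((norm x)\<^sup>2))" if "H \<in> radial_class" for H
    using radial_integrable_power[OF that, of "\<lambda>_::'a. 1"] by simp
  define B0 where "B0 x = bessel_heat s x - F ((norm x)\<^sup>2)" for x :: 'a
  have "integrable lborel B0"
    unfolding B0_def[abs_def] by (intro Bochner_Integration.integrable_diff bessel_heat_integrable s int F)
  moreover have "rfourier B0 \<xi> = complex_of_real ((1 + 4 * pi\<^sup>2 * (norm \<xi>)\<^sup>2) powr (- s)) - rfourier (\<lambda>x. F ((norm x)\<^sup>2)) \<xi>" for \<xi>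
    unfolding bessel_heat_fourier[OF s, symmetric] fourier_def B0_def of_real_diff left_diff_distrib
    using bessel_heat_integrable[OF s, where 'a='a] int[OF F]
    by (intro Bochner_Integration.integral_diff) (auto intro!: integrable_mult_cis)
  moreover have "B0 (- x) = B0 x" for x by (simp add: B0_def bessel_heat_even)
  moreover have "B0 x = 0" if "\<rho> \<le> norm x" for x
    using q(2)[of "(norm x)\<^sup>2"] power_mono[OF that, of 2] \<rho> by (simp add: B0_def Feq)
  ultimately show ?thesis
    using F1(2) F2(2) int[OF F1(1)] int[OF F2(1)]
    by (intro that[of B0 "\<lambda>x. F1 ((norm x)\<^sup>2)" "\<lambda>x. F2 ((norm x)\<^sup>2)"]) auto
qed

section \<open>Convolution on Lebesgue spaces\<close>

lemma Lp_on_UNIV_iff: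
  "Lp_on UNIV p u \<longleftrightarrow> u \<in> borel_measurable borel \<and> integrable lborel (\<lambda>x. \<bar>u x\<bar> powr p)"
proof -
  have "integrable lborel (\<lambda>x. \<bar>u x\<bar> powr p) \<longleftrightarrow> (\<integral>\<^sup>+ x. ennreal (\<bar>u x\<bar> powr p) \<partial>lborel) < \<infinity>"
    if [measurable]: "u \<in> borel_measurable borel"
    by (simp add: integrable_iff_bounded)
  then show ?thesis by (auto simp: Lp_on_def)
qed

lemma Lp_norm_on_UNIV:
  assumes "Lp_on UNIV p u"
  shows "Lp_norm_on UNIV p u = (LINT x|lborel. \<bar>u x\<bar> powr p) powr (1 / p)"
  using assms unfolding Lp_on_UNIV_iff
  by (simp add: Lp_norm_on_def nn_integral_eq_integral integral_nonneg_AE)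

lemma indicator_times_powr:
  fixes a :: real
  assumes "0 < p"
  shows "indicator A x * \<bar>a\<bar> powr p = \<bar>indicator A x * a\<bar> powr p"
  using assms by (simp add: indicator_def)

lemma Lp_on_zero_extension:
  assumes "Lp_on A p f" "0 < p"
  shows "Lp_on UNIV p (\<lambda>x. indicator A x * f x)"
    and "Lp_norm_on UNIV p (\<lambda>x. indicator A x * f x) = Lp_norm_on A p f"
  using assms unfolding Lp_on_def Lp_norm_on_def by (simp_all add: indicator_times_powr)

text \<open>Above the level \<open>l\<close>, the nonpositive exponent gives
  \<open>\<bar>u\<bar> powr (1 - p) \<le> l powr (1 - p)\<close>. Optimizing the free level
  \<open>l\<close> later takes the place of Hoelder's inequality.\<close>

lemma abs_le_powr_interpolation:
  fixes u l p :: real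
  assumes "0 < l" "1 \<le> p"
  shows "\<bar>u\<bar> \<le> l + l powr (1 - p) * \<bar>u\<bar> powr p"
proof (cases "\<bar>u\<bar> \<le> l")
  case True
  then show ?thesis by (simp add: add_increasing2)
next
  case False
  then have u: "0 < \<bar>u\<bar>" "l < \<bar>u\<bar>" using assms by auto
  have "\<bar>u\<bar> = \<bar>u\<bar> powr (1 - p) * \<bar>u\<bar> powr p"
    using u by (simp add: powr_add[symmetric])
  also have "\<dots> \<le> l powr (1 - p) * \<bar>u\<bar> powr p"
    using u assms by (intro mult_right_mono powr_mono2') auto
  finally show ?thesis using assms by simp
qed

lemma abs_le_1_plus_powr: "1 \<le> p \<Longrightarrow> \<bar>u::real\<bar> \<le> 1 + \<bar>u\<bar> powr p"
  using abs_le_powr_interpolation[of 1 p u] by simp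

lemma Lp_locally_integrable:
  fixes u :: "'a::euclidean_space \<Rightarrow> real"
  assumes u: "Lp_on UNIV p u" and p: "1 \<le> p"
  shows "integrable lborel (\<lambda>x. indicator (cball 0 r) x * u x)"
proof -
  have [measurable]: "u \<in> borel_measurable borel" and i: "integrable lborel (\<lambda>x. \<bar>u x\<bar> powr p)"
    using u by (auto simp: Lp_on_UNIV_iff)
  have "integrable lborel (indicator (cball (0::'a) r) :: 'a \<Rightarrow> real)"
    using emeasure_lborel_cball_finite by (intro integrable_real_indicator) auto
  from Bochner_Integration.integrable_add[OF this i]
  show ?thesis
  proof (rule Bochner_Integration.integrable_bound)
    show "AE x in lborel. norm (indicator (cball 0 r) x * u x) \<le> norm (indicator (cball 0 r) x + \<bar>u x\<bar> powr p)"
      using abs_le_1_plus_powr[OF p] by (intro AE_I2) (auto simp: indicator_def abs_mult)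
    show "(\<lambda>x. indicator (cball 0 r) x * u x) \<in> borel_measurable lborel"
      unfolding measurable_lborel1 by (intro borel_measurable_times borel_measurable_indicator) auto
  qed
qed

lemma integrable_conv_kernel:
  fixes K u :: "'a::euclidean_space \<Rightarrow> real"
  assumes K: "integrable lborel K" and [measurable]: "u \<in> borel_measurable borel" and p: "1 \<le> p"
    and V: "integrable lborel (\<lambda>y. K (x - y) * \<bar>u y\<bar> powr p)"
  shows "integrable lborel (\<lambda>y. K (x - y) * u y)"
proof -
  have [measurable]: "K \<in> borel_measurable borel" using K by auto
  have "integrable lborel (\<lambda>y. \<bar>K (x - y)\<bar> + \<bar>K (x - y) * \<bar>u y\<bar> powr p\<bar>)"
    using integrable_reflect_at[OF K, of x] V by simp
  then show ?thesis
  proof (rule Bochner_Integration.integrable_bound)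
    show "AE y in lborel. norm (K (x - y) * u y) \<le> norm (\<bar>K (x - y)\<bar> + \<bar>K (x - y) * \<bar>u y\<bar> powr p\<bar>)"
    proof (intro AE_I2)
      fix y
      have "\<bar>K (x - y)\<bar> * \<bar>u y\<bar> \<le> \<bar>K (x - y)\<bar> * (1 + \<bar>u y\<bar> powr p)"
        by (intro mult_left_mono abs_le_1_plus_powr p) auto
      then show "norm (K (x - y) * u y) \<le> norm (\<bar>K (x - y)\<bar> + \<bar>K (x - y) * \<bar>u y\<bar> powr p\<bar>)"
        by (simp add: abs_mult distrib_left)
    qed
  qed measurable
qed

text \<open>Hoelder's inequality up to a factor: the interpolation bound with \<open>l = (V / k) powr (1 / p)\<close>.\<close>

lemma conv_powr_le:
  fixes K u :: "'a::euclidean_space \<Rightarrow> real"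
  assumes K: "integrable lborel K" and [measurable]: "u \<in> borel_measurable borel" and p: "1 \<le> p"
    and V: "integrable lborel (\<lambda>y. \<bar>K (x - y)\<bar> * \<bar>u y\<bar> powr p)"
    and k: "(LINT y|lborel. \<bar>K y\<bar>) \<le> k" "0 < k"
  shows "\<bar>conv K u x\<bar> powr p \<le> (2 * k) powr p / k * (LINT y|lborel. \<bar>K (x - y)\<bar> * \<bar>u y\<bar> powr p)"
proof -
  have [measurable]: "K \<in> borel_measurable borel" using K by auto
  let ?V = "LINT y|lborel. \<bar>K (x - y)\<bar> * \<bar>u y\<bar> powr p"
  let ?I = "LINT y|lborel. \<bar>K (x - y)\<bar> * \<bar>u y\<bar>"
  have V0: "0 \<le> ?V" by (intro Bochner_Integration.integral_nonneg) auto
  have I0: "0 \<le> ?I" by (intro Bochner_Integration.integral_nonneg) auto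
  have Kx: "(LINT y|lborel. \<bar>K (x - y)\<bar>) = (LINT y|lborel. \<bar>K y\<bar>)"
    by (rule integral_reflect_at[of "\<lambda>y. \<bar>K y\<bar>"]) measurable
  have Ki: "integrable lborel (\<lambda>y. \<bar>K (x - y)\<bar>)"
    using integrable_reflect_at[OF K, of x] by simp
  have I: "?I \<le> l * k + l powr (1 - p) * ?V" if l: "0 < l" for l
  proof -
    have "?I \<le> (LINT y|lborel. l * \<bar>K (x - y)\<bar> + l powr (1 - p) * (\<bar>K (x - y)\<bar> * \<bar>u y\<bar> powr p))"
    proof (rule integral_mono')
      show "integrable lborel (\<lambda>y. l * \<bar>K (x - y)\<bar> + l powr (1 - p) * (\<bar>K (x - y)\<bar> * \<bar>u y\<bar> powr p))"
        by (intro Bochner_Integration.integrable_add integrable_mult_right Ki V)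
      fix y
      have "\<bar>K (x - y)\<bar> * \<bar>u y\<bar> \<le> \<bar>K (x - y)\<bar> * (l + l powr (1 - p) * \<bar>u y\<bar> powr p)"
        by (intro mult_left_mono abs_le_powr_interpolation l p) auto
      then show "\<bar>K (x - y)\<bar> * \<bar>u y\<bar> \<le> l * \<bar>K (x - y)\<bar> + l powr (1 - p) * (\<bar>K (x - y)\<bar> * \<bar>u y\<bar> powr p)"
        by (simp add: distrib_left mult_ac)
      then show "0 \<le> l * \<bar>K (x - y)\<bar> + l powr (1 - p) * (\<bar>K (x - y)\<bar> * \<bar>u y\<bar> powr p)"
        by (rule order_trans[rotated]) simp
    qed
    also have "\<dots> = l * (LINT y|lborel. \<bar>K (x - y)\<bar>) + l powr (1 - p) * ?V"
      using Ki V by simp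
    also have "\<dots> \<le> l * k + l powr (1 - p) * ?V"
      unfolding Kx using k l by (intro add_right_mono mult_left_mono) auto
    finally show ?thesis .
  qed
  have "?I powr p \<le> (2 * k) powr p / k * ?V"
  proof (cases "?V = 0")
    case True
    \<comment> \<open>The balancing level would be 0 here. The bound reduces to
      \<open>?I \<le> l * k\<close> for every positive \<open>l\<close>, and
      \<open>l = ?I / (2 * k)\<close> excludes a positive \<open>?I\<close>.\<close>
    have "?I = 0"
    proof (rule ccontr)
      assume "?I \<noteq> 0"
      from not_sym[OF this] have "0 < ?I" by (rule order_le_neq_trans[OF I0])
      then have "?I \<le> ?I / 2" using I[of "?I / (2 * k)"] k True by simp
      then show False using \<open>0 < ?I\<close> by simp
    qed
    then show ?thesis using V0 k by simp
  next
    case False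
    from not_sym[OF this] have Vp: "0 < ?V" by (rule order_le_neq_trans[OF V0])
    \<comment> \<open>At this level the two terms \<open>l * k\<close> and
      \<open>l powr (1 - p) * ?V\<close> are equal, which is the source of the factor 2.\<close>
    define l where "l = (?V / k) powr (1 / p)"
    have l: "0 < l" using Vp k by (simp add: l_def)
    have lp: "l powr p = ?V / k" using Vp k p by (simp add: l_def powr_powr)
    have "l powr (1 - p) * ?V = l * k"
      using l Vp k by (simp add: powr_diff lp)
    then have "?I \<le> 2 * k * l" using I[OF l] by simp
    then have "?I powr p \<le> (2 * k * l) powr p" using I0 p by (intro powr_mono2) auto
    also have "\<dots> = (2 * k) powr p * (?V / k)" using k l by (simp only: powr_mult lp)
    finally show ?thesis by simp
  qed
  moreover have "\<bar>conv K u x\<bar> \<le> ?I"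
    unfolding conv_def using integral_norm_bound[of lborel "\<lambda>y. K (x - y) * u y"] by (simp add: abs_mult)
  then have "\<bar>conv K u x\<bar> powr p \<le> ?I powr p" using p by (intro powr_mono2) auto
  ultimately show ?thesis by simp
qed

lemma borel_measurable_conv:
  assumes [measurable]: "f \<in> borel_measurable borel" "g \<in> borel_measurable borel"
  shows "conv f g \<in> borel_measurable borel"
  unfolding conv_def[abs_def] by measurable

text \<open>Young's inequality up to a factor 2: the pointwise bound is integrated with Fubini. A
  positive \<open>k\<close> above the norm of \<open>K\<close> permits division even when
  \<open>K\<close> vanishes. The third claim later justifies splitting convolutions of sums.\<close>

lemma conv_Lp:
  fixes K u :: "'a::euclidean_space \<Rightarrow> real"
  assumes K: "integrable lborel K" and u: "Lp_on UNIV p u" and p: "1 \<le> p"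
    and k: "(LINT y|lborel. \<bar>K y\<bar>) \<le> k" "0 < k"
  shows "Lp_on UNIV p (conv K u)"
    and "(LINT x|lborel. \<bar>conv K u x\<bar> powr p) \<le> (2 * k) powr p * (LINT x|lborel. \<bar>u x\<bar> powr p)"
    and "AE x in lborel. integrable lborel (\<lambda>y. K (x - y) * u y)"
proof -
  have [measurable]: "K \<in> borel_measurable borel" using K by auto
  have um [measurable]: "u \<in> borel_measurable borel" and i: "integrable lborel (\<lambda>x. \<bar>u x\<bar> powr p)"
    using u by (auto simp: Lp_on_UNIV_iff)
  have aK: "integrable lborel (\<lambda>x. \<bar>K x\<bar>)" using K by simp
  have pair: "integrable (lborel \<Otimes>\<^sub>M lborel) (\<lambda>(x, y). \<bar>K (x - y)\<bar> * \<bar>u y\<bar> powr p)"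
    by (rule integrable_conv_pair[OF aK i])
  let ?W = "\<lambda>x. LINT y|lborel. \<bar>K (x - y)\<bar> * \<bar>u y\<bar> powr p"
  have W: "AE x in lborel. integrable lborel (\<lambda>y. \<bar>K (x - y)\<bar> * \<bar>u y\<bar> powr p)"
    by (rule lborel_pair.AE_integrable_fst[OF pair])
  have Wi: "integrable lborel ?W" by (rule lborel_pair.integrable_fst[OF pair])
  have Weq: "(LINT x|lborel. ?W x) = (LINT y|lborel. \<bar>K y\<bar>) * (LINT x|lborel. \<bar>u x\<bar> powr p)"
  proof -
    have "(LINT x|lborel. ?W x) = (LINT y|lborel. LINT x|lborel. \<bar>K (x - y)\<bar> * \<bar>u y\<bar> powr p)"
      by (rule lborel_pair.Fubini_integral[OF pair, symmetric])
    also have "\<dots> = (LINT y|lborel. (LINT y|lborel. \<bar>K y\<bar>) * \<bar>u y\<bar> powr p)"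
      by (simp add: integral_translate_diff[of "\<lambda>x. \<bar>K x\<bar>"])
    finally show ?thesis by simp
  qed
  show "AE x in lborel. integrable lborel (\<lambda>y. K (x - y) * u y)"
    using W
  proof eventually_elim
    fix x assume "integrable lborel (\<lambda>y. \<bar>K (x - y)\<bar> * \<bar>u y\<bar> powr p)"
    then have "integrable lborel (\<lambda>y. K (x - y) * \<bar>u y\<bar> powr p)"
      by (rule Bochner_Integration.integrable_bound) (auto simp: abs_mult)
    then show "integrable lborel (\<lambda>y. K (x - y) * u y)"
      by (rule integrable_conv_kernel[OF K um p])
  qed
  have bd: "AE x in lborel. \<bar>conv K u x\<bar> powr p \<le> (2 * k) powr p / k * ?W x"
    using W by eventually_elim (rule conv_powr_le[OF K _ p _ k], auto)
  have [measurable]: "conv K u \<in> borel_measurable borel" by (intro borel_measurable_conv) measurable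
  have ci: "integrable lborel (\<lambda>x. \<bar>conv K u x\<bar> powr p)"
  proof (rule Bochner_Integration.integrable_bound[OF integrable_mult_right[OF Wi, of "(2 * k) powr p / k"]])
    show "AE x in lborel. norm (\<bar>conv K u x\<bar> powr p) \<le> norm ((2 * k) powr p / k * ?W x)"
      using bd
    proof eventually_elim
      fix x assume *: "\<bar>conv K u x\<bar> powr p \<le> (2 * k) powr p / k * ?W x"
      have "norm (\<bar>conv K u x\<bar> powr p) = \<bar>conv K u x\<bar> powr p" by simp
      also note *
      also have "(2 * k) powr p / k * ?W x \<le> norm ((2 * k) powr p / k * ?W x)"
        unfolding real_norm_def by (rule abs_ge_self)
      finally show "norm (\<bar>conv K u x\<bar> powr p) \<le> norm ((2 * k) powr p / k * ?W x)" .
    qed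
  qed measurable
  then show "Lp_on UNIV p (conv K u)" by (simp add: Lp_on_UNIV_iff)
  have "(LINT x|lborel. \<bar>conv K u x\<bar> powr p) \<le> (LINT x|lborel. (2 * k) powr p / k * ?W x)"
    by (rule integral_mono_AE[OF ci integrable_mult_right[OF Wi] bd])
  also have "\<dots> = (2 * k) powr p / k * ((LINT y|lborel. \<bar>K y\<bar>) * (LINT x|lborel. \<bar>u x\<bar> powr p))"
    by (simp only: integral_mult_right_zero Weq)
  also have "\<dots> \<le> (2 * k) powr p / k * (k * (LINT x|lborel. \<bar>u x\<bar> powr p))"
    using k by (intro mult_left_mono mult_right_mono Bochner_Integration.integral_nonneg) auto
  finally show "(LINT x|lborel. \<bar>conv K u x\<bar> powr p) \<le> (2 * k) powr p * (LINT x|lborel. \<bar>u x\<bar> powr p)"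
    using k by simp
qed

lemma powr_sum3_le:
  fixes a b c p :: real
  assumes "0 \<le> p"
  shows "\<bar>a + b + c\<bar> powr p \<le> 3 powr p * (\<bar>a\<bar> powr p + \<bar>b\<bar> powr p + \<bar>c\<bar> powr p)"
proof -
  define m where "m = max \<bar>a\<bar> (max \<bar>b\<bar> \<bar>c\<bar>)"
  have "\<bar>a + b + c\<bar> powr p \<le> (3 * m) powr p"
    using assms by (intro powr_mono2) (auto simp: m_def)
  also have "\<dots> = 3 powr p * m powr p" by (simp add: powr_mult m_def)
  also have "m powr p \<le> \<bar>a\<bar> powr p + \<bar>b\<bar> powr p + \<bar>c\<bar> powr p"
    by (auto simp: m_def max_def add_increasing add_increasing2)
  finally show ?thesis by simp
qed

lemma Lp_on_add3:
  fixes f g h :: "'a::euclidean_space \<Rightarrow> real"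
  assumes f: "Lp_on UNIV p f" and g: "Lp_on UNIV p g" and h: "Lp_on UNIV p h" and p: "0 \<le> p"
  shows "Lp_on UNIV p (\<lambda>x. f x + g x + h x)"
    and "(LINT x|lborel. \<bar>f x + g x + h x\<bar> powr p)
      \<le> 3 powr p * ((LINT x|lborel. \<bar>f x\<bar> powr p) + (LINT x|lborel. \<bar>g x\<bar> powr p) + (LINT x|lborel. \<bar>h x\<bar> powr p))"
proof -
  have [measurable]: "f \<in> borel_measurable borel" "g \<in> borel_measurable borel" "h \<in> borel_measurable borel"
    and i: "integrable lborel (\<lambda>x. \<bar>f x\<bar> powr p)" "integrable lborel (\<lambda>x. \<bar>g x\<bar> powr p)" "integrable lborel (\<lambda>x. \<bar>h x\<bar> powr p)"
    using f g h by (auto simp: Lp_on_UNIV_iff)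
  let ?b = "\<lambda>x. 3 powr p * (\<bar>f x\<bar> powr p + \<bar>g x\<bar> powr p + \<bar>h x\<bar> powr p)"
  have b: "integrable lborel ?b" using i by simp
  have s: "integrable lborel (\<lambda>x. \<bar>f x + g x + h x\<bar> powr p)"
    by (rule Bochner_Integration.integrable_bound[OF b])
       (auto intro!: order_trans[OF powr_sum3_le[OF p]])
  then show "Lp_on UNIV p (\<lambda>x. f x + g x + h x)" by (simp add: Lp_on_UNIV_iff)
  have "(LINT x|lborel. \<bar>f x + g x + h x\<bar> powr p) \<le> (LINT x|lborel. ?b x)"
    by (intro integral_mono s b powr_sum3_le p)
  then show "(LINT x|lborel. \<bar>f x + g x + h x\<bar> powr p)
      \<le> 3 powr p * ((LINT x|lborel. \<bar>f x\<bar> powr p) + (LINT x|lborel. \<bar>g x\<bar> powr p) + (LINT x|lborel. \<bar>h x\<bar> powr p))"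
    using i by simp
qed

lemma Lp_on_uminus: "Lp_on UNIV p u \<Longrightarrow> Lp_on UNIV p (\<lambda>x. - u x)"
  by (simp add: Lp_on_UNIV_iff)

text \<open>Fubini at one fixed \<open>x\<close>, with absolute convergence of the iterated integral
  as hypothesis. Smoothness of a test function needs the identity at every point, whereas for
  \<open>L^p\<close> functions only almost every \<open>x\<close> qualifies.\<close>

lemma conv_assoc_at:
  fixes f g h :: "'a::euclidean_space \<Rightarrow> real"
  assumes f: "integrable lborel f" and g: "integrable lborel g" and [measurable]: "h \<in> borel_measurable borel"
    and i: "integrable lborel (\<lambda>z. conv (\<lambda>x. \<bar>f x\<bar>) (\<lambda>x. \<bar>g x\<bar>) (x - z) * h z)"
  shows "conv f (conv g h) x = conv (conv f g) h x"
proof -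
  have [measurable]: "f \<in> borel_measurable borel" "g \<in> borel_measurable borel" using f g by auto
  let ?H = "\<lambda>z y. f (x - y) * g (y - z) * h z"
  have shift: "(LINT y|lborel. f' (x - y) * g' (y - z)) = conv f' g' (x - z)"
    if [measurable]: "f' \<in> borel_measurable borel" "g' \<in> borel_measurable borel" for f' g' :: "'a \<Rightarrow> real" and z
    using integral_translate_diff[of "\<lambda>y. f' (x - z - y) * g' y" z] by (simp add: conv_def algebra_simps)
  have aef: "integrable lborel (\<lambda>x. \<bar>f x\<bar>)" and aeg: "integrable lborel (\<lambda>x. \<bar>g x\<bar>)" using f g by auto
  have "AE w in lborel. integrable lborel (\<lambda>y. f (w - y) * g y)"
    by (rule lborel_pair.AE_integrable_fst[OF integrable_conv_pair[OF f g]])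
  then have AE: "AE z in lborel. integrable lborel (\<lambda>y. f (x - z - y) * g y)"
    by (rule AE_reflect_at)
  have pair: "integrable (lborel \<Otimes>\<^sub>M lborel) (case_prod ?H)"
  proof (rule lborel_pair.Fubini_integrable)
    have "(LINT y|lborel. norm (?H z y)) = conv (\<lambda>x. \<bar>f x\<bar>) (\<lambda>x. \<bar>g x\<bar>) (x - z) * \<bar>h z\<bar>" for z
      using shift[of "\<lambda>x. \<bar>f x\<bar>" "\<lambda>x. \<bar>g x\<bar>" z] by (simp add: abs_mult)
    moreover have "0 \<le> conv (\<lambda>x. \<bar>f x\<bar>) (\<lambda>x. \<bar>g x\<bar>) w" for w
      unfolding conv_def by (intro Bochner_Integration.integral_nonneg) auto
    ultimately have n: "(LINT y|lborel. norm (case_prod ?H (z, y))) = \<bar>conv (\<lambda>x. \<bar>f x\<bar>) (\<lambda>x. \<bar>g x\<bar>) (x - z) * h z\<bar>" for z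
      by (simp add: abs_mult)
    show "integrable lborel (\<lambda>z. LINT y|lborel. norm (case_prod ?H (z, y)))"
      unfolding n using i by (rule integrable_abs)
    show "AE z in lborel. integrable lborel (\<lambda>y. case_prod ?H (z, y))"
      using AE
    proof eventually_elim
      fix z assume "integrable lborel (\<lambda>y. f (x - z - y) * g y)"
      from integrable_translate_diff[OF this, of z]
      show "integrable lborel (\<lambda>y. case_prod ?H (z, y))" by (simp add: algebra_simps)
    qed
  qed measurable
  have "conv (conv f g) h x = (LINT z|lborel. LINT y|lborel. ?H z y)"
    unfolding conv_def[of "conv f g"] integral_mult_left_zero shift[OF \<open>f \<in> _\<close> \<open>g \<in> _\<close>] ..
  also have "\<dots> = (LINT y|lborel. LINT z|lborel. ?H z y)"
    by (rule lborel_pair.Fubini_integral[OF pair, symmetric])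
  also have "\<dots> = conv f (conv g h) x"
    unfolding conv_def by (simp add: mult.assoc)
  finally show ?thesis by simp
qed

lemma conv_assoc_AE:
  fixes f g h :: "'a::euclidean_space \<Rightarrow> real"
  assumes f: "integrable lborel f" and g: "integrable lborel g" and h: "Lp_on UNIV p h" and p: "1 \<le> p"
  shows "AE x in lborel. conv f (conv g h) x = conv (conv f g) h x"
proof -
  have a: "integrable lborel (\<lambda>x. \<bar>f x\<bar>)" "integrable lborel (\<lambda>x. \<bar>g x\<bar>)" using f g by auto
  let ?k = "conv (\<lambda>x. \<bar>f x\<bar>) (\<lambda>x. \<bar>g x\<bar>)"
  have "0 < (LINT y|lborel. \<bar>?k y\<bar>) + 1" by (intro add_nonneg_pos Bochner_Integration.integral_nonneg) auto
  from conv_Lp(3)[OF integrable_conv[OF a] h p _ this]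
  have "AE x in lborel. integrable lborel (\<lambda>z. ?k (x - z) * h z)" by simp
  then show ?thesis
    by eventually_elim (rule conv_assoc_at[OF f g], use h in \<open>auto simp: Lp_on_UNIV_iff\<close>)
qed

text \<open>Reflection preserves null sets, so kernels equal almost everywhere give convolutions
  equal at every point.\<close>

lemma conv_cong_AE:
  fixes f g h :: "'a::euclidean_space \<Rightarrow> real"
  assumes "AE x in lborel. f x = g x" and [measurable]: "f \<in> borel_measurable borel" "g \<in> borel_measurable borel" "h \<in> borel_measurable borel"
  shows "conv f h x = conv g h x"
  unfolding conv_def
proof (rule integral_cong_AE)
  show "AE y in lborel. f (x - y) * h y = g (x - y) * h y"
    using AE_reflect_at[OF assms(1), of x] by eventually_elim simp
qed measurable

text \<open>Evenness of \<open>K\<close> lets Fubini move the convolution from \<open>\<psi>\<close>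
  to \<open>u\<close>. For joint integrability,
  \<open>\<bar>u\<bar> \<le> 1 + \<bar>u\<bar> powr p\<close>: the term 1 uses that
  \<open>\<psi>\<close> is integrable, the power uses that \<open>\<psi>\<close> is bounded.\<close>

lemma conv_duality:
  fixes K u \<psi> :: "'a::euclidean_space \<Rightarrow> real"
  assumes K: "integrable lborel K" "\<And>x. K (- x) = K x" and u: "Lp_on UNIV p u" and p: "1 \<le> p"
    and \<psi>: "integrable lborel \<psi>" "\<And>x. \<bar>\<psi> x\<bar> \<le> M"
  shows "integrable lborel (\<lambda>x. u x * conv K \<psi> x)"
    and "integrable lborel (\<lambda>x. conv K u x * \<psi> x)"
    and "(LINT x|lborel. u x * conv K \<psi> x) = (LINT x|lborel. conv K u x * \<psi> x)"
proof -
  have [measurable]: "K \<in> borel_measurable borel" "\<psi> \<in> borel_measurable borel" using K \<psi> by auto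
  have [measurable]: "u \<in> borel_measurable borel" and i: "integrable lborel (\<lambda>x. \<bar>u x\<bar> powr p)"
    using u by (auto simp: Lp_on_UNIV_iff)
  let ?H = "\<lambda>x y. u x * (K (x - y) * \<psi> y)"
  have M0: "0 \<le> M" using \<psi>(2)[of 0] by simp
  have b1: "integrable (lborel \<Otimes>\<^sub>M lborel) (\<lambda>(x, y). \<bar>K (x - y)\<bar> * \<bar>\<psi> y\<bar>)"
    by (rule integrable_conv_pair[of "\<lambda>x. \<bar>K x\<bar>" "\<lambda>x. \<bar>\<psi> x\<bar>"]) (use K \<psi> in auto)
  have b2: "integrable (lborel \<Otimes>\<^sub>M lborel) (\<lambda>(x, y). \<bar>u x\<bar> powr p * (\<bar>K (x - y)\<bar> * M))"
  proof (rule lborel_pair.Fubini_integrable)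
    have n: "(LINT y|lborel. norm (\<bar>u x\<bar> powr p * (\<bar>K (x - y)\<bar> * M))) = \<bar>u x\<bar> powr p * ((LINT y|lborel. \<bar>K y\<bar>) * M)" for x
      using M0 by (simp add: abs_mult integral_reflect_at[of "\<lambda>y. \<bar>K y\<bar>"])
    show "integrable lborel (\<lambda>x. LINT y|lborel. norm (case (x, y) of (x, y) \<Rightarrow> \<bar>u x\<bar> powr p * (\<bar>K (x - y)\<bar> * M)))"
      unfolding split_conv n using i by simp
    show "AE x in lborel. integrable lborel (\<lambda>y. case (x, y) of (x, y) \<Rightarrow> \<bar>u x\<bar> powr p * (\<bar>K (x - y)\<bar> * M))"
      using integrable_reflect_at[OF integrable_abs[OF K(1)]] by simp
  qed measurable
  have pair: "integrable (lborel \<Otimes>\<^sub>M lborel) (case_prod ?H)"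
  proof (rule Bochner_Integration.integrable_bound[OF Bochner_Integration.integrable_add[OF b1 b2]])
    have "\<bar>?H x y\<bar> \<le> \<bar>K (x - y)\<bar> * \<bar>\<psi> y\<bar> + \<bar>u x\<bar> powr p * (\<bar>K (x - y)\<bar> * M)" for x y
    proof -
      have "\<bar>?H x y\<bar> \<le> (1 + \<bar>u x\<bar> powr p) * (\<bar>K (x - y)\<bar> * \<bar>\<psi> y\<bar>)"
        unfolding abs_mult by (intro mult_right_mono abs_le_1_plus_powr p) auto
      also have "\<dots> \<le> \<bar>K (x - y)\<bar> * \<bar>\<psi> y\<bar> + \<bar>u x\<bar> powr p * (\<bar>K (x - y)\<bar> * M)"
        unfolding distrib_right mult_1_left by (intro add_left_mono mult_left_mono \<psi>) auto
      finally show ?thesis .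
    qed
    then show "AE z in lborel \<Otimes>\<^sub>M lborel. norm (case_prod ?H z)
      \<le> norm ((case z of (x, y) \<Rightarrow> \<bar>K (x - y)\<bar> * \<bar>\<psi> y\<bar>) + (case z of (x, y) \<Rightarrow> \<bar>u x\<bar> powr p * (\<bar>K (x - y)\<bar> * M)))"
      by (intro AE_I2) (auto simp: case_prod_beta intro: order_trans[OF _ abs_ge_self])
  qed measurable
  have 1: "(LINT y|lborel. ?H x y) = u x * conv K \<psi> x" for x
    by (simp add: conv_def)
  have 2: "(LINT x|lborel. ?H x y) = conv K u y * \<psi> y" for y
  proof -
    have "K (x - y) = K (y - x)" for x using K(2)[of "y - x"] by simp
    then have H: "?H x y = K (y - x) * u x * \<psi> y" for x by simp
    show ?thesis unfolding conv_def H integral_mult_left_zero ..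
  qed
  show "integrable lborel (\<lambda>x. u x * conv K \<psi> x)"
    using lborel_pair.integrable_fst[OF pair] unfolding 1 .
  show "integrable lborel (\<lambda>x. conv K u x * \<psi> x)"
    using lborel_pair.integrable_snd[OF pair] unfolding 2 .
  show "(LINT x|lborel. u x * conv K \<psi> x) = (LINT x|lborel. conv K u x * \<psi> x)"
    using lborel_pair.Fubini_integral[OF pair] unfolding 1 2 by simp
qed

section \<open>Local representation of solutions\<close>

text \<open>The function \<open>bessel_heat s\<close> witnesses that the choice defining
  \<open>bessel_kernel\<close> is not vacuous.\<close>

lemma bessel_kernel_fourier:
  assumes "0 < s"
  shows "integrable lborel (bessel_kernel s :: 'a::euclidean_space \<Rightarrow> real)"
    and "rfourier (bessel_kernel s) (\<xi>::'a) = complex_of_real ((1 + 4 * pi\<^sup>2 * (norm \<xi>)\<^sup>2) powr (- s))"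
proof -
  have "\<exists>B::'a \<Rightarrow> real. integrable lborel B \<and>
      (\<forall>\<xi>. rfourier B \<xi> = complex_of_real ((1 + 4 * pi\<^sup>2 * (norm \<xi>)\<^sup>2) powr (- s)))"
    using bessel_heat_integrable[OF assms] bessel_heat_fourier[OF assms] by blast
  from someI_ex[OF this] show "integrable lborel (bessel_kernel s :: 'a \<Rightarrow> real)"
    "rfourier (bessel_kernel s) \<xi> = complex_of_real ((1 + 4 * pi\<^sup>2 * (norm \<xi>)\<^sup>2) powr (- s))"
    unfolding bessel_kernel_def[symmetric] by blast+
qed

text \<open>On the Fourier side everything is multiplication by powers of \<open>w\<close>. The
  kernel identities hold almost everywhere because they come from uniqueness of the transform, but
  evenness of \<open>R\<close> holds everywhere, being inherited from its two convolution
  factors.\<close>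

lemma parametrix_kernels:
  assumes s: "0 < s" "s < 1" and \<rho>: "0 < \<rho>"
  obtains B0 R H :: "'a::euclidean_space \<Rightarrow> real" where
    "integrable lborel B0" "integrable lborel R" "integrable lborel H"
    "\<And>x. B0 (- x) = B0 x" "\<And>x. R (- x) = R x" "\<And>x. \<rho> \<le> norm x \<Longrightarrow> B0 x = 0"
    "\<And>\<xi>. rfourier R \<xi> = 1 - complex_of_real ((1 + 4 * pi\<^sup>2 * (norm \<xi>)\<^sup>2) powr s) * rfourier B0 \<xi>"
    "AE x in lborel. bessel_kernel s x - conv (bessel_kernel s) R x = B0 x"
    "AE x in lborel. conv (bessel_kernel s) H x = R x"
proof (rule bessel_parametrix[OF s(1) \<rho>, where 'a = 'a])
  fix B0 G1 G2 :: "'a \<Rightarrow> real"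
  assume int: "integrable lborel B0" "integrable lborel G1" "integrable lborel G2"
    and evenB: "\<And>x. B0 (- x) = B0 x" and supp: "\<And>x. \<rho> \<le> norm x \<Longrightarrow> B0 x = 0" and evenG: "\<And>x. G1 (- x) = G1 x"
    and G1: "\<And>\<xi>. rfourier G1 \<xi> = complex_of_real (1 + 4 * pi\<^sup>2 * (norm \<xi>)\<^sup>2) * (complex_of_real ((1 + 4 * pi\<^sup>2 * (norm \<xi>)\<^sup>2) powr (- s)) - rfourier B0 \<xi>)"
    and G2: "\<And>\<xi>. rfourier G2 \<xi> = complex_of_real (1 + 4 * pi\<^sup>2 * (norm \<xi>)\<^sup>2) * rfourier G1 \<xi>"
  define w where "w \<xi> = 1 + 4 * pi\<^sup>2 * (norm \<xi>)\<^sup>2" for \<xi> :: 'a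
  have w: "0 < w \<xi>" for \<xi> unfolding w_def by (intro add_pos_nonneg) auto
  let ?A = "bessel_heat (1 - s) :: 'a \<Rightarrow> real" and ?B = "bessel_kernel s :: 'a \<Rightarrow> real"
  have A: "integrable lborel ?A" "\<And>\<xi>. rfourier ?A \<xi> = complex_of_real (w \<xi> powr (s - 1))"
    using bessel_heat_integrable[of "1 - s"] bessel_heat_fourier[of "1 - s"] s by (auto simp: w_def)
  have B: "integrable lborel ?B" "\<And>\<xi>. rfourier ?B \<xi> = complex_of_real (w \<xi> powr (- s))"
    using bessel_kernel_fourier[OF s(1)] by (auto simp: w_def)
  define R where "R = conv ?A G1"
  \<comment> \<open>Two factors \<open>w powr (s - 1)\<close> and the additional \<open>w\<close> in
    \<open>G2\<close> make the transform of \<open>H\<close> equal to \<open>w powr s\<close> times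
    that of \<open>R\<close>.\<close>
  define H where "H = conv ?A (conv ?A G2)"
  have R: "integrable lborel R" and H: "integrable lborel H"
    unfolding R_def H_def by (intro integrable_conv A int)+
  have pw: "complex_of_real (w \<xi> powr a) * complex_of_real (w \<xi> powr b) = complex_of_real (w \<xi> powr (a + b))" for a b \<xi>
    by (simp add: powr_add)
  have w1: "complex_of_real (w \<xi>) = complex_of_real (w \<xi> powr 1)" for \<xi> using w[of \<xi>] by simp
  have inv: "complex_of_real (w \<xi> powr s) * complex_of_real (w \<xi> powr (- s)) = 1"
    and inv': "complex_of_real (w \<xi> powr (- s)) * complex_of_real (w \<xi> powr s) = 1" for \<xi>
    unfolding pw using w[of \<xi>] by simp_all
  have FR: "rfourier R \<xi> = 1 - complex_of_real (w \<xi> powr s) * rfourier B0 \<xi>" for \<xi>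
  proof -
    have "rfourier R \<xi> = complex_of_real (w \<xi> powr (s - 1)) * complex_of_real (w \<xi> powr 1) * (complex_of_real (w \<xi> powr (- s)) - rfourier B0 \<xi>)"
      unfolding R_def fourier_conv[OF A(1) int(2)] A(2) G1 w_def[symmetric] w1 by (simp only: mult.assoc)
    also have "\<dots> = complex_of_real (w \<xi> powr s) * complex_of_real (w \<xi> powr (- s)) - complex_of_real (w \<xi> powr s) * rfourier B0 \<xi>"
      unfolding pw[of \<xi> "s - 1" 1] by (simp add: right_diff_distrib)
    finally show ?thesis unfolding inv .
  qed
  have FH: "rfourier H \<xi> = complex_of_real (w \<xi> powr s) * rfourier R \<xi>" for \<xi>
  proof -
    have "rfourier H \<xi> = complex_of_real (w \<xi> powr (s - 1)) * complex_of_real (w \<xi> powr 1) * rfourier R \<xi>"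
      unfolding H_def R_def fourier_conv[OF A(1) integrable_conv[OF A(1) int(3)]] fourier_conv[OF A(1) int(3)]
        fourier_conv[OF A(1) int(2)] G2 w_def[symmetric] w1 A(2)
      by (simp only: mult.left_commute mult.assoc)
    then show ?thesis unfolding pw by simp
  qed
  have "\<exists>\<kappa> :: nat \<Rightarrow> 'a \<Rightarrow> real. mollifiers \<kappa>" by (rule mollifiers_exist) (erule exI)
  then obtain \<kappa> :: "nat \<Rightarrow> 'a \<Rightarrow> real" where "mollifiers \<kappa>" ..
  then interpret M: mollifiers \<kappa> .
  have "AE x in lborel. conv ?B R x = ?B x - B0 x"
  proof (rule M.fourier_eq_imp_AE_eq)
    show "integrable lborel (conv ?B R)" by (intro integrable_conv B R)
    show "integrable lborel (\<lambda>x. ?B x - B0 x)" using B(1) int(1) by simp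
    have "rfourier (\<lambda>x. ?B x - B0 x) \<xi> = rfourier ?B \<xi> - rfourier B0 \<xi>" for \<xi>
      unfolding fourier_def of_real_diff left_diff_distrib using B(1) int(1)
      by (intro Bochner_Integration.integral_diff) (auto intro!: integrable_mult_cis)
    moreover have "complex_of_real (w \<xi> powr (- s)) * (complex_of_real (w \<xi> powr s) * z) = z" for \<xi> z
      unfolding mult.assoc[symmetric] inv' by simp
    ultimately show "rfourier (conv ?B R) \<xi> = rfourier (\<lambda>x. ?B x - B0 x) \<xi>" for \<xi>
      unfolding fourier_conv[OF B(1) R] FR B(2) by (simp add: right_diff_distrib)
  qed
  then have 1: "AE x in lborel. ?B x - conv ?B R x = B0 x"
    by eventually_elim simp
  have 2: "AE x in lborel. conv ?B H x = R x"
  proof (rule M.fourier_eq_imp_AE_eq[OF _ R])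
    show "integrable lborel (conv ?B H)" by (intro integrable_conv B H)
    show "rfourier (conv ?B H) \<xi> = rfourier R \<xi>" for \<xi>
      unfolding fourier_conv[OF B(1) H] FH B(2) mult.assoc[symmetric] inv' by simp
  qed
  have 3: "R (- x) = R x" for x
    unfolding R_def using A(1) int(2) evenG by (intro conv_even) (auto simp: bessel_heat_even)
  show ?thesis
    by (rule that[OF int(1) R H evenB 3 supp _ 1 2]) (use FR in \<open>simp_all add: w_def\<close>)
qed

lemma integrable_Lp_times_bounded:
  fixes u \<psi> :: "'a::euclidean_space \<Rightarrow> real"
  assumes u: "Lp_on UNIV p u" and p: "1 \<le> p" and \<psi>: "integrable lborel \<psi>" "\<And>x. \<bar>\<psi> x\<bar> \<le> M"
  shows "integrable lborel (\<lambda>x. u x * \<psi> x)"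
proof -
  have [measurable]: "\<psi> \<in> borel_measurable borel" using \<psi> by auto
  have [measurable]: "u \<in> borel_measurable borel" and i: "integrable lborel (\<lambda>x. \<bar>u x\<bar> powr p)"
    using u by (auto simp: Lp_on_UNIV_iff)
  have "integrable lborel (\<lambda>x. \<bar>\<psi> x\<bar> + \<bar>u x\<bar> powr p * M)" using i \<psi>(1) by simp
  then show ?thesis
  proof (rule Bochner_Integration.integrable_bound)
    show "AE x in lborel. norm (u x * \<psi> x) \<le> norm (\<bar>\<psi> x\<bar> + \<bar>u x\<bar> powr p * M)"
    proof (intro AE_I2)
      fix x
      have "\<bar>u x * \<psi> x\<bar> \<le> (1 + \<bar>u x\<bar> powr p) * \<bar>\<psi> x\<bar>"
        unfolding abs_mult by (intro mult_right_mono abs_le_1_plus_powr p) auto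
      also have "\<dots> \<le> \<bar>\<psi> x\<bar> + \<bar>u x\<bar> powr p * M"
        unfolding distrib_right mult_1_left by (intro add_left_mono mult_left_mono \<psi>) auto
      finally show "norm (u x * \<psi> x) \<le> norm (\<bar>\<psi> x\<bar> + \<bar>u x\<bar> powr p * M)"
        unfolding real_norm_def by (rule order_trans[OF _ abs_ge_self])
    qed
  qed measurable
qed

lemma bump_smooth_compact:
  assumes "0 < e"
  shows "smooth_compact (bump e a)"
proof -
  have "bump e a x = 0" if "norm a + e < norm x" for x
    using bump_supp[OF assms, of a x] norm_triangle_ineq[of a "x - a"] that by fastforce
  then show ?thesis unfolding smooth_compact_def using bump_smooth by blast
qed

text \<open>The self-convolution of a bump is not presented as a member of
  \<open>smooth_class\<close>. Associativity moves one bump to the kernel, leaving an integrable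
  kernel convolved with a single translated bump.\<close>

lemma conv_bump_bump_smooth_fun:
  fixes K :: "'a::euclidean_space \<Rightarrow> real"
  assumes K: "integrable lborel K" and e: "0 < e"
  shows "smooth_fun (conv K (\<lambda>x. c * conv (bump e 0) (bump e 0) (x - a)))"
proof -
  have b: "integrable lborel (bump e (a::'a))" for a by (rule bump_integrable[OF e])
  then have [measurable]: "bump e (a::'a) \<in> borel_measurable borel" for a by auto
  obtain M where M: "\<And>x. \<bar>bump e a x\<bar> \<le> M"
    using smooth_compact_bounded[OF bump_smooth_compact[OF e]] by blast
  have shift: "conv (bump e 0) (bump e 0) (x - a) = conv (bump e 0) (bump e a) x" for x
  proof -
    have "conv (bump e 0) (bump e a) x = (LINT y|lborel. bump e 0 (x - a - (y - a)) * bump e 0 (y - a))"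
      by (simp add: conv_def bump_translate[of e a])
    also have "\<dots> = conv (bump e 0) (bump e 0) (x - a)"
      unfolding conv_def by (rule integral_translate_diff[of "\<lambda>y. bump e 0 (x - a - y) * bump e 0 y"]) measurable
    finally show ?thesis by simp
  qed
  have "conv K (\<lambda>x. c * conv (bump e 0) (bump e 0) (x - a)) x = conv (\<lambda>x. c * conv K (bump e 0) x) (bump e a) x" for x
  proof -
    have "integrable lborel (\<lambda>z. conv (\<lambda>x. \<bar>K x\<bar>) (\<lambda>x. \<bar>bump e 0 x\<bar>) (x - z) * bump e a z)"
    proof (rule Bochner_Integration.integrable_bound)
      have k: "integrable lborel (conv (\<lambda>x. \<bar>K x\<bar>) (\<lambda>x. \<bar>bump e (0::'a) x\<bar>))"
        by (intro integrable_conv integrable_abs K b)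
      show "integrable lborel (\<lambda>z. M * conv (\<lambda>x. \<bar>K x\<bar>) (\<lambda>x. \<bar>bump e 0 x\<bar>) (x - z))"
        using integrable_reflect_at[OF k, of x] by simp
      have [measurable]: "conv (\<lambda>x. \<bar>K x\<bar>) (\<lambda>x. \<bar>bump e (0::'a) x\<bar>) \<in> borel_measurable borel" using k by auto
      show "(\<lambda>z. conv (\<lambda>x. \<bar>K x\<bar>) (\<lambda>x. \<bar>bump e 0 x\<bar>) (x - z) * bump e a z) \<in> borel_measurable lborel" by measurable
      show "AE z in lborel. norm (conv (\<lambda>x. \<bar>K x\<bar>) (\<lambda>x. \<bar>bump e 0 x\<bar>) (x - z) * bump e a z)
        \<le> norm (M * conv (\<lambda>x. \<bar>K x\<bar>) (\<lambda>x. \<bar>bump e 0 x\<bar>) (x - z))"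
        using order_trans[OF M abs_ge_self] by (intro AE_I2) (simp add: abs_mult mult.commute mult_right_mono)
    qed
    from conv_assoc_at[OF K b _ this] have "conv K (conv (bump e 0) (bump e a)) x = conv (conv K (bump e 0)) (bump e a) x"
      by simp
    then show ?thesis unfolding shift by (simp add: conv_def mult.assoc mult.left_commute[of _ c])
  qed
  then have "conv K (\<lambda>x. c * conv (bump e 0) (bump e 0) (x - a)) = conv (\<lambda>x. c * conv K (bump e 0) x) (bump e a)" ..
  moreover have "smooth_fun (conv (\<lambda>x. c * conv K (bump e 0) x) (bump e a))"
    by (intro conv_smooth_fun bump_smooth_compact e integrable_mult_right integrable_conv K b)
  ultimately show ?thesis by simp
qed

text \<open>By \<open>FR\<close> the growing symbol cancels: the integrand of the inverse transform
  becomes a difference of two integrable functions. Inversion handles the first, the multiplication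
  formula the second.\<close>

lemma bessel_op_parametrix:
  fixes B0 R \<psi> :: "'a::euclidean_space \<Rightarrow> real"
  assumes B0: "integrable lborel B0" and R: "integrable lborel R"
    and FR: "\<And>\<xi>. rfourier R \<xi> = 1 - complex_of_real ((1 + 4 * pi\<^sup>2 * (norm \<xi>)\<^sup>2) powr s) * rfourier B0 \<xi>"
    and \<psi>: "integrable lborel \<psi>" "integrable lborel (rfourier \<psi>)" "\<And>x. ifourier (rfourier \<psi>) x = complex_of_real (\<psi> x)"
  shows "bessel_op s (conv B0 \<psi>) x = complex_of_real (\<psi> x - conv R \<psi> x)"
proof -
  have [measurable]: "R \<in> borel_measurable borel" "\<psi> \<in> borel_measurable borel" using R \<psi> by auto
  have Rc: "integrable lborel (\<lambda>x. complex_of_real (R x))" using R by simp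
  have "bessel_op s (conv B0 \<psi>) x = ifourier (\<lambda>\<xi>. rfourier \<psi> \<xi> - rfourier R \<xi> * rfourier \<psi> \<xi>) x"
    unfolding bessel_op_def fourier_conv[OF B0 \<psi>(1)] FR by (simp add: algebra_simps)
  also have "\<dots> = ifourier (rfourier \<psi>) x - ifourier (\<lambda>\<xi>. rfourier R \<xi> * rfourier \<psi> \<xi>) x"
    unfolding ifourier_def left_diff_distrib
    by (intro Bochner_Integration.integral_diff integrable_mult_cis \<psi> integrable_fourier_mult Rc) auto
  also have "ifourier (\<lambda>\<xi>. rfourier R \<xi> * rfourier \<psi> \<xi>) x = (LINT y|lborel. complex_of_real (R y * \<psi> (x - y)))"
    unfolding ifourier_fourier_mult[OF Rc \<psi>(2)] \<psi>(3) of_real_mult ..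
  also have "\<dots> = complex_of_real (LINT y|lborel. R y * \<psi> (x - y))" by (rule integral_complex_of_real)
  also have "(LINT y|lborel. R y * \<psi> (x - y)) = conv R \<psi> x"
    using integral_reflect_at[of "\<lambda>y. R (x - y) * \<psi> y" x] by (simp add: conv_def)
  finally show ?thesis using \<psi>(3) by simp
qed

text \<open>The support lies in the Minkowski sum of \<open>K\<close> and the closed ball of radius
  \<open>\<rho>\<close>, which is compact and therefore also contains the closure.\<close>

lemma test_fun_conv:
  fixes B0 \<psi> :: "'a::euclidean_space \<Rightarrow> real"
  assumes sm: "smooth_fun (conv B0 \<psi>)" and B0: "\<And>x. \<rho> \<le> norm x \<Longrightarrow> B0 x = 0"
    and \<psi>: "\<And>x. \<psi> x \<noteq> 0 \<Longrightarrow> x \<in> K" and K: "compact K"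
    and sub: "\<And>x z. x \<in> K \<Longrightarrow> norm z \<le> \<rho> \<Longrightarrow> x + z \<in> \<Omega>"
  shows "test_fun \<Omega> (conv B0 \<psi>)"
proof -
  let ?S = "{x + z |x z. x \<in> K \<and> z \<in> cball 0 \<rho>}"
  have S: "compact ?S" by (rule compact_sums[OF K compact_cball])
  have "conv B0 \<psi> x = 0" if "x \<notin> ?S" for x
  proof -
    have "B0 (x - y) * \<psi> y = 0" for y
    proof (rule ccontr)
      assume n: "B0 (x - y) * \<psi> y \<noteq> 0"
      then have "\<not> \<rho> \<le> norm (x - y)" "y \<in> K" using B0 \<psi> by auto
      then have "y + (x - y) \<in> ?S" by (intro CollectI exI[of _ y] exI[of _ "x - y"]) auto
      then show False using that by simp
    qed
    then show ?thesis unfolding conv_def by (simp only:) simp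
  qed
  then have "{x. conv B0 \<psi> x \<noteq> 0} \<subseteq> ?S" by blast
  then have t: "tsupport (conv B0 \<psi>) \<subseteq> ?S"
    unfolding tsupport_def by (rule closure_minimal) (rule compact_imp_closed[OF S])
  moreover have "compact (tsupport (conv B0 \<psi>))"
    using compact_Int_closed[OF S closed_closure[of "{x. conv B0 \<psi> x \<noteq> 0}"]] t
    unfolding tsupport_def by (simp add: Int_absorb1)
  moreover have "?S \<subseteq> \<Omega>" using sub by auto
  ultimately show ?thesis using sm unfolding test_fun_def by blast
qed

text \<open>Duality moves \<open>R\<close> and \<open>B0\<close> from the mollifier to
  \<open>u\<close> and the extended \<open>f\<close>, so the tested equation says that the residual
  \<open>w\<close> has vanishing mollified averages in \<open>U\<close>. The residual is a sum of
  \<open>L^p\<close> functions and hence locally integrable.\<close>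

lemma dist_solution_local_representation:
  fixes \<Omega> U :: "'a::euclidean_space set" and B0 R :: "'a \<Rightarrow> real"
  assumes sol: "dist_solution s \<Omega> f u" and f: "Lp_on \<Omega> p f" and u: "Lp_on UNIV p u" and p: "1 \<le> p"
    and U: "open U" and sub: "\<And>x z. x \<in> U \<Longrightarrow> norm z \<le> \<rho> \<Longrightarrow> x + z \<in> \<Omega>"
    and B0: "integrable lborel B0" "\<And>x. B0 (- x) = B0 x" "\<And>x. \<rho> \<le> norm x \<Longrightarrow> B0 x = 0"
    and R: "integrable lborel R" "\<And>x. R (- x) = R x"
    and FR: "\<And>\<xi>. rfourier R \<xi> = 1 - complex_of_real ((1 + 4 * pi\<^sup>2 * (norm \<xi>)\<^sup>2) powr s) * rfourier B0 \<xi>"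
  shows "AE x in lborel. x \<in> U \<longrightarrow> u x = conv R u x + conv B0 (\<lambda>x. indicator \<Omega> x * f x) x"
proof (rule mollifiers_exist[where 'a = 'a])
  fix \<kappa> :: "nat \<Rightarrow> 'a \<Rightarrow> real" and c e
  assume "mollifiers \<kappa>" and e: "\<And>m. 0 < e m" and \<kappa>: "\<And>m x. \<kappa> m x = c m * conv (bump (e m) 0) (bump (e m) 0) x"
  interpret M: mollifiers \<kappa> by fact
  let ?F = "\<lambda>x. indicator \<Omega> x * f x"
  have F: "Lp_on UNIV p ?F" using Lp_on_zero_extension(1)[OF f] p by simp
  define w where "w x = u x - conv R u x - conv B0 ?F x" for x
  have pos: "0 < (LINT y|lborel. \<bar>K y\<bar>) + 1" for K :: "'a \<Rightarrow> real"
    by (intro add_nonneg_pos Bochner_Integration.integral_nonneg) auto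
  have Ru: "Lp_on UNIV p (conv R u)" by (rule conv_Lp(1)[OF R(1) u p _ pos[of R]]) simp
  have BF: "Lp_on UNIV p (conv B0 ?F)" by (rule conv_Lp(1)[OF B0(1) F p _ pos[of B0]]) simp
  have "AE x in lborel. x \<in> U \<longrightarrow> w x = 0"
  proof (rule M.AE_zero_if_mollified_zero[OF U])
    show "integrable lborel (\<lambda>x. indicator (cball 0 r) x * w x)" for r
      using Lp_locally_integrable[OF u p, of r] Lp_locally_integrable[OF Ru p, of r] Lp_locally_integrable[OF BF p, of r]
      by (simp add: w_def right_diff_distrib)
    show "w \<in> borel_measurable borel"
      using u Ru BF unfolding w_def[abs_def] Lp_on_UNIV_iff by (intro borel_measurable_diff) auto
    fix m and x0 :: 'a assume x0: "cball x0 (1 / real (Suc m)) \<subseteq> U"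
    define \<psi> where "\<psi> y = \<kappa> m (y - x0)" for y
    have \<psi>i: "integrable lborel \<psi>"
      unfolding \<psi>_def by (rule integrable_translate_diff[OF M.int])
    have \<psi>c: "continuous_on UNIV \<psi>"
      unfolding \<psi>_def[abs_def] by (rule continuous_on_compose2[OF M.cont[of m]]) (auto intro!: continuous_intros)
    obtain N where N: "\<And>x. \<bar>\<psi> x\<bar> \<le> N" using M.bounded[of m] by (auto simp: \<psi>_def)
    have F\<psi>: "rfourier \<psi> \<xi> = rfourier (\<kappa> m) \<xi> * cis (- 2 * pi * (x0 \<bullet> \<xi>))" for \<xi>
    proof -
      have "rfourier \<psi> \<xi> = (LINT y|lborel. complex_of_real (\<kappa> m (y - x0)) * cis (- 2 * pi * ((y - x0 + x0) \<bullet> \<xi>)))"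
        by (simp add: fourier_def \<psi>_def)
      also have "\<dots> = (LINT y|lborel. complex_of_real (\<kappa> m y) * cis (- 2 * pi * ((y + x0) \<bullet> \<xi>)))"
        by (rule integral_translate_diff[where f = "\<lambda>y. complex_of_real (\<kappa> m y) * cis (- 2 * pi * ((y + x0) \<bullet> \<xi>))"]) measurable
      also have "\<dots> = (LINT y|lborel. complex_of_real (\<kappa> m y) * cis (- 2 * pi * (y \<bullet> \<xi>)) * cis (- 2 * pi * (x0 \<bullet> \<xi>)))"
        by (simp add: inner_add_left distrib_left mult.assoc cis_mult)
      finally show ?thesis by (simp add: fourier_def)
    qed
    have F\<psi>i: "integrable lborel (rfourier \<psi>)"
      unfolding F\<psi>[abs_def] by (intro integrable_mult_cis M.fourier_int) measurable
    have inv: "ifourier (rfourier \<psi>) x = complex_of_real (\<psi> x)" for x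
      by (rule fourier_inversion[OF \<psi>i \<psi>c N F\<psi>i])
    have "test_fun \<Omega> (conv B0 \<psi>)"
    proof (rule test_fun_conv[OF _ B0(3), where K = "cball x0 (1 / real (Suc m))"])
      show "smooth_fun (conv B0 \<psi>)"
        unfolding \<psi>_def \<kappa> by (rule conv_bump_bump_smooth_fun[OF B0(1) e])
      show "x \<in> cball x0 (1 / real (Suc m))" if "\<psi> x \<noteq> 0" for x
        using M.supp[of m "x - x0"] that by (simp add: \<psi>_def dist_norm norm_minus_commute)
      show "x + z \<in> \<Omega>" if "x \<in> cball x0 (1 / real (Suc m))" "norm z \<le> \<rho>" for x z
        using sub[OF _ that(2)] x0 that(1) by blast
    qed auto
    then have "(LINT x|lborel. complex_of_real (u x) * bessel_op s (conv B0 \<psi>) x)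
        = complex_of_real (LINT x|lborel. indicator \<Omega> x * f x * conv B0 \<psi> x)"
      using sol unfolding dist_solution_def by blast
    then have "complex_of_real (LINT x|lborel. u x * (\<psi> x - conv R \<psi> x)) = complex_of_real (LINT x|lborel. ?F x * conv B0 \<psi> x)"
      unfolding bessel_op_parametrix[OF B0(1) R(1) FR \<psi>i F\<psi>i inv] of_real_mult[symmetric] integral_complex_of_real .
    then have eq: "(LINT x|lborel. u x * (\<psi> x - conv R \<psi> x)) = (LINT x|lborel. ?F x * conv B0 \<psi> x)"
      by (simp only: of_real_eq_iff)
    note dR = conv_duality[OF R u p \<psi>i N] and dB = conv_duality[OF B0(1,2) F p \<psi>i N]
    have ui: "integrable lborel (\<lambda>x. u x * \<psi> x)" by (rule integrable_Lp_times_bounded[OF u p \<psi>i N])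
    have "(LINT x|lborel. u x * (\<psi> x - conv R \<psi> x)) = (LINT x|lborel. u x * \<psi> x) - (LINT x|lborel. conv R u x * \<psi> x)"
      unfolding right_diff_distrib dR(3)[symmetric] by (rule Bochner_Integration.integral_diff[OF ui dR(1)])
    then have "(LINT x|lborel. u x * \<psi> x) - (LINT x|lborel. conv R u x * \<psi> x) - (LINT x|lborel. conv B0 ?F x * \<psi> x) = 0"
      using eq dB(3) by simp
    moreover have "(LINT x|lborel. w x * \<psi> x) = (LINT x|lborel. u x * \<psi> x) - (LINT x|lborel. conv R u x * \<psi> x) - (LINT x|lborel. conv B0 ?F x * \<psi> x)"
      unfolding w_def left_diff_distrib
      by (simp only: Bochner_Integration.integral_diff[OF Bochner_Integration.integrable_diff[OF ui dR(2)] dB(2)]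
          Bochner_Integration.integral_diff[OF ui dR(2)])
    ultimately show "(LINT y|lborel. w y * \<kappa> m (y - x0)) = 0" by (simp add: \<psi>_def)
  qed
  then show ?thesis
  proof eventually_elim
    fix x assume "x \<in> U \<longrightarrow> w x = 0"
    moreover have "u x = conv R u x + conv B0 ?F x" if "w x = 0" using that unfolding w_def by linarith
    ultimately show "x \<in> U \<longrightarrow> u x = conv R u x + conv B0 ?F x" by blast
  qed
qed

section \<open>From kernel bounds to the local Bessel norm\<close>

lemma powr_add_root_le:
  fixes X Y p :: real
  assumes "0 \<le> X" "0 \<le> Y" "0 < p"
  shows "(X + Y) powr (1 / p) \<le> 2 powr (1 / p) * (X powr (1 / p) + Y powr (1 / p))"
proof -
  have "(X + Y) powr (1 / p) \<le> (2 * max X Y) powr (1 / p)"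
    using assms by (intro powr_mono2) auto
  also have "\<dots> = 2 powr (1 / p) * max X Y powr (1 / p)" using assms by (simp add: powr_mult)
  also have "max X Y powr (1 / p) \<le> X powr (1 / p) + Y powr (1 / p)" by (auto simp: max_def)
  finally show ?thesis by simp
qed

text \<open>The representing \<open>g\<close> keeps the set of norms nonempty; without a member its
  \<open>Inf\<close> could not be bounded below.\<close>

lemma bessel_norm_nonneg: "bessel_rep s p v g \<Longrightarrow> 0 \<le> bessel_norm s p v"
  unfolding bessel_norm_def by (intro cInf_greatest) (auto simp: Lp_norm_on_def)

lemma bessel_norm_le:
  assumes "bessel_rep s p v g"
  shows "bessel_norm s p v \<le> Lp_norm_on UNIV p g"
  unfolding bessel_norm_def
  by (rule cInf_lower) (use assms in \<open>auto intro!: bdd_belowI[of _ 0] simp: Lp_norm_on_def\<close>)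

lemma loc_bessel_norm_le:
  assumes "w \<in> bessel_space s p" and "AE x in lborel. x \<in> A \<longrightarrow> w x = v x"
  shows "loc_bessel_norm s p A v \<le> bessel_norm s p w"
  unfolding loc_bessel_norm_def
proof (rule cInf_lower)
  show "bdd_below {bessel_norm s p w |w. w \<in> bessel_space s p \<and> (AE x in lborel. x \<in> A \<longrightarrow> w x = v x)}"
    by (rule bdd_belowI[of _ 0]) (auto simp: bessel_space_def intro: bessel_norm_nonneg)
qed (use assms in blast)

theorem theorem5p1:
  fixes \<Omega> \<Omega>' :: "'a::euclidean_space set" and s p :: real
  assumes "open \<Omega>" and "bounded \<Omega>"
    and "compact (closure \<Omega>')" and "closure \<Omega>' \<subseteq> \<Omega>"
    and "0 < s" and "s < 1" and "1 < p"
  shows "\<exists>C>0. \<forall>f u. Lp_on \<Omega> p f \<longrightarrow> Lp_on UNIV p u \<longrightarrow> dist_solution s \<Omega> f u \<longrightarrow>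
           u \<in> loc_bessel_space s p \<Omega>' \<and>
           loc_bessel_norm s p \<Omega>' u \<le> C * (Lp_norm_on \<Omega> p f + Lp_norm_on UNIV p u)"
proof -
  have p: "1 \<le> p" "0 < p" using assms(7) by auto
  obtain d where d: "0 < d" "(\<Union>x\<in>closure \<Omega>'. ball x d) \<subseteq> \<Omega>"
    using compact_subset_open_imp_ball_epsilon_subset[OF assms(3,1,4)] by blast
  define U where "U = (\<Union>x\<in>closure \<Omega>'. ball x (d / 2))"
  have U: "open U" unfolding U_def by auto
  have \<Omega>'U: "\<Omega>' \<subseteq> U" unfolding U_def using d(1) closure_subset[of \<Omega>'] by force
  \<comment> \<open>Points of \<open>U\<close> are within \<open>d / 2\<close> of the closure of
    \<open>\<Omega>'\<close>; a further displacement by \<open>d / 4\<close> stays below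
    \<open>d\<close>, hence inside \<open>\<Omega>\<close>.\<close>
  define \<rho> where "\<rho> = d / 4"
  have \<rho>: "0 < \<rho>" using d by (simp add: \<rho>_def)
  have sub: "x + z \<in> \<Omega>" if "x \<in> U" "norm z \<le> \<rho>" for x z
  proof -
    obtain y where y: "y \<in> closure \<Omega>'" "dist y x < d / 2" using \<open>x \<in> U\<close> by (auto simp: U_def)
    have "dist y (x + z) \<le> dist y x + norm z" using dist_triangle[of y "x + z" x] by (simp add: dist_norm)
    then have "x + z \<in> ball y d" using y that(2) d(1) by (simp add: \<rho>_def)
    then show ?thesis using y(1) d(2) by blast
  qed
  show ?thesis
  proof (rule parametrix_kernels[OF assms(5,6) \<rho>, where 'a = 'a])
    fix B0 R H :: "'a \<Rightarrow> real"
    assume B0: "integrable lborel B0" and R: "integrable lborel R" and H: "integrable lborel H"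
      and evB: "\<And>x. B0 (- x) = B0 x" and evR: "\<And>x. R (- x) = R x" and supp: "\<And>x. \<rho> \<le> norm x \<Longrightarrow> B0 x = 0"
      and FR: "\<And>\<xi>. rfourier R \<xi> = 1 - complex_of_real ((1 + 4 * pi\<^sup>2 * (norm \<xi>)\<^sup>2) powr s) * rfourier B0 \<xi>"
      and BR: "AE x in lborel. bessel_kernel s x - conv (bessel_kernel s) R x = B0 x"
      and BH: "AE x in lborel. conv (bessel_kernel s) H x = R x"
    let ?B = "bessel_kernel s :: 'a \<Rightarrow> real"
    have B: "integrable lborel ?B" by (rule bessel_kernel_fourier(1)[OF assms(5)])
    have [measurable]: "B0 \<in> borel_measurable borel" "R \<in> borel_measurable borel" "H \<in> borel_measurable borel" "?B \<in> borel_measurable borel"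
      using B0 R H B by auto
    \<comment> \<open>Adding 1 makes the bound positive for every kernel, as Young's inequality in
      the above form requires.\<close>
    define k where "k K = (LINT y|lborel. \<bar>K y\<bar>) + 1" for K :: "'a \<Rightarrow> real"
    have kpos: "0 < k K" for K
      unfolding k_def by (intro add_nonneg_pos Bochner_Integration.integral_nonneg) auto
    have kle: "(LINT y|lborel. \<bar>K y\<bar>) \<le> k K" for K by (simp add: k_def)
    note Lp = conv_Lp[OF _ _ p(1) kle kpos]
    \<comment> \<open>The factor \<open>3 powr p\<close> comes from the three summands of
      \<open>g\<close>, the powers of \<open>2 * k R\<close> and \<open>2 * k H\<close> from Young's
      inequality. The kernels were fixed before \<open>f\<close> and \<open>u\<close>, so the
      constant is uniform in both.\<close>
    define M where "M = 3 powr p * (1 + (2 * k R) powr p + (2 * k H) powr p)"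
    have M: "0 < M" unfolding M_def by (intro mult_pos_pos add_pos_nonneg) auto
    define C where "C = M powr (1 / p) * 2 powr (1 / p)"
    have C: "0 < C" using M by (simp add: C_def)
    show ?thesis
    proof (intro exI[of _ C] conjI allI impI C)
      fix f u assume f: "Lp_on \<Omega> p f" and u: "Lp_on UNIV p u" and sol: "dist_solution s \<Omega> f u"
      define F where "F x = indicator \<Omega> x * f x" for x
      have F: "Lp_on UNIV p F" and nF: "Lp_norm_on UNIV p F = Lp_norm_on \<Omega> p f"
        unfolding F_def using Lp_on_zero_extension[OF f p(2)] by auto
      have [measurable]: "F \<in> borel_measurable borel" "u \<in> borel_measurable borel"
        using F u by (auto simp: Lp_on_UNIV_iff)
      let ?RF = "conv R F" and ?Hu = "conv H u"
      \<comment> \<open>Chosen so that \<open>B * g\<close> regroups as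
        \<open>(B - B * R) * F + (B * H) * u\<close>, that is \<open>B0 * F + R * u\<close>.\<close>
      define g where "g x = F x + - ?RF x + ?Hu x" for x
      have RF: "Lp_on UNIV p ?RF" and Hu: "Lp_on UNIV p ?Hu"
        by (rule Lp(1)[OF R F], rule Lp(1)[OF H u])
      have g: "Lp_on UNIV p g"
        unfolding g_def[abs_def] by (rule Lp_on_add3(1)[OF F Lp_on_uminus[OF RF] Hu]) (use p in simp)
      define v where "v = conv ?B g"
      have v: "Lp_on UNIV p v" unfolding v_def by (rule Lp(1)[OF B g])
      have rep: "bessel_rep s p v g" unfolding bessel_rep_def v_def using g by simp
      have vs: "v \<in> bessel_space s p" unfolding bessel_space_def using v rep by blast
      have rep_u: "AE x in lborel. x \<in> U \<longrightarrow> u x = conv R u x + conv B0 F x"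
        unfolding F_def[abs_def]
        by (rule dist_solution_local_representation[OF sol f u p(1) U sub B0 evB supp R evR FR])
      \<comment> \<open>Splitting the convolution with \<open>g\<close> is legitimate only where
        each integral converges, so several almost-everywhere facts are intersected.\<close>
      have vU: "AE x in lborel. x \<in> \<Omega>' \<longrightarrow> v x = u x"
        using rep_u Lp(3)[OF B F] Lp(3)[OF B RF] Lp(3)[OF B Hu] Lp(3)[OF integrable_conv[OF B R] F]
          conv_assoc_AE[OF B R F p(1)] conv_assoc_AE[OF B H u p(1)]
      proof eventually_elim
        fix x
        assume u_eq: "x \<in> U \<longrightarrow> u x = conv R u x + conv B0 F x"
          and i: "integrable lborel (\<lambda>y. ?B (x - y) * F y)" "integrable lborel (\<lambda>y. ?B (x - y) * ?RF y)"
            "integrable lborel (\<lambda>y. ?B (x - y) * ?Hu y)" "integrable lborel (\<lambda>y. conv ?B R (x - y) * F y)"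
          and a: "conv ?B (conv R F) x = conv (conv ?B R) F x" "conv ?B (conv H u) x = conv (conv ?B H) u x"
        have "v x = conv ?B F x - conv ?B ?RF x + conv ?B ?Hu x"
          unfolding v_def conv_def[of ?B] g_def using i(1-3)
          by (simp add: distrib_left right_diff_distrib)
        also have "\<dots> = (conv ?B F x - conv (conv ?B R) F x) + conv (conv ?B H) u x"
          by (simp only: a)
        also have "conv ?B F x - conv (conv ?B R) F x = conv (\<lambda>x. ?B x - conv ?B R x) F x"
          unfolding conv_def[of _ F] left_diff_distrib by (rule Bochner_Integration.integral_diff[OF i(1,4), symmetric])
        also have "\<dots> = conv B0 F x"
          by (rule conv_cong_AE[OF BR]) (use B integrable_conv[OF B R] in auto)
        also have "conv (conv ?B H) u x = conv R u x"
          by (rule conv_cong_AE[OF BH]) (use integrable_conv[OF B H] in auto)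
        finally show "x \<in> \<Omega>' \<longrightarrow> v x = u x" using u_eq \<Omega>'U by auto
      qed
      show "u \<in> loc_bessel_space s p \<Omega>'"
        unfolding loc_bessel_space_def using vs vU by blast
      let ?X = "LINT x|lborel. \<bar>F x\<bar> powr p" and ?Y = "LINT x|lborel. \<bar>u x\<bar> powr p"
      have XY: "0 \<le> ?X" "0 \<le> ?Y" by (intro Bochner_Integration.integral_nonneg; simp)+
      have "(LINT x|lborel. \<bar>g x\<bar> powr p)
        \<le> 3 powr p * (?X + (LINT x|lborel. \<bar>- ?RF x\<bar> powr p) + (LINT x|lborel. \<bar>?Hu x\<bar> powr p))"
        unfolding g_def by (rule Lp_on_add3(2)[OF F Lp_on_uminus[OF RF] Hu]) (use p in simp)
      also have "\<dots> \<le> 3 powr p * (?X + (2 * k R) powr p * ?X + (2 * k H) powr p * ?Y)"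
        using Lp(2)[OF R F] Lp(2)[OF H u] by (intro mult_left_mono add_mono) auto
      also have "\<dots> \<le> M * (?X + ?Y)"
      proof -
        have "?X + a * ?X + b * ?Y \<le> (1 + a + b) * (?X + ?Y)" if "0 \<le> a" "0 \<le> b" for a b
        proof -
          have "0 \<le> ?Y + a * ?Y + b * ?X" using XY that by (intro add_nonneg_nonneg mult_nonneg_nonneg)
          then show ?thesis by (simp add: distrib_left distrib_right)
        qed
        then show ?thesis unfolding M_def mult.assoc by (intro mult_left_mono) auto
      qed
      finally have gM: "(LINT x|lborel. \<bar>g x\<bar> powr p) \<le> M * (?X + ?Y)" .
      \<comment> \<open>Both norms are infima, and the one competitor \<open>v\<close> with density
        \<open>g\<close> bounds each of them.\<close>
      have "loc_bessel_norm s p \<Omega>' u \<le> bessel_norm s p v" by (rule loc_bessel_norm_le[OF vs vU])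
      also have "\<dots> \<le> Lp_norm_on UNIV p g" by (rule bessel_norm_le[OF rep])
      also have "\<dots> = (LINT x|lborel. \<bar>g x\<bar> powr p) powr (1 / p)" by (rule Lp_norm_on_UNIV[OF g])
      also have "\<dots> \<le> (M * (?X + ?Y)) powr (1 / p)"
        using p by (intro powr_mono2 gM Bochner_Integration.integral_nonneg) auto
      also have "\<dots> = M powr (1 / p) * (?X + ?Y) powr (1 / p)"
        using M XY by (simp add: powr_mult)
      also have "\<dots> \<le> M powr (1 / p) * (2 powr (1 / p) * (?X powr (1 / p) + ?Y powr (1 / p)))"
        by (intro mult_left_mono powr_add_root_le XY p) auto
      also have "\<dots> = C * (Lp_norm_on \<Omega> p f + Lp_norm_on UNIV p u)"
        unfolding C_def nF[symmetric] Lp_norm_on_UNIV[OF F] Lp_norm_on_UNIV[OF u] by (simp only: mult.assoc)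
      finally show "loc_bessel_norm s p \<Omega>' u \<le> C * (Lp_norm_on \<Omega> p f + Lp_norm_on UNIV p u)" .
    qed
  qed
qed


end
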